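(* Let $n\ge 2$ and let $x: M^n\rightarrow \mathbb{R}^{n+1}_{1}$ be a complete space-like $\lambda$-hypersurface with weight $s=\langle x, x\rangle$, i.e. $H-\langle x,x\rangle\langle x,N\rangle=\lambda$ is constant on $M^n$. Suppose $S-\frac{H^{2}}{n}$ is constant. If $$4A^{2}-\frac{4HA}{n}+\left(S-\frac{H^{2}}{n}\right)I\geq 0$$ and $$\left(\sqrt{S-\frac1n H^{2}} -|\lambda|\frac{n-2}{2\sqrt{n(n-1)}}\right)^{2}+\frac{1}{n}(H-\lambda)^{2} -\frac{n\lambda^{2}}{4(n-1)}\geq 0$$ everywhere on $M^n$, then $x$ is isometric to either the hyperbolic space $\mathbb{H}^{n}(-r^{-2})\subset\mathbb{R}^{n+1}_{1}$ with $r\geq\left(\frac n2\right)^{\frac14}$ or the hyperplane $\mathbb{R}^{n}\subset\mathbb{R}^{n+1}_{1}$.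
   Context: $\mathbb{R}^{n+1}_1$ is $\mathbb{R}^{n+1}$ with the Lorentzian product $\langle X,Y\rangle=X_1Y_1+\cdots+X_nY_n-X_{n+1}Y_{n+1}$. A space-like hypersurface is an immersion $x:M^n\to\mathbb{R}^{n+1}_1$ of a connected $n$-manifold whose induced metric is Riemannian; it is complete if the induced metric is complete. The letter $x$ also denotes the position vector. $N$ is a smooth unit normal field, $\langle N,N\rangle=-1$. In a local orthonormal tangent frame $e_1,\dots,e_n$ the second fundamental form is $h_{ij}=\langle dN(e_i),e_j\rangle$; $A$ is the shape operator (with matrix $(h_{ij})$), $I$ the identity map of the tangent spaces, $H=\sum_i h_{ii}$ the mean curvature (no factor $1/n$) and $S=\sum_{i,j}h_{ij}^2$ the squared norm of the second fundamental form. An inequality $T\ge0$ for a self-adjoint endomorphism $T$ of the tangent bundle means $T$ is positive semidefinite at each point. For $r>0$, $\mathbb{H}^n(-r^{-2})=\{x\in\mathbb{R}^{n+1}_1:\langle x,x\rangle=-r^2,\ x_{n+1}>0\}$; $\mathbb{R}^n\subset\mathbb{R}^{n+1}_1$ denotes a space-like hyperplane. "Isometric to" one of these hypersurfaces means coinciding with it up to an isometry of $\mathbb{R}^{n+1}_1$. *)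

theory Defs
  imports "HOL-Analysis.Analysis"
begin

section \<open>Smooth maps on open sets\<close>

primrec Ck_on :: "nat \<Rightarrow> 'a::euclidean_space set \<Rightarrow> ('a \<Rightarrow> 'b::euclidean_space) \<Rightarrow> bool" where
  "Ck_on 0 S f \<longleftrightarrow> continuous_on S f"
| "Ck_on (Suc k) S f \<longleftrightarrow>
     f differentiable_on S \<and> (\<forall>v. Ck_on k S (\<lambda>u. frechet_derivative f (at u) v))"

text \<open>Only used for open \<open>S\<close>.\<close>

definition smooth_on :: "'a::euclidean_space set \<Rightarrow> ('a \<Rightarrow> 'b::euclidean_space) \<Rightarrow> bool" where
  "smooth_on S f \<longleftrightarrow> (\<forall>k. Ck_on k S f)"

section \<open>Smooth manifolds\<close>

text \<open>
  The underlying space is a whole type, which theorems take to be Hausdorff and second countable.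
  An atlas is a set of local parametrizations \<open>(D, \<phi>)\<close>, the inverses of charts: \<open>\<phi>\<close> maps the
  open set \<open>D\<close> homeomorphically onto an open set of the manifold. The values of \<open>\<phi>\<close> outside
  \<open>D\<close> are irrelevant.
\<close>

type_synonym ('n, 'm) param = "(real ^ 'n) set \<times> (real ^ 'n \<Rightarrow> 'm)"

abbreviation param_range :: "('n, 'm) param \<Rightarrow> 'm set" where
  "param_range c \<equiv> snd c ` fst c"

definition coords :: "('n, 'm) param \<Rightarrow> 'm \<Rightarrow> real ^ 'n" where
  "coords c = inv_into (fst c) (snd c)"

definition smooth_atlas :: "('n::finite, 'm::topological_space) param set \<Rightarrow> bool" where
  "smooth_atlas \<A> \<longleftrightarrow>
     (\<forall>c\<in>\<A>. open (fst c) \<and> open (param_range c) \<and>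
        homeomorphism (fst c) (param_range c) (snd c) (coords c)) \<and>
     (\<Union>c\<in>\<A>. param_range c) = UNIV \<and>
     (\<forall>c\<in>\<A>. \<forall>c'\<in>\<A>. smooth_on {u \<in> fst c. snd c u \<in> param_range c'} (coords c' \<circ> snd c))"

definition smooth_map ::
    "('n::finite, 'm) param set \<Rightarrow> ('m \<Rightarrow> 'b::euclidean_space) \<Rightarrow> bool" where
  "smooth_map \<A> f \<longleftrightarrow> (\<forall>c\<in>\<A>. smooth_on (fst c) (f \<circ> snd c))"

text \<open>
  The tangent space at \<open>p\<close> is identified with \<open>real ^ 'n\<close> through one fixed parametrization
  around \<open>p\<close>; everything below that is used in statements is independent of this choice.
\<close>

definition param_at :: "('n, 'm) param set \<Rightarrow> 'm \<Rightarrow> ('n, 'm) param" where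
  "param_at \<A> p = (SOME c. c \<in> \<A> \<and> p \<in> param_range c)"

definition differential ::
    "('n::finite, 'm) param set \<Rightarrow> ('m \<Rightarrow> 'b::euclidean_space) \<Rightarrow> 'm \<Rightarrow> real ^ 'n \<Rightarrow> 'b" where
  "differential \<A> f p =
     (let c = param_at \<A> p in frechet_derivative (f \<circ> snd c) (at (coords c p)))"

text \<open>At the end points of \<open>I\<close> the curve is \<open>C\<^sup>1\<close> in a two-sided neighbourhood.\<close>

definition C1_curve_on :: "('n::finite, 'm) param set \<Rightarrow> real set \<Rightarrow> (real \<Rightarrow> 'm) \<Rightarrow> bool" where
  "C1_curve_on \<A> I \<gamma> \<longleftrightarrow>
     (\<forall>t\<in>I. \<exists>c\<in>\<A>. \<exists>J. open J \<and> t \<in> J \<and> \<gamma> ` J \<subseteq> param_range c \<and>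
        (coords c \<circ> \<gamma>) C1_differentiable_on J)"

definition piecewise_C1_curve :: "('n::finite, 'm) param set \<Rightarrow> (real \<Rightarrow> 'm) \<Rightarrow> bool" where
  "piecewise_C1_curve \<A> \<gamma> \<longleftrightarrow>
     (\<exists>T. finite T \<and> {0, 1} \<subseteq> T \<and> T \<subseteq> {0..1} \<and>
        (\<forall>a\<in>T. \<forall>b\<in>T. a < b \<and> {a<..<b} \<inter> T = {} \<longrightarrow>
           (\<exists>\<eta>. C1_curve_on \<A> {a..b} \<eta> \<and> (\<forall>t\<in>{a..b}. \<gamma> t = \<eta> t))))"

definition velocity :: "('n::finite, 'm) param set \<Rightarrow> (real \<Rightarrow> 'm) \<Rightarrow> real \<Rightarrow> real ^ 'n" where
  "velocity \<A> \<gamma> t = vector_derivative (coords (param_at \<A> (\<gamma> t)) \<circ> \<gamma>) (at t)"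

section \<open>Lorentz space\<close>

text \<open>The space \<open>\<real>\<^sup>n\<^sup>+\<^sup>1\<^sub>1\<close>; the last coordinate is the second component of the pair.\<close>

type_synonym 'n lorentz_space = "(real ^ 'n) \<times> real"

definition lorentz :: "'n::finite lorentz_space \<Rightarrow> 'n lorentz_space \<Rightarrow> real" where
  "lorentz X Y = fst X \<bullet> fst Y - snd X * snd Y"

definition lorentz_isometry :: "('n::finite lorentz_space \<Rightarrow> 'n lorentz_space) \<Rightarrow> bool" where
  "lorentz_isometry F \<longleftrightarrow>
     bij F \<and> smooth_on UNIV F \<and> smooth_on UNIV (inv F) \<and>
     (\<forall>X u v. lorentz (frechet_derivative F (at X) u) (frechet_derivative F (at X) v) = lorentz u v)"

definition hyperbolic_space :: "real \<Rightarrow> 'n::finite lorentz_space set" where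
  "hyperbolic_space r = {X. lorentz X X = - r\<^sup>2 \<and> snd X > 0}"

definition standard_hyperplane :: "'n::finite lorentz_space set" where
  "standard_hyperplane = {X. snd X = 0}"

section \<open>Space-like hypersurfaces\<close>

definition induced_metric ::
    "('n::finite, 'm) param set \<Rightarrow> ('m \<Rightarrow> 'n lorentz_space) \<Rightarrow> 'm \<Rightarrow> real ^ 'n \<Rightarrow> real ^ 'n \<Rightarrow> real" where
  "induced_metric \<A> x p v w = lorentz (differential \<A> x p v) (differential \<A> x p w)"

definition spacelike_hypersurface ::
    "('n::finite, 'm::topological_space) param set \<Rightarrow> ('m \<Rightarrow> 'n lorentz_space) \<Rightarrow> bool" where
  "spacelike_hypersurface \<A> x \<longleftrightarrow>
     smooth_atlas \<A> \<and> connected (UNIV :: 'm set) \<and> smooth_map \<A> x \<and>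
     (\<forall>p. inj (differential \<A> x p)) \<and>
     (\<forall>p v. v \<noteq> 0 \<longrightarrow> induced_metric \<A> x p v v > 0)"

definition curve_length ::
    "('n::finite, 'm) param set \<Rightarrow> ('m \<Rightarrow> 'n lorentz_space) \<Rightarrow> (real \<Rightarrow> 'm) \<Rightarrow> real" where
  "curve_length \<A> x \<gamma> =
     integral {0..1} (\<lambda>t. sqrt (induced_metric \<A> x (\<gamma> t) (velocity \<A> \<gamma> t) (velocity \<A> \<gamma> t)))"

definition riemannian_dist ::
    "('n::finite, 'm) param set \<Rightarrow> ('m \<Rightarrow> 'n lorentz_space) \<Rightarrow> 'm \<Rightarrow> 'm \<Rightarrow> real" where
  "riemannian_dist \<A> x p q =
     Inf {curve_length \<A> x \<gamma> | \<gamma>. piecewise_C1_curve \<A> \<gamma> \<and> \<gamma> 0 = p \<and> \<gamma> 1 = q}"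

definition complete_hypersurface ::
    "('n::finite, 'm) param set \<Rightarrow> ('m \<Rightarrow> 'n lorentz_space) \<Rightarrow> bool" where
  "complete_hypersurface \<A> x \<longleftrightarrow> Metric_space.mcomplete UNIV (riemannian_dist \<A> x)"

definition unit_normal_field ::
    "('n::finite, 'm) param set \<Rightarrow> ('m \<Rightarrow> 'n lorentz_space) \<Rightarrow> ('m \<Rightarrow> 'n lorentz_space) \<Rightarrow> bool" where
  "unit_normal_field \<A> x N \<longleftrightarrow>
     smooth_map \<A> N \<and>
     (\<forall>p. lorentz (N p) (N p) = -1) \<and>
     (\<forall>p v. lorentz (N p) (differential \<A> x p v) = 0)"

definition orthonormal_frame ::
    "('n::finite, 'm) param set \<Rightarrow> ('m \<Rightarrow> 'n lorentz_space) \<Rightarrow> 'm \<Rightarrow> ('n \<Rightarrow> real ^ 'n) \<Rightarrow> bool" where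
  "orthonormal_frame \<A> x p e \<longleftrightarrow>
     (\<forall>i j. induced_metric \<A> x p (e i) (e j) = (if i = j then 1 else 0))"

definition frame_at ::
    "('n::finite, 'm) param set \<Rightarrow> ('m \<Rightarrow> 'n lorentz_space) \<Rightarrow> 'm \<Rightarrow> 'n \<Rightarrow> real ^ 'n" where
  "frame_at \<A> x p = (SOME e. orthonormal_frame \<A> x p e)"

definition second_fundamental_form ::
    "('n::finite, 'm) param set \<Rightarrow> ('m \<Rightarrow> 'n lorentz_space) \<Rightarrow> ('m \<Rightarrow> 'n lorentz_space) \<Rightarrow>
     'm \<Rightarrow> real ^ 'n \<Rightarrow> real ^ 'n \<Rightarrow> real" where
  "second_fundamental_form \<A> x N p v w =
     lorentz (differential \<A> N p v) (differential \<A> x p w)"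

text \<open>With this sign convention the shape operator is \<open>dN\<close>, read as a tangent vector.\<close>

definition shape_operator ::
    "('n::finite, 'm) param set \<Rightarrow> ('m \<Rightarrow> 'n lorentz_space) \<Rightarrow> ('m \<Rightarrow> 'n lorentz_space) \<Rightarrow>
     'm \<Rightarrow> real ^ 'n \<Rightarrow> real ^ 'n" where
  "shape_operator \<A> x N p v =
     (THE w. differential \<A> x p w = differential \<A> N p v)"

definition mean_curvature ::
    "('n::finite, 'm) param set \<Rightarrow> ('m \<Rightarrow> 'n lorentz_space) \<Rightarrow> ('m \<Rightarrow> 'n lorentz_space) \<Rightarrow>
     'm \<Rightarrow> real" where
  "mean_curvature \<A> x N p =
     (let e = frame_at \<A> x p in \<Sum>i\<in>UNIV. second_fundamental_form \<A> x N p (e i) (e i))"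

definition sq_norm_sff ::
    "('n::finite, 'm) param set \<Rightarrow> ('m \<Rightarrow> 'n lorentz_space) \<Rightarrow> ('m \<Rightarrow> 'n lorentz_space) \<Rightarrow>
     'm \<Rightarrow> real" where
  "sq_norm_sff \<A> x N p =
     (let e = frame_at \<A> x p in
        \<Sum>i\<in>UNIV. \<Sum>j\<in>UNIV. (second_fundamental_form \<A> x N p (e i) (e j))\<^sup>2)"

definition lambda_hypersurface ::
    "('n::finite, 'm) param set \<Rightarrow> ('m \<Rightarrow> 'n lorentz_space) \<Rightarrow> ('m \<Rightarrow> 'n lorentz_space) \<Rightarrow>
     real \<Rightarrow> bool" where
  "lambda_hypersurface \<A> x N l \<longleftrightarrow>
     (\<forall>p. mean_curvature \<A> x N p - lorentz (x p) (x p) * lorentz (x p) (N p) = l)"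

definition pos_semidef ::
    "('n::finite, 'm) param set \<Rightarrow> ('m \<Rightarrow> 'n lorentz_space) \<Rightarrow> 'm \<Rightarrow> (real ^ 'n \<Rightarrow> real ^ 'n) \<Rightarrow> bool" where
  "pos_semidef \<A> x p T \<longleftrightarrow> (\<forall>v. induced_metric \<A> x p (T v) v \<ge> 0)"

text \<open>
  \<open>x\<close> coincides, up to an isometry of Lorentz space, with the hypersurface \<open>Q\<close>. A smooth immersion
  that is a homeomorphism onto the embedded hypersurface \<open>F ` Q\<close> of the same dimension is a
  diffeomorphism onto it, and it preserves the metric because the metric on its domain is induced.
\<close>

definition isometric_to ::
    "('m::topological_space \<Rightarrow> 'n::finite lorentz_space) \<Rightarrow> 'n lorentz_space set \<Rightarrow> bool" where
  "isometric_to x Q \<longleftrightarrow> (\<exists>F y. lorentz_isometry F \<and> homeomorphism UNIV (F ` Q) x y)"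

end

theory Submission
  imports Defs
begin

text \<open>
  Write \<open>B = S - H\<^sup>2 / n\<close>, \<open>w = \<langle>x, N\<rangle>\<close> and \<open>s = \<langle>x, x\<rangle>\<close>, and let \<open>x\<^sup>T\<close> be the tangential part of \<open>x\<close>. The Simons
  identity, combined with \<open>H = \<lambda> + s w\<close>, expresses \<open>(1/2) (\<Delta>B - s \<langle>x, \<nabla>B\<rangle>)\<close> as the sum of
  \<open>|\<nabla>h|\<^sup>2 - |\<nabla>H|\<^sup>2 / n\<close>, of \<open>B w\<^sup>2\<close>, of the first hypothesis evaluated at \<open>x\<^sup>T\<close>, and of a cubic term
  that Okumura's inequality bounds below by \<open>B\<close> times the second hypothesis. All summands are
  nonnegative and \<open>B\<close> is constant, so that all of them vanish pointwise and no maximum principle is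
  needed. If \<open>B > 0\<close>, then \<open>w = 0\<close>, hence \<open>A x\<^sup>T = 0\<close>, hence \<open>x = 0\<close>, which is absurd. So the
  hypersurface is totally umbilic, \<open>dN = \<kappa> dx\<close> with \<open>\<kappa>\<close> constant. If \<open>\<kappa> = 0\<close> it lies in a hyperplane.
  Otherwise it lies in a hyperboloid of radius \<open>1 / |\<kappa>|\<close>, which the \<open>\<lambda>\<close>-equation forces to be centred
  at the origin, and the second hypothesis turns into the bound on the radius. Finally, the projection
  to \<open>\<real>\<^sup>n\<close> does not decrease lengths, so that completeness allows to continue its local sections along
  balls of any radius; hence it is a homeomorphism and \<open>x\<close> covers the whole hyperplane or one sheet
  of the hyperboloid.
\<close>

section \<open>Smooth functions\<close>

text \<open>Neither a connection nor a Laplacian is introduced. At each point a Lorentz reflection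
  makes the tangent plane horizontal, and functions are differentiated along the coordinate fields
  of the projection to that plane. At the point the metric
  \<open>\<delta>\<^sub>i\<^sub>j - z\<^sub>i z\<^sub>j\<close> is Euclidean to first order, so
  Christoffel symbols vanish and Laplacians are sums of iterated derivatives. The Codazzi equation
  and the commutation of covariant derivatives turn into symmetry of the derivatives of
  \<open>z\<close>, while the curvature terms come from second derivatives of the normal.
  Completeness speaks of lengths, but the manifold carries its own topology; two opposite estimates
  relate both to the projection. Lorentz length is at most the length of the projection, which makes
  sections of the projection Lipschitz. Conversely the projection stretches by at most the last
  component of the normal, which is locally bounded, so that limits in the Riemannian distance are
  limits in the manifold.\<close>

lemma frechet_derivative_cong_open:
  assumes "open S" "u \<in> S" "\<And>v. v \<in> S \<Longrightarrow> f v = g v"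
  shows "frechet_derivative f (at u) = frechet_derivative g (at u)"
proof -
  have "(f has_derivative F) (at u) \<longleftrightarrow> (g has_derivative F) (at u)" for F
    using assms by (metis has_derivative_transform_within_open)
  then show ?thesis by (simp add: frechet_derivative_def)
qed

lemma differentiable_on_cong_open:
  assumes "open S" "\<And>v. v \<in> S \<Longrightarrow> f v = g v" "f differentiable_on S"
  shows "g differentiable_on S"
  using assms(2,3) unfolding differentiable_on_def differentiable_def
  by (metis has_derivative_transform)

lemma differentiable_on_openD:
  assumes "f differentiable_on S" "open S" "u \<in> S"
  shows "(f has_derivative frechet_derivative f (at u)) (at u)"
  using assms frechet_derivative_works at_within_open differentiable_on_def by metis

lemma differentiable_on_openI:
  assumes "open S" "\<And>u. u \<in> S \<Longrightarrow> (f has_derivative F u) (at u)"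
  shows "f differentiable_on S"
  using assms by (metis at_within_open differentiable_def differentiable_on_def)

lemma Ck_on_cong:
  assumes "open S" "\<And>u. u \<in> S \<Longrightarrow> f u = g u" "Ck_on k S f"
  shows "Ck_on k S g"
  using assms(2,3)
proof (induction k arbitrary: f g)
  case 0
  then show ?case by (simp cong: continuous_on_cong)
next
  case (Suc k)
  have "frechet_derivative f (at u) = frechet_derivative g (at u)" if "u \<in> S" for u
    using frechet_derivative_cong_open[OF assms(1) that] Suc.prems(1) by blast
  then have "Ck_on k S (\<lambda>u. frechet_derivative g (at u) v)" for v
    using Suc.IH[of "\<lambda>u. frechet_derivative f (at u) v" "\<lambda>u. frechet_derivative g (at u) v"] Suc.prems(2)
    by simp
  moreover have "g differentiable_on S"
    by (rule differentiable_on_cong_open[OF assms(1) Suc.prems(1)]) (use Suc.prems(2) in simp_all)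
  ultimately show ?case by simp
qed

lemma Ck_on_SucD: "Ck_on (Suc k) S f \<Longrightarrow> Ck_on k S f"
  by (induction k arbitrary: f) (auto intro: differentiable_imp_continuous_on)

text \<open>With an explicit derivative \<open>F\<close> in place of
  \<open>frechet_derivative\<close>, which is a choice, the closure properties below become
  inductions on \<open>k\<close> by the usual differentiation rules.\<close>

lemma Ck_on_SucI:
  assumes "open S" "\<And>u. u \<in> S \<Longrightarrow> (f has_derivative F u) (at u)"
    and "\<And>v. Ck_on k S (\<lambda>u. F u v)"
  shows "Ck_on (Suc k) S f"
proof -
  have "F u v = frechet_derivative f (at u) v" if "u \<in> S" for u v
    using frechet_derivative_at[OF assms(2)[OF that]] by simp
  then have "Ck_on k S (\<lambda>u. frechet_derivative f (at u) v)" for v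
    using Ck_on_cong[OF assms(1) _ assms(3)[of v], of "\<lambda>u. frechet_derivative f (at u) v"] by blast
  moreover have "f differentiable_on S"
    using differentiable_on_openI[OF assms(1,2)] .
  ultimately show ?thesis by simp
qed

lemma Ck_on_SucE:
  assumes "open S" "Ck_on (Suc k) S f"
  obtains F where "\<And>u. u \<in> S \<Longrightarrow> (f has_derivative F u) (at u)" "\<And>v. Ck_on k S (\<lambda>u. F u v)"
  using assms differentiable_on_openD[OF _ assms(1)] that[of "\<lambda>u. frechet_derivative f (at u)"]
  by auto

lemma Ck_on_const: "Ck_on k S (\<lambda>u. c)"
  by (induction k arbitrary: c) (auto intro: differentiable_on_const)

lemma Ck_on_linear:
  assumes L: "bounded_linear L" and S: "open S" and f: "Ck_on k S f"
  shows "Ck_on k S (\<lambda>u. L (f u))"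
  using f
proof (induction k arbitrary: f)
  case 0
  then show ?case by (simp add: bounded_linear.continuous_on[OF L])
next
  case (Suc k)
  obtain F where F: "\<And>u. u \<in> S \<Longrightarrow> (f has_derivative F u) (at u)" "\<And>v. Ck_on k S (\<lambda>u. F u v)"
    using Ck_on_SucE[OF S Suc.prems] by metis
  show ?case
    by (rule Ck_on_SucI[OF S, where F = "\<lambda>u v. L (F u v)"])
      (auto intro: F Suc.IH bounded_linear.has_derivative[OF L])
qed

lemma Ck_on_add:
  assumes S: "open S" and "Ck_on k S f" "Ck_on k S g"
  shows "Ck_on k S (\<lambda>u. f u + g u)"
  using assms(2,3)
proof (induction k arbitrary: f g)
  case 0
  then show ?case by (simp add: continuous_on_add)
next
  case (Suc k)
  obtain F where F: "\<And>u. u \<in> S \<Longrightarrow> (f has_derivative F u) (at u)" "\<And>v. Ck_on k S (\<lambda>u. F u v)"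
    using Ck_on_SucE[OF S Suc.prems(1)] by metis
  obtain G where G: "\<And>u. u \<in> S \<Longrightarrow> (g has_derivative G u) (at u)" "\<And>v. Ck_on k S (\<lambda>u. G u v)"
    using Ck_on_SucE[OF S Suc.prems(2)] by metis
  show ?case
    by (rule Ck_on_SucI[OF S, where F = "\<lambda>u v. F u v + G u v"])
      (auto intro: F G Suc.IH has_derivative_add)
qed

text \<open>The product rule pairs one differentiated with one undifferentiated factor, which is why
  the induction runs over all \<open>f\<close> and \<open>g\<close>. Products, scalar multiples and
  the Lorentz form are instances.\<close>

lemma Ck_on_bilinear:
  assumes P: "bounded_bilinear P" and S: "open S" and "Ck_on k S f" "Ck_on k S g"
  shows "Ck_on k S (\<lambda>u. P (f u) (g u))"
  using assms(3,4)
proof (induction k arbitrary: f g)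
  case 0
  then show ?case by (simp add: bounded_bilinear.continuous_on[OF P])
next
  case (Suc k)
  obtain F where F: "\<And>u. u \<in> S \<Longrightarrow> (f has_derivative F u) (at u)" "\<And>v. Ck_on k S (\<lambda>u. F u v)"
    using Ck_on_SucE[OF S Suc.prems(1)] by metis
  obtain G where G: "\<And>u. u \<in> S \<Longrightarrow> (g has_derivative G u) (at u)" "\<And>v. Ck_on k S (\<lambda>u. G u v)"
    using Ck_on_SucE[OF S Suc.prems(2)] by metis
  show ?case
  proof (rule Ck_on_SucI[OF S, where F = "\<lambda>u v. P (f u) (G u v) + P (F u v) (g u)"])
    show "Ck_on k S (\<lambda>u. P (f u) (G u v) + P (F u v) (g u))" for v
      using Ck_on_SucD[OF Suc.prems(1)] Ck_on_SucD[OF Suc.prems(2)]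
      by (intro Ck_on_add[OF S] Suc.IH F(2) G(2))
  qed (auto intro: F G bounded_bilinear.FDERIV[OF P])
qed

text \<open>The derivative \<open>- F / f\<^sup>2\<close> contains \<open>1 / f\<close> again, but
  only to order \<open>k\<close>, so the induction closes with \<open>f\<close> fixed.\<close>

lemma Ck_on_inverse:
  fixes f :: "'a::euclidean_space \<Rightarrow> real"
  assumes S: "open S" and nz: "\<And>u. u \<in> S \<Longrightarrow> f u \<noteq> 0" and f: "Ck_on k S f"
  shows "Ck_on k S (\<lambda>u. inverse (f u))"
  using f
proof (induction k)
  case 0
  then show ?case by (simp add: continuous_on_inverse nz)
next
  case (Suc k)
  obtain F where F: "\<And>u. u \<in> S \<Longrightarrow> (f has_derivative F u) (at u)" "\<And>v. Ck_on k S (\<lambda>u. F u v)"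
    using Ck_on_SucE[OF S Suc.prems] by metis
  have mult: "Ck_on k S (\<lambda>u. g u * h u)" if "Ck_on k S g" "Ck_on k S h" for g h :: "'a \<Rightarrow> real"
    using Ck_on_bilinear[OF bounded_bilinear_mult S that] .
  show ?case
  proof (rule Ck_on_SucI[OF S, where F = "\<lambda>u v. - (inverse (f u) * F u v * inverse (f u))"])
    have "Ck_on k S (\<lambda>u. inverse (f u))"
      using Suc.IH Ck_on_SucD[OF Suc.prems] .
    then show "Ck_on k S (\<lambda>u. - (inverse (f u) * F u v * inverse (f u)))" for v
      by (intro Ck_on_linear[OF bounded_linear_minus[OF bounded_linear_ident] S] mult F(2))
    show "((\<lambda>u. inverse (f u)) has_derivative (\<lambda>v. - (inverse (f u) * F u v * inverse (f u)))) (at u)"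
      if "u \<in> S" for u
      using Deriv.has_derivative_inverse[OF nz F(1)] that by blast
  qed
qed

section \<open>Closure properties of smooth maps\<close>

lemma smooth_on_cong:
  "open S \<Longrightarrow> (\<And>u. u \<in> S \<Longrightarrow> f u = g u) \<Longrightarrow> smooth_on S f \<Longrightarrow> smooth_on S g"
  unfolding smooth_on_def using Ck_on_cong by blast

lemma smooth_on_const: "smooth_on S (\<lambda>u. c)"
  by (simp add: smooth_on_def Ck_on_const)

lemma smooth_on_linear:
  "bounded_linear L \<Longrightarrow> open S \<Longrightarrow> smooth_on S f \<Longrightarrow> smooth_on S (\<lambda>u. L (f u))"
  by (simp add: smooth_on_def Ck_on_linear)

lemma smooth_on_add:
  "open S \<Longrightarrow> smooth_on S f \<Longrightarrow> smooth_on S g \<Longrightarrow> smooth_on S (\<lambda>u. f u + g u)"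
  by (simp add: smooth_on_def Ck_on_add)

lemma smooth_on_minus:
  "open S \<Longrightarrow> smooth_on S f \<Longrightarrow> smooth_on S (\<lambda>u. - f u)"
  by (rule smooth_on_linear[OF bounded_linear_minus[OF bounded_linear_ident]])

lemma smooth_on_diff:
  "open S \<Longrightarrow> smooth_on S f \<Longrightarrow> smooth_on S g \<Longrightarrow> smooth_on S (\<lambda>u. f u - g u)"
  using smooth_on_add[OF _ _ smooth_on_minus, of S f g] by simp

lemma smooth_on_mult:
  fixes f g :: "'a::euclidean_space \<Rightarrow> real"
  shows "open S \<Longrightarrow> smooth_on S f \<Longrightarrow> smooth_on S g \<Longrightarrow> smooth_on S (\<lambda>u. f u * g u)"
  by (simp add: smooth_on_def Ck_on_bilinear[OF bounded_bilinear_mult])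

lemma smooth_on_scaleR:
  "open S \<Longrightarrow> smooth_on S f \<Longrightarrow> smooth_on S g \<Longrightarrow> smooth_on S (\<lambda>u. f u *\<^sub>R g u)"
  by (simp add: smooth_on_def Ck_on_bilinear[OF bounded_bilinear_scaleR])

lemma smooth_on_sum:
  "open S \<Longrightarrow> (\<And>i. i \<in> I \<Longrightarrow> smooth_on S (f i)) \<Longrightarrow> smooth_on S (\<lambda>u. \<Sum>i\<in>I. f i u)"
  by (induction I rule: infinite_finite_induct) (auto intro: smooth_on_const smooth_on_add)

lemma smooth_on_prod:
  fixes f :: "'i \<Rightarrow> 'a::euclidean_space \<Rightarrow> real"
  shows "open S \<Longrightarrow> (\<And>i. i \<in> I \<Longrightarrow> smooth_on S (f i)) \<Longrightarrow> smooth_on S (\<lambda>u. \<Prod>i\<in>I. f i u)"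
  by (induction I rule: infinite_finite_induct) (auto intro: smooth_on_const smooth_on_mult)

lemma smooth_on_inverse:
  fixes f :: "'a::euclidean_space \<Rightarrow> real"
  shows "open S \<Longrightarrow> (\<And>u. u \<in> S \<Longrightarrow> f u \<noteq> 0) \<Longrightarrow> smooth_on S f \<Longrightarrow> smooth_on S (\<lambda>u. inverse (f u))"
  by (simp add: smooth_on_def Ck_on_inverse)

lemma smooth_on_directional:
  "smooth_on S f \<Longrightarrow> smooth_on S (\<lambda>u. frechet_derivative f (at u) v)"
  unfolding smooth_on_def using Ck_on.simps(2) by blast

lemma smooth_on_differentiable: "smooth_on S f \<Longrightarrow> f differentiable_on S"
  unfolding smooth_on_def using Ck_on.simps(2) by blast

lemma smooth_on_has_derivative:
  "smooth_on S f \<Longrightarrow> open S \<Longrightarrow> u \<in> S \<Longrightarrow> (f has_derivative frechet_derivative f (at u)) (at u)"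
  using smooth_on_differentiable differentiable_on_openD by blast

lemma smooth_on_continuous: "smooth_on S f \<Longrightarrow> continuous_on S f"
  using smooth_on_differentiable differentiable_imp_continuous_on by blast

lemma smooth_on_ident: "smooth_on S (\<lambda>u. u)"
proof -
  have "Ck_on k S (\<lambda>u::'a. u)" for k
    by (cases k) (simp_all add: Ck_on_const frechet_derivative_at[OF has_derivative_ident, symmetric]
      differentiable_on_ident)
  then show ?thesis by (simp add: smooth_on_def)
qed

lemma smooth_on_linear_UNIV: "bounded_linear L \<Longrightarrow> smooth_on UNIV L"
  using smooth_on_linear[OF _ open_UNIV smooth_on_ident, of L] .

lemma smooth_on_vec_nth: "open S \<Longrightarrow> smooth_on S f \<Longrightarrow> smooth_on S (\<lambda>u. f u $ i)"
  by (rule smooth_on_linear[OF bounded_linear_vec_nth])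

lemma smooth_on_fst: "open S \<Longrightarrow> smooth_on S f \<Longrightarrow> smooth_on S (\<lambda>u. fst (f u))"
  by (rule smooth_on_linear[OF bounded_linear_fst])

lemma smooth_on_snd: "open S \<Longrightarrow> smooth_on S f \<Longrightarrow> smooth_on S (\<lambda>u. snd (f u))"
  by (rule smooth_on_linear[OF bounded_linear_snd])

lemma smooth_on_vec_lambda:
  assumes "open S" "\<And>i. smooth_on S (\<lambda>u. f u $ i)"
  shows "smooth_on S (f :: 'a::euclidean_space \<Rightarrow> real ^ 'n)"
proof -
  have "smooth_on S (\<lambda>u. \<Sum>i\<in>UNIV. (f u $ i) *\<^sub>R axis i 1)"
    by (intro smooth_on_sum smooth_on_scaleR assms smooth_on_const)
  moreover have "f = (\<lambda>u. \<Sum>i\<in>UNIV. (f u $ i) *\<^sub>R axis i 1)"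
    by (simp add: fun_eq_iff vec_eq_iff axis_def if_distrib cong: if_cong)
  ultimately show ?thesis by (rule ssubst[rotated])
qed

text \<open>\<open>Ck_on\<close> differentiates in constant directions. Expanding the varying
  direction \<open>V u\<close> in the basis leaves a combination of such derivatives with smooth
  coefficients.\<close>

lemma smooth_on_along_field:
  assumes "open S" "smooth_on S f" "smooth_on S V"
  shows "smooth_on S (\<lambda>u. frechet_derivative f (at u) (V u))"
proof (rule smooth_on_cong[OF assms(1)])
  show "smooth_on S (\<lambda>u. \<Sum>b\<in>Basis. (V u \<bullet> b) *\<^sub>R frechet_derivative f (at u) b)"
    by (intro smooth_on_sum smooth_on_scaleR smooth_on_directional
      smooth_on_linear[OF bounded_linear_inner_left] assms)
  fix u assume "u \<in> S"
  then have "linear (frechet_derivative f (at u))"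
    using smooth_on_has_derivative[OF assms(2,1)] has_derivative_linear by blast
  then show "(\<Sum>b\<in>Basis. (V u \<bullet> b) *\<^sub>R frechet_derivative f (at u) b) = frechet_derivative f (at u) (V u)"
    by (subst (2) euclidean_representation[of "V u", symmetric])
      (simp add: linear_sum linear_cmul)
qed

text \<open>Both iterated derivatives equal the limit of the same second difference quotient.\<close>

lemma second_difference:
  fixes f :: "'a::euclidean_space \<Rightarrow> real"
  assumes S: "open S" "convex S" and f: "smooth_on S f"
    and t: "t > 0" "u \<in> S" "u + t *\<^sub>R a \<in> S" "u + t *\<^sub>R b \<in> S" "u + t *\<^sub>R a + t *\<^sub>R b \<in> S"
  obtains \<xi> \<eta> where "0 < \<xi>" "\<xi> < t" "0 < \<eta>" "\<eta> < t"
    "f (u + t *\<^sub>R a + t *\<^sub>R b) - f (u + t *\<^sub>R a) - f (u + t *\<^sub>R b) + f u =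
      t\<^sup>2 * frechet_derivative (\<lambda>w. frechet_derivative f (at w) a) (at (u + \<xi> *\<^sub>R a + \<eta> *\<^sub>R b)) b"
proof -
  have conv: "u + x *\<^sub>R a + y *\<^sub>R b \<in> S" if "0 \<le> x" "x \<le> t" "0 \<le> y" "y \<le> t" for x y
  proof -
    have 1: "u + x *\<^sub>R a \<in> S"
      using convexD[OF S(2) t(2,3), of "1 - x/t" "x/t"] that t(1)
      by (simp add: algebra_simps)
    have "u + x *\<^sub>R a + t *\<^sub>R b \<in> S"
      using convexD[OF S(2) t(4,5), of "1 - x/t" "x/t"] that t(1)
      by (simp add: algebra_simps)
    from convexD[OF S(2) 1 this, of "1 - y/t" "y/t"] that t(1) show ?thesis
      by (simp add: algebra_simps)
  qed
  have der: "((\<lambda>x. g (v + x *\<^sub>R c)) has_real_derivative frechet_derivative g (at (v + x *\<^sub>R c)) c) (at x)"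
    if g: "smooth_on S g" and "v + x *\<^sub>R c \<in> S" for g :: "'a \<Rightarrow> real" and v c x
  proof -
    have D: "(g has_derivative frechet_derivative g (at (v + x *\<^sub>R c))) (at (v + x *\<^sub>R c))"
      using smooth_on_has_derivative[OF g S(1) that(2)] .
    have l: "((\<lambda>x. v + x *\<^sub>R c) has_derivative (\<lambda>h. h *\<^sub>R c)) (at x)"
      by (auto intro!: derivative_eq_intros)
    have "((\<lambda>x. g (v + x *\<^sub>R c)) has_derivative (\<lambda>h. frechet_derivative g (at (v + x *\<^sub>R c)) (h *\<^sub>R c))) (at x)"
      using has_derivative_compose[OF l D] .
    moreover have "(\<lambda>h. frechet_derivative g (at (v + x *\<^sub>R c)) (h *\<^sub>R c)) = (*) (frechet_derivative g (at (v + x *\<^sub>R c)) c)"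
      using has_derivative_linear[OF D] by (simp add: fun_eq_iff linear_cmul)
    ultimately show ?thesis by (simp add: has_field_derivative_def)
  qed
  \<comment> \<open>The second difference is the increment over [0, t] of x \<mapsto> f (u + t b + x
    a) - f (u + x a). One mean value step in the direction \<open>a\<close> and one in the direction
    \<open>b\<close> produce the iterated derivative.\<close>
  have "\<exists>\<xi>. 0 < \<xi> \<and> \<xi> < t \<and>
      (f (u + t *\<^sub>R b + t *\<^sub>R a) - f (u + t *\<^sub>R a)) - (f (u + t *\<^sub>R b + 0 *\<^sub>R a) - f (u + 0 *\<^sub>R a)) =
      (t - 0) * (frechet_derivative f (at (u + t *\<^sub>R b + \<xi> *\<^sub>R a)) a - frechet_derivative f (at (u + \<xi> *\<^sub>R a)) a)"
  proof (rule MVT2[where f = "\<lambda>x. f (u + t *\<^sub>R b + x *\<^sub>R a) - f (u + x *\<^sub>R a)"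
        and f' = "\<lambda>x. frechet_derivative f (at (u + t *\<^sub>R b + x *\<^sub>R a)) a - frechet_derivative f (at (u + x *\<^sub>R a)) a"])
    fix x assume x: "0 \<le> x" "x \<le> t"
    have "u + t *\<^sub>R b + x *\<^sub>R a \<in> S" "u + x *\<^sub>R a \<in> S"
      using conv[OF x, of t] conv[OF x, of 0] t(1) by (simp_all add: add_ac)
    then show "((\<lambda>x. f (u + t *\<^sub>R b + x *\<^sub>R a) - f (u + x *\<^sub>R a)) has_real_derivative
        frechet_derivative f (at (u + t *\<^sub>R b + x *\<^sub>R a)) a - frechet_derivative f (at (u + x *\<^sub>R a)) a) (at x)"
      by (intro DERIV_diff der f)
  qed (rule t(1))
  then obtain \<xi> where xi: "0 < \<xi>" "\<xi> < t" 
    and e1: "f (u + t *\<^sub>R b + t *\<^sub>R a) - f (u + t *\<^sub>R a) - (f (u + t *\<^sub>R b) - f u) =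
      t * (frechet_derivative f (at (u + t *\<^sub>R b + \<xi> *\<^sub>R a)) a - frechet_derivative f (at (u + \<xi> *\<^sub>R a)) a)"
    by auto
  have "\<exists>\<eta>. 0 < \<eta> \<and> \<eta> < t \<and>
      frechet_derivative f (at (u + \<xi> *\<^sub>R a + t *\<^sub>R b)) a - frechet_derivative f (at (u + \<xi> *\<^sub>R a + 0 *\<^sub>R b)) a =
      (t - 0) * frechet_derivative (\<lambda>w. frechet_derivative f (at w) a) (at (u + \<xi> *\<^sub>R a + \<eta> *\<^sub>R b)) b"
  proof (rule MVT2[where f = "\<lambda>y. frechet_derivative f (at (u + \<xi> *\<^sub>R a + y *\<^sub>R b)) a"])
    fix y assume y: "0 \<le> y" "y \<le> t"
    have "u + \<xi> *\<^sub>R a + y *\<^sub>R b \<in> S" using conv xi y by simp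
    then show "((\<lambda>y. frechet_derivative f (at (u + \<xi> *\<^sub>R a + y *\<^sub>R b)) a) has_real_derivative
        frechet_derivative (\<lambda>w. frechet_derivative f (at w) a) (at (u + \<xi> *\<^sub>R a + y *\<^sub>R b)) b) (at y)"
      using der[OF smooth_on_directional[OF f]] by blast
  qed (rule t(1))
  then obtain \<eta> where "0 < \<eta>" "\<eta> < t" 
      "frechet_derivative f (at (u + \<xi> *\<^sub>R a + t *\<^sub>R b)) a - frechet_derivative f (at (u + \<xi> *\<^sub>R a)) a =
      t * frechet_derivative (\<lambda>w. frechet_derivative f (at w) a) (at (u + \<xi> *\<^sub>R a + \<eta> *\<^sub>R b)) b"
    by auto
  with e1 xi show ?thesis
    by (intro that[of \<xi> \<eta>]) (simp_all add: power2_eq_square algebra_simps)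
qed

lemma second_derivative_symmetric_real:
  fixes f :: "'a::euclidean_space \<Rightarrow> real"
  assumes S: "open S" and f: "smooth_on S f" and u: "u \<in> S"
  shows "frechet_derivative (\<lambda>w. frechet_derivative f (at w) a) (at u) b =
    frechet_derivative (\<lambda>w. frechet_derivative f (at w) b) (at u) a"
proof -
  obtain r where r: "r > 0" "ball u r \<subseteq> S" using S u openE by blast
  have f': "smooth_on (ball u r) f"
    using f r(2) unfolding smooth_on_def
  proof safe
    fix k assume "\<forall>k. Ck_on k S f"
    then have "Ck_on k S f" by blast
    then show "Ck_on k (ball u r) f" using r(2)
      by (induction k arbitrary: f) (auto intro: continuous_on_subset differentiable_on_subset)
  qed
  define M where "M = norm a + norm b + 1"
  have M: "M > 0" by (auto simp: M_def add_nonneg_pos)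
  define P where "P a b w = frechet_derivative (\<lambda>w. frechet_derivative f (at w) a) (at w) b" for a b w
  have cont: "continuous_on (ball u r) (P a b)" for a b
    unfolding P_def by (intro smooth_on_continuous smooth_on_directional f')
  \<comment> \<open>The mean value points depend on \<open>t\<close> and on the order of
    \<open>a\<close> and \<open>b\<close>; squeezed between 0 and \<open>t\<close>, they still lead
    to \<open>u\<close>, where \<open>P a b\<close> is continuous.\<close>
  have lim: "((\<lambda>t. P a b (u + \<xi> t *\<^sub>R a + \<eta> t *\<^sub>R b)) \<longlongrightarrow> P a b u) (at_right 0)"
    if "\<forall>\<^sub>F t in at_right 0. 0 < \<xi> t \<and> \<xi> t < t \<and> 0 < \<eta> t \<and> \<eta> t < t" for a b \<xi> \<eta>
  proof -
    have z: "(\<xi> \<longlongrightarrow> 0) (at_right 0)" "(\<eta> \<longlongrightarrow> 0) (at_right 0)"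
      by (rule tendsto_sandwich[of "\<lambda>_. 0" _ _ "\<lambda>t. t"], use that in \<open>auto elim!: eventually_mono\<close>)+
    have "((\<lambda>t. u + \<xi> t *\<^sub>R a + \<eta> t *\<^sub>R b) \<longlongrightarrow> u + 0 *\<^sub>R a + 0 *\<^sub>R b) (at_right 0)"
      by (intro tendsto_intros z)
    moreover have "isCont (P a b) (u + 0 *\<^sub>R a + 0 *\<^sub>R b)"
      using cont[of a b] r(1) by (simp add: continuous_on_eq_continuous_at)
    ultimately show ?thesis using isCont_tendsto_compose by fastforce
  qed
  have ex: "\<exists>\<xi> \<eta>. 0 < \<xi> \<and> \<xi> < t \<and> 0 < \<eta> \<and> \<eta> < t \<and>
     f (u + t *\<^sub>R a + t *\<^sub>R b) - f (u + t *\<^sub>R a) - f (u + t *\<^sub>R b) + f u = t\<^sup>2 * P a b (u + \<xi> *\<^sub>R a + \<eta> *\<^sub>R b)"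
    if t: "0 < t" "t * (norm a + norm b) < r" for a b t
  proof -
    have "norm (t *\<^sub>R a + t *\<^sub>R b) \<le> t * (norm a + norm b)"
      "norm (t *\<^sub>R a) \<le> t * (norm a + norm b)" "norm (t *\<^sub>R b) \<le> t * (norm a + norm b)"
      using norm_triangle_ineq[of "t *\<^sub>R a" "t *\<^sub>R b"] t by (simp_all add: algebra_simps)
    then have le: "norm (t *\<^sub>R a + t *\<^sub>R b) < r" "norm (t *\<^sub>R a) < r" "norm (t *\<^sub>R b) < r"
      using t(2) by linarith+
    have "u + w \<in> ball u r" if "norm w < r" for w :: 'a
      using that by (simp add: dist_norm)
    from this[OF le(2)] this[OF le(3)] this[OF le(1)]
    have mem: "u + t *\<^sub>R a \<in> ball u r" "u + t *\<^sub>R b \<in> ball u r" "u + t *\<^sub>R a + t *\<^sub>R b \<in> ball u r"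
      by (simp_all add: add.assoc)
    show ?thesis
      using second_difference[OF open_ball convex_ball f' t(1) _ mem(1,2,3)] r(1) unfolding P_def
      by (metis centre_in_ball)
  qed
  have ev: "\<forall>\<^sub>F t in at_right 0. 0 < t \<and> t * (norm a + norm b) < r" for a b :: 'a
  proof -
    have "((\<lambda>t. t * (norm a + norm b)) \<longlongrightarrow> 0 * (norm a + norm b)) (at_right (0::real))"
      by (intro tendsto_intros)
    then have "\<forall>\<^sub>F t in at_right 0. t * (norm a + norm b) < r"
      using r(1) by (auto dest!: order_tendstoD(2))
    then show ?thesis by (simp add: eventually_conj eventually_at_right_less)
  qed
  define Q where "Q a b t = (f (u + t *\<^sub>R a + t *\<^sub>R b) - f (u + t *\<^sub>R a) - f (u + t *\<^sub>R b) + f u) / t\<^sup>2" for a b t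
  have Q: "(Q a b \<longlongrightarrow> P a b u) (at_right 0)" for a b
  proof -
    obtain \<xi> \<eta> where *: "\<And>t. 0 < t \<Longrightarrow> t * (norm a + norm b) < r \<Longrightarrow>
       0 < \<xi> t \<and> \<xi> t < t \<and> 0 < \<eta> t \<and> \<eta> t < t \<and>
     f (u + t *\<^sub>R a + t *\<^sub>R b) - f (u + t *\<^sub>R a) - f (u + t *\<^sub>R b) + f u = t\<^sup>2 * P a b (u + \<xi> t *\<^sub>R a + \<eta> t *\<^sub>R b)"
      using ex[of _ a b] by metis
    have "((\<lambda>t. P a b (u + \<xi> t *\<^sub>R a + \<eta> t *\<^sub>R b)) \<longlongrightarrow> P a b u) (at_right 0)"
      by (rule lim, rule eventually_mono[OF ev[of a b]]) (use * in blast)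
    moreover have "\<forall>\<^sub>F t in at_right 0. P a b (u + \<xi> t *\<^sub>R a + \<eta> t *\<^sub>R b) = Q a b t"
      by (rule eventually_mono[OF ev[of a b]]) (use * in \<open>simp add: Q_def\<close>)
    ultimately show ?thesis by (rule Lim_transform_eventually)
  qed
  \<comment> \<open>The quotient is symmetric in the two directions, so its limits for both orders
    coincide.\<close>
  have "Q a b = Q b a" by (simp add: Q_def fun_eq_iff algebra_simps)
  then have "P a b u = P b a u"
    using tendsto_unique[OF _ Q[of a b]] Q[of b a] by simp
  then show ?thesis by (simp add: P_def)
qed

lemma frechet_derivative_linear_compose:
  assumes "bounded_linear L" "(f has_derivative F) (at u)"
  shows "frechet_derivative (\<lambda>w. L (f w)) (at u) = (\<lambda>v. L (frechet_derivative f (at u) v))"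
  using frechet_derivative_at[OF bounded_linear.has_derivative[OF assms]] frechet_derivative_at[OF assms(2)]
  by simp

lemma second_derivative_symmetric:
  fixes f :: "'a::euclidean_space \<Rightarrow> 'b::euclidean_space"
  assumes S: "open S" and f: "smooth_on S f" and u: "u \<in> S"
  shows "frechet_derivative (\<lambda>w. frechet_derivative f (at w) a) (at u) b =
    frechet_derivative (\<lambda>w. frechet_derivative f (at w) b) (at u) a"
proof (rule euclidean_eqI)
  fix e :: 'b
  have sm: "smooth_on S (\<lambda>w. f w \<bullet> e)"
    by (rule smooth_on_linear[OF bounded_linear_inner_left S f])
  have 1: "frechet_derivative (\<lambda>w. f w \<bullet> e) (at w) v = frechet_derivative f (at w) v \<bullet> e" if "w \<in> S" for w v
    using frechet_derivative_linear_compose[OF bounded_linear_inner_left smooth_on_has_derivative[OF f S that]] by simp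
  have 2: "frechet_derivative (\<lambda>w. frechet_derivative (\<lambda>w. f w \<bullet> e) (at w) v) (at u) v' =
    frechet_derivative (\<lambda>w. frechet_derivative f (at w) v) (at u) v' \<bullet> e" for v v'
  proof -
    have "frechet_derivative (\<lambda>w. frechet_derivative (\<lambda>w. f w \<bullet> e) (at w) v) (at u) v' =
      frechet_derivative (\<lambda>w. frechet_derivative f (at w) v \<bullet> e) (at u) v'"
      by (rule fun_cong[OF frechet_derivative_cong_open[OF S u]]) (rule 1)
    also have "\<dots> = frechet_derivative (\<lambda>w. frechet_derivative f (at w) v) (at u) v' \<bullet> e"
      using frechet_derivative_linear_compose[OF bounded_linear_inner_left
         smooth_on_has_derivative[OF smooth_on_directional[OF f] S u]] by simp
    finally show ?thesis .
  qed
  show "frechet_derivative (\<lambda>w. frechet_derivative f (at w) a) (at u) b \<bullet> e =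
    frechet_derivative (\<lambda>w. frechet_derivative f (at w) b) (at u) a \<bullet> e"
    using second_derivative_symmetric_real[OF S sm u, of a b] by (simp add: 2)
qed

section \<open>Trace inequalities for symmetric matrices\<close>

text \<open>As \<open>\<phi>\<close> is traceless, the matrix of products \<open>v i * v j\<close>
  may be replaced by its traceless part \<open>w\<close>, whose squared norm is
  \<open>V\<^sup>2 (1 - 1 / n)\<close>; then Cauchy-Schwarz applies. This bounds the largest
  eigenvalue without diagonalization.\<close>

lemma quadratic_form_traceless_le:
  fixes \<phi> :: "'n::finite \<Rightarrow> 'n \<Rightarrow> real" and v :: "'n \<Rightarrow> real"
  assumes tr: "(\<Sum>i\<in>UNIV. \<phi> i i) = 0"
  shows "(\<Sum>i\<in>UNIV. \<Sum>j\<in>UNIV. \<phi> i j * v i * v j) \<le>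
    sqrt (\<Sum>i\<in>UNIV. \<Sum>j\<in>UNIV. (\<phi> i j)\<^sup>2) * sqrt (1 - 1 / CARD('n)) * (\<Sum>i\<in>UNIV. (v i)\<^sup>2)"
proof -
  let ?n = "real CARD('n)"
  define V where "V = (\<Sum>i\<in>UNIV. (v i)\<^sup>2)"
  define w where "w i j = v i * v j - (if i = j then V / ?n else 0)" for i j
  have n: "?n \<ge> 1" using zero_less_card_finite[where 'a = 'n] by linarith
  have V0: "V \<ge> 0" by (simp add: V_def sum_nonneg)
  have "(\<Sum>i\<in>UNIV. \<Sum>j\<in>UNIV. \<phi> i j * w i j) =
     (\<Sum>i\<in>UNIV. \<Sum>j\<in>UNIV. \<phi> i j * v i * v j) - (\<Sum>i\<in>UNIV. \<phi> i i * (V / ?n))"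
    by (simp add: w_def right_diff_distrib sum_subtractf if_distrib[where f = "\<lambda>x. _ * x"] mult.assoc cong: if_cong)
  then have e1: "(\<Sum>i\<in>UNIV. \<Sum>j\<in>UNIV. \<phi> i j * v i * v j) = (\<Sum>i\<in>UNIV. \<Sum>j\<in>UNIV. \<phi> i j * w i j)"
    by (simp only: sum_distrib_right[symmetric] tr)
  have "(w i j)\<^sup>2 = (v i)\<^sup>2 * (v j)\<^sup>2 + (if i = j then (V / ?n)\<^sup>2 - 2 * (V / ?n) * (v i)\<^sup>2 else 0)" for i j
    by (simp add: w_def power2_eq_square algebra_simps)
  then have "(\<Sum>i\<in>UNIV. \<Sum>j\<in>UNIV. (w i j)\<^sup>2) =
     (\<Sum>i\<in>UNIV. \<Sum>j\<in>UNIV. (v i)\<^sup>2 * (v j)\<^sup>2) + (\<Sum>i\<in>(UNIV::'n set). (V / ?n)\<^sup>2 - 2 * (V / ?n) * (v i)\<^sup>2)"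
    by (simp add: sum.distrib)
  also have "\<dots> = V * V + (?n * (V / ?n)\<^sup>2 - 2 * (V / ?n) * V)"
    unfolding sum_product[symmetric] by (simp add: V_def sum_subtractf sum_distrib_left)
  also have "\<dots> = V\<^sup>2 * (1 - 1 / ?n)"
    using n by (simp add: field_simps power2_eq_square)
  finally have e2: "(\<Sum>i\<in>UNIV. \<Sum>j\<in>UNIV. (w i j)\<^sup>2) = V\<^sup>2 * (1 - 1 / ?n)" .
  have "(\<Sum>p\<in>UNIV \<times> UNIV. \<phi> (fst p) (snd p) * w (fst p) (snd p))\<^sup>2 \<le>
    (\<Sum>p\<in>UNIV \<times> UNIV. (\<phi> (fst p) (snd p))\<^sup>2) * (\<Sum>p\<in>UNIV \<times> UNIV. (w (fst p) (snd p))\<^sup>2)"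
    by (rule Cauchy_Schwarz_ineq_sum)
  then have "(\<Sum>i\<in>UNIV. \<Sum>j\<in>UNIV. \<phi> i j * w i j)\<^sup>2 \<le>
     (\<Sum>i\<in>UNIV. \<Sum>j\<in>UNIV. (\<phi> i j)\<^sup>2) * (V\<^sup>2 * (1 - 1 / ?n))"
    unfolding e2[symmetric] by (simp add: sum.cartesian_product case_prod_unfold)
  then have "\<bar>\<Sum>i\<in>UNIV. \<Sum>j\<in>UNIV. \<phi> i j * w i j\<bar> \<le>
     sqrt ((\<Sum>i\<in>UNIV. \<Sum>j\<in>UNIV. (\<phi> i j)\<^sup>2) * (V\<^sup>2 * (1 - 1 / ?n)))"
    by (intro real_le_rsqrt) simp
  also have "\<dots> = sqrt (\<Sum>i\<in>UNIV. \<Sum>j\<in>UNIV. (\<phi> i j)\<^sup>2) * sqrt (1 - 1 / ?n) * V"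
    using V0 by (simp add: real_sqrt_mult)
  finally show ?thesis unfolding e1 V_def[symmetric] by linarith
qed

text \<open>Okumura's inequality. With the sharp bound \<open>b\<close> for the quadratic form and
  \<open>a = - b / (n - 1)\<close>, it is the inequality \<open>tr ((\<phi> - a)\<^sup>2 (b - \<phi>)) \<ge> 0\<close>, so no eigenvalues are needed.\<close>

lemma trace_cube_le:
  fixes \<phi> :: "'n::finite \<Rightarrow> 'n \<Rightarrow> real"
  assumes n: "CARD('n) \<ge> 2" and sym: "\<And>i j. \<phi> i j = \<phi> j i" and tr: "(\<Sum>i\<in>UNIV. \<phi> i i) = 0"
    and \<beta>: "\<beta> = sqrt (\<Sum>i\<in>UNIV. \<Sum>j\<in>UNIV. (\<phi> i j)\<^sup>2)"
  shows "(\<Sum>i\<in>UNIV. \<Sum>j\<in>UNIV. \<Sum>k\<in>UNIV. \<phi> i j * \<phi> j k * \<phi> k i) \<le>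
    (real CARD('n) - 2) / sqrt (real CARD('n) * (real CARD('n) - 1)) * \<beta> ^ 3"
proof -
  define m where "m = real CARD('n)"
  have m: "m \<ge> 2" using n by (simp add: m_def)
  define c where "c = sqrt (m * (m - 1))"
  have c: "c > 0" "c\<^sup>2 = m * (m - 1)" using m by (simp_all add: c_def)
  define a where "a = - \<beta> / c"
  define b where "b = \<beta> * (m - 1) / c"
  have "sqrt (1 - 1 / m) = (m - 1) / c"
  proof (rule real_sqrt_unique)
    show "((m - 1) / c)\<^sup>2 = 1 - 1 / m"
      using m by (simp add: power_divide c(2)) (simp add: field_simps power2_eq_square)
  qed (use m c in simp)
  then have bound: "(\<Sum>i\<in>UNIV. \<Sum>j\<in>UNIV. \<phi> i j * v i * v j) \<le> b * (\<Sum>i\<in>UNIV. (v i)\<^sup>2)" for v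
    using quadratic_form_traceless_le[where \<phi> = \<phi>, OF tr, of v] by (simp add: \<beta>[symmetric] b_def m_def)
  \<comment> \<open>\<open>?v k\<close> is row \<open>k\<close> of \<open>\<phi> - a\<close>; adding
    the bounds for all rows gives the trace inequality for
    \<open>(\<phi> - a)\<^sup>2 (b - \<phi>)\<close>.\<close>
  let ?v = "\<lambda>k i. \<phi> k i - (if i = k then a else 0)"
  have form: "(\<Sum>i\<in>UNIV. \<Sum>j\<in>UNIV. \<phi> i j * ?v k i * ?v k j) =
     (\<Sum>i\<in>UNIV. \<Sum>j\<in>UNIV. \<phi> i j * \<phi> k i * \<phi> k j) - 2 * a * (\<Sum>i\<in>UNIV. (\<phi> k i)\<^sup>2) + a\<^sup>2 * \<phi> k k" for k
  proof -
    have "\<phi> i j * ?v k i * ?v k j = \<phi> i j * \<phi> k i * \<phi> k j - (if j = k then a * \<phi> i j * \<phi> k i else 0)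
        - (if i = k then a * \<phi> i j * \<phi> k j else 0) + (if i = k then if j = k then a\<^sup>2 * \<phi> i j else 0 else 0)" for i j
      by (simp add: power2_eq_square algebra_simps)
    note that = this
    have "(\<Sum>i\<in>UNIV. \<Sum>j\<in>UNIV. \<phi> i j * ?v k i * ?v k j) =
       (\<Sum>i\<in>UNIV. \<Sum>j\<in>UNIV. \<phi> i j * \<phi> k i * \<phi> k j) - (\<Sum>i\<in>UNIV. a * \<phi> i k * \<phi> k i)
       - (\<Sum>i\<in>UNIV. \<Sum>j\<in>UNIV. if i = k then a * \<phi> i j * \<phi> k j else 0) + a\<^sup>2 * \<phi> k k"
    proof -
      have "(\<Sum>i\<in>UNIV. \<Sum>j\<in>UNIV. if i = k then if j = k then a\<^sup>2 * \<phi> i j else 0 else 0) = a\<^sup>2 * \<phi> k k"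
        by (subst sum.swap) simp
      with that show ?thesis by (simp only: sum.distrib sum_subtractf) simp
    qed
    also have "(\<Sum>i\<in>UNIV. \<Sum>j\<in>UNIV. if i = k then a * \<phi> i j * \<phi> k j else 0) = (\<Sum>j\<in>UNIV. a * \<phi> k j * \<phi> k j)"
      by (subst sum.swap) simp
    also have "(\<Sum>i\<in>UNIV. a * \<phi> i k * \<phi> k i) = (\<Sum>j\<in>UNIV. a * \<phi> k j * \<phi> k j)"
      by (simp add: sym[of _ k])
    finally show ?thesis by (simp add: power2_eq_square sum_distrib_left mult.assoc sum_negf)
  qed
  have norm: "(\<Sum>i\<in>UNIV. (?v k i)\<^sup>2) = (\<Sum>i\<in>UNIV. (\<phi> k i)\<^sup>2) - 2 * a * \<phi> k k + a\<^sup>2" for k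
  proof -
    have "(?v k i)\<^sup>2 = (\<phi> k i)\<^sup>2 + (if i = k then a\<^sup>2 - 2 * a * \<phi> k i else 0)" for i
      by (simp add: power2_eq_square algebra_simps)
    then show ?thesis by (simp add: sum.distrib)
  qed
  have \<beta>2: "(\<Sum>i\<in>UNIV. \<Sum>j\<in>UNIV. (\<phi> i j)\<^sup>2) = \<beta>\<^sup>2"
    by (simp add: \<beta> sum_nonneg)
  define f3 where "f3 = (\<Sum>i\<in>UNIV. \<Sum>j\<in>UNIV. \<Sum>k\<in>UNIV. \<phi> i j * \<phi> j k * \<phi> k i)"
  have f3: "f3 = (\<Sum>k\<in>UNIV. \<Sum>i\<in>UNIV. \<Sum>j\<in>UNIV. \<phi> i j * \<phi> k i * \<phi> k j)"
    unfolding f3_def by (intro sum.cong refl) (subst (3) sym, simp add: mult_ac)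
  have "(\<Sum>k\<in>UNIV. \<Sum>i\<in>UNIV. \<Sum>j\<in>UNIV. \<phi> i j * ?v k i * ?v k j) \<le> (\<Sum>k\<in>UNIV. b * (\<Sum>i\<in>UNIV. (?v k i)\<^sup>2))"
    by (intro sum_mono bound)
  then have "f3 - 2 * a * \<beta>\<^sup>2 + a\<^sup>2 * 0 \<le> b * (\<beta>\<^sup>2 - 2 * a * 0 + m * a\<^sup>2)"
    unfolding form norm
    by (simp add: sum.distrib sum_subtractf sum_distrib_left[symmetric] tr \<beta>2 f3 m_def)
  then have "f3 \<le> 2 * a * \<beta>\<^sup>2 + b * \<beta>\<^sup>2 + b * (m * a\<^sup>2)"
    by (simp add: algebra_simps)
  also have "m * a\<^sup>2 = \<beta>\<^sup>2 / (m - 1)"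
    using m by (simp add: a_def power_divide c(2))
  also have "2 * a * \<beta>\<^sup>2 + b * \<beta>\<^sup>2 + b * (\<beta>\<^sup>2 / (m - 1)) = (m - 2) / c * \<beta> ^ 3"
    using m c(1) by (simp add: a_def b_def field_simps power2_eq_square power3_eq_cube)
  finally show ?thesis by (simp add: f3_def c_def m_def)
qed

lemma abs_trace_cube_le:
  fixes \<phi> :: "'n::finite \<Rightarrow> 'n \<Rightarrow> real"
  assumes n: "CARD('n) \<ge> 2" and sym: "\<And>i j. \<phi> i j = \<phi> j i" and tr: "(\<Sum>i\<in>UNIV. \<phi> i i) = 0"
    and \<beta>: "\<beta> = sqrt (\<Sum>i\<in>UNIV. \<Sum>j\<in>UNIV. (\<phi> i j)\<^sup>2)"
  shows "\<bar>\<Sum>i\<in>UNIV. \<Sum>j\<in>UNIV. \<Sum>k\<in>UNIV. \<phi> i j * \<phi> j k * \<phi> k i\<bar> \<le>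
    (real CARD('n) - 2) / sqrt (real CARD('n) * (real CARD('n) - 1)) * \<beta> ^ 3"
  using trace_cube_le[OF n sym tr \<beta>] trace_cube_le[where \<phi> = "\<lambda>i j. - \<phi> i j" and \<beta> = \<beta>, OF n] sym tr \<beta>
  by (simp add: sum_negf)

lemma sum_square_traceless:
  fixes F :: "'n::finite \<Rightarrow> 'n \<Rightarrow> real"
  defines "t \<equiv> \<Sum>i\<in>UNIV. F i i"
  shows "(\<Sum>i\<in>UNIV. \<Sum>j\<in>UNIV. (F i j - (if i = j then t / CARD('n) else 0))\<^sup>2) =
    (\<Sum>i\<in>UNIV. \<Sum>j\<in>UNIV. (F i j)\<^sup>2) - t\<^sup>2 / CARD('n)"
proof -
  let ?n = "real CARD('n)"
  define c where "c = t / ?n"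
  have "(F i j - (if i = j then c else 0))\<^sup>2 = (F i j)\<^sup>2 + (if i = j then c\<^sup>2 - (2 * c) * F i i else 0)" for i j
    by (simp add: power2_eq_square algebra_simps)
  then have "(\<Sum>i\<in>UNIV. \<Sum>j\<in>UNIV. (F i j - (if i = j then c else 0))\<^sup>2) =
     (\<Sum>i\<in>UNIV. \<Sum>j\<in>UNIV. (F i j)\<^sup>2) + (?n * c\<^sup>2 - 2 * c * t)"
    by (simp add: sum.distrib sum_subtractf sum_distrib_left[symmetric] t_def)
  also have "?n * c\<^sup>2 - 2 * c * t = - (t\<^sup>2 / ?n)"
    by (simp add: c_def field_simps power2_eq_square)
  finally show ?thesis unfolding c_def by simp
qed

text \<open>With \<open>c = t / n\<close> the trace of \<open>(F - c)\<^sup>3\<close> is \<open>tr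
  F\<^sup>3 - 3 c tr F\<^sup>2 + 3 c\<^sup>2 t - n c\<^sup>3\<close>, and the last two terms add up
  to \<open>2 t\<^sup>3 / n\<^sup>2\<close>.\<close>

lemma sum_cube_traceless:
  fixes F :: "'n::finite \<Rightarrow> 'n \<Rightarrow> real"
  assumes sym: "\<And>i j. F i j = F j i"
  defines "t \<equiv> \<Sum>i\<in>UNIV. F i i"
  defines "\<phi> \<equiv> \<lambda>i j. F i j - (if i = j then t / CARD('n) else 0)"
  shows "(\<Sum>i\<in>UNIV. \<Sum>j\<in>UNIV. \<Sum>k\<in>UNIV. \<phi> i j * \<phi> j k * \<phi> k i) =
    (\<Sum>i\<in>UNIV. \<Sum>j\<in>UNIV. \<Sum>k\<in>UNIV. F i j * F j k * F k i)
    - 3 * (t / CARD('n)) * (\<Sum>i\<in>UNIV. \<Sum>j\<in>UNIV. (F i j)\<^sup>2) + 2 * t ^ 3 / (real CARD('n))\<^sup>2"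
proof -
  let ?n = "real CARD('n)"
  define c where "c = t / ?n"
  have inner: "(\<Sum>k\<in>UNIV. G k * \<phi> k i) = (\<Sum>k\<in>UNIV. G k * F k i) - c * G i" for G i
  proof -
    have "G k * \<phi> k i = G k * F k i - (if k = i then c * G k else 0)" for k
      by (simp add: \<phi>_def c_def algebra_simps)
    then show ?thesis by (simp add: sum_subtractf)
  qed
  have two: "(\<Sum>j\<in>UNIV. \<phi> i j * \<phi> j k) = (\<Sum>j\<in>UNIV. F i j * F j k) - 2 * c * F i k + (if i = k then c\<^sup>2 else 0)" for i k
  proof -
    have "(\<Sum>j\<in>UNIV. \<phi> i j * \<phi> j k) = (\<Sum>j\<in>UNIV. F j k * \<phi> i j) - c * \<phi> i k"
      unfolding inner by (simp add: mult.commute)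
    also have "(\<Sum>j\<in>UNIV. F j k * \<phi> i j) = (\<Sum>j\<in>UNIV. F j k * \<phi> j i)"
      using sym by (simp add: \<phi>_def eq_commute)
    also have "\<dots> = (\<Sum>j\<in>UNIV. F j k * F j i) - c * F i k" by (rule inner)
    finally show ?thesis
      by (simp add: \<phi>_def c_def sym[of _ i] algebra_simps power2_eq_square)
  qed
  have "(\<Sum>i\<in>UNIV. \<Sum>j\<in>UNIV. \<Sum>k\<in>UNIV. \<phi> i j * \<phi> j k * \<phi> k i) =
    (\<Sum>i\<in>UNIV. \<Sum>k\<in>UNIV. (\<Sum>j\<in>UNIV. \<phi> i j * \<phi> j k) * \<phi> k i)"
    by (rule sum.cong[OF refl], subst sum.swap) (simp add: sum_distrib_right)
  also have "\<dots> = (\<Sum>i\<in>UNIV. (\<Sum>k\<in>UNIV. (\<Sum>j\<in>UNIV. \<phi> i j * \<phi> j k) * F k i) - c * (\<Sum>j\<in>UNIV. \<phi> i j * \<phi> j i))"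
    by (simp add: inner)
  also have "\<dots> = (\<Sum>i\<in>UNIV. (\<Sum>k\<in>UNIV. (\<Sum>j\<in>UNIV. F i j * F j k) * F k i) - 2 * c * (\<Sum>k\<in>UNIV. F i k * F k i)
      + c\<^sup>2 * F i i - c * ((\<Sum>j\<in>UNIV. F i j * F j i) - 2 * c * F i i + c\<^sup>2))"
  proof (intro sum.cong refl)
    fix i
    have "((\<Sum>j\<in>UNIV. F i j * F j k) - 2 * c * F i k + (if i = k then c\<^sup>2 else 0)) * F k i =
      (\<Sum>j\<in>UNIV. F i j * F j k) * F k i - 2 * c * (F i k * F k i) + (if i = k then c\<^sup>2 * F k i else 0)" for k
      by (simp add: algebra_simps)
    then show "(\<Sum>k\<in>UNIV. (\<Sum>j\<in>UNIV. \<phi> i j * \<phi> j k) * F k i) - c * (\<Sum>j\<in>UNIV. \<phi> i j * \<phi> j i) =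
      (\<Sum>k\<in>UNIV. (\<Sum>j\<in>UNIV. F i j * F j k) * F k i) - 2 * c * (\<Sum>k\<in>UNIV. F i k * F k i)
      + c\<^sup>2 * F i i - c * ((\<Sum>j\<in>UNIV. F i j * F j i) - 2 * c * F i i + c\<^sup>2)"
      unfolding two by (simp add: sum.distrib sum_subtractf sum_distrib_left)
  qed
  also have "\<dots> = (\<Sum>i\<in>UNIV. \<Sum>k\<in>UNIV. (\<Sum>j\<in>UNIV. F i j * F j k) * F k i)
      - 3 * c * (\<Sum>i\<in>UNIV. \<Sum>k\<in>UNIV. F i k * F k i) + 3 * c\<^sup>2 * t - ?n * c ^ 3"
    unfolding t_def by (simp add: sum.distrib sum_subtractf sum_distrib_left[symmetric] sum_distrib_right[symmetric] algebra_simps power3_eq_cube power2_eq_square)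
  also have "(\<Sum>i\<in>UNIV. \<Sum>k\<in>UNIV. (\<Sum>j\<in>UNIV. F i j * F j k) * F k i) =
      (\<Sum>i\<in>UNIV. \<Sum>j\<in>UNIV. \<Sum>k\<in>UNIV. F i j * F j k * F k i)"
    by (rule sum.cong[OF refl], simp only: sum_distrib_right, rule sum.swap)
  also have "(\<Sum>i\<in>UNIV. \<Sum>k\<in>UNIV. F i k * F k i) = (\<Sum>i\<in>UNIV. \<Sum>j\<in>UNIV. (F i j)\<^sup>2)"
    by (intro sum.cong refl) (subst (2) sym, simp add: power2_eq_square)
  finally have "(\<Sum>i\<in>UNIV. \<Sum>j\<in>UNIV. \<Sum>k\<in>UNIV. \<phi> i j * \<phi> j k * \<phi> k i) =
    (\<Sum>i\<in>UNIV. \<Sum>j\<in>UNIV. \<Sum>k\<in>UNIV. F i j * F j k * F k i)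
      - 3 * c * (\<Sum>i\<in>UNIV. \<Sum>j\<in>UNIV. (F i j)\<^sup>2) + 3 * c\<^sup>2 * t - ?n * c ^ 3" .
  moreover have "3 * c\<^sup>2 * t - ?n * c ^ 3 = 2 * t ^ 3 / ?n\<^sup>2"
    by (simp add: c_def field_simps power2_eq_square power3_eq_cube)
  ultimately show ?thesis unfolding c_def by linarith
qed

section \<open>Commuting vector fields\<close>

text \<open>Derivatives along commuting fields behave like partial derivatives. Using the coordinate
  fields of a map in place of its inverse avoids all questions about the smoothness of inverse
  maps.\<close>

locale commuting_fields =
  fixes D :: "'a::euclidean_space set" and V :: "'n::finite \<Rightarrow> 'a \<Rightarrow> 'a"
  assumes open_D: "open D" and smooth_V: "smooth_on D (V i)"
    and bracket: "u \<in> D \<Longrightarrow>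
      frechet_derivative (V j) (at u) (V i u) = frechet_derivative (V i) (at u) (V j u)"
begin

definition d :: "'n \<Rightarrow> ('a \<Rightarrow> 'b::euclidean_space) \<Rightarrow> 'a \<Rightarrow> 'b" where
  "d i f u = frechet_derivative f (at u) (V i u)"

lemma smooth_d: "smooth_on D f \<Longrightarrow> smooth_on D (d i f)"
  unfolding d_def by (rule smooth_on_along_field[OF open_D _ smooth_V])

lemma d_eq: "(f has_derivative F) (at u) \<Longrightarrow> d i f u = F (V i u)"
  unfolding d_def using frechet_derivative_at by metis

lemma d_cong: "(\<And>w. w \<in> D \<Longrightarrow> f w = g w) \<Longrightarrow> u \<in> D \<Longrightarrow> d i f u = d i g u"
  unfolding d_def by (rule fun_cong[OF frechet_derivative_cong_open[OF open_D]])

lemma d_const: "d i (\<lambda>w. c) u = 0"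
  by (simp add: d_def)

lemma hd: "smooth_on D f \<Longrightarrow> u \<in> D \<Longrightarrow> (f has_derivative frechet_derivative f (at u)) (at u)"
  using smooth_on_has_derivative open_D by blast

lemma d_add: "smooth_on D f \<Longrightarrow> smooth_on D g \<Longrightarrow> u \<in> D \<Longrightarrow> d i (\<lambda>w. f w + g w) u = d i f u + d i g u"
  using d_eq[OF has_derivative_add[OF hd hd]] by (simp add: d_def)

lemma d_diff: "smooth_on D f \<Longrightarrow> smooth_on D g \<Longrightarrow> u \<in> D \<Longrightarrow> d i (\<lambda>w. f w - g w) u = d i f u - d i g u"
  using d_eq[OF has_derivative_diff[OF hd hd]] by (simp add: d_def)

lemma d_mult:
  fixes f g :: "'a \<Rightarrow> real"
  shows "smooth_on D f \<Longrightarrow> smooth_on D g \<Longrightarrow> u \<in> D \<Longrightarrow>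
    d i (\<lambda>w. f w * g w) u = d i f u * g u + f u * d i g u"
  using d_eq[OF has_derivative_mult[OF hd hd], of f u g] by (simp add: d_def add.commute)

lemma d_sum: "(\<And>k. k \<in> K \<Longrightarrow> smooth_on D (f k)) \<Longrightarrow> u \<in> D \<Longrightarrow>
    d i (\<lambda>w. \<Sum>k\<in>K. f k w) u = (\<Sum>k\<in>K. d i (f k) u)"
  using d_eq[OF has_derivative_sum[of K f "\<lambda>k. frechet_derivative (f k) (at u)" "at u"]]
  by (simp add: d_def hd)

lemma d_linear: "bounded_linear L \<Longrightarrow> smooth_on D f \<Longrightarrow> u \<in> D \<Longrightarrow> d i (\<lambda>w. L (f w)) u = L (d i f u)"
  using d_eq[OF bounded_linear.has_derivative[OF _ hd]] by (simp add: d_def)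

text \<open>An iterated derivative is the derivative of \<open>f\<close> in the direction of
  \<open>V j\<close> differentiated along \<open>V i\<close>, plus the Hessian of \<open>f\<close>
  on both fields. \<open>bracket\<close> makes the first part symmetric, symmetry of second
  derivatives the other.\<close>

lemma d_commute:
  fixes f :: "'a \<Rightarrow> real"
  assumes f: "smooth_on D f" and u: "u \<in> D"
  shows "d i (d j f) u = d j (d i f) u"
proof -
  have expand: "d i (d j f) u = frechet_derivative f (at u) (frechet_derivative (V j) (at u) (V i u)) +
    (\<Sum>b\<in>Basis. \<Sum>c\<in>Basis. (V j u \<bullet> b) * (V i u \<bullet> c) *
       frechet_derivative (\<lambda>w. frechet_derivative f (at w) b) (at u) c)" for i j
  proof -
    have lin: "linear (frechet_derivative g (at w))" if "smooth_on D g" "w \<in> D" for g :: "'a \<Rightarrow> real" and w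
      using hd[OF that] has_derivative_linear by blast
    have rep: "frechet_derivative g (at w) v = (\<Sum>b\<in>Basis. (v \<bullet> b) * frechet_derivative g (at w) b)"
      if "smooth_on D g" "w \<in> D" for g :: "'a \<Rightarrow> real" and w v
      using linear_sum[OF lin[OF that], of "\<lambda>b. (v \<bullet> b) *\<^sub>R b" Basis]
      by (simp add: euclidean_representation linear_cmul[OF lin[OF that]])
    have sm: "smooth_on D (\<lambda>w. V j w \<bullet> b)" for b
      by (rule smooth_on_linear[OF bounded_linear_inner_left open_D smooth_V])
    have dV: "d i (\<lambda>w. V j w \<bullet> b) u = frechet_derivative (V j) (at u) (V i u) \<bullet> b" for b
      using d_linear[OF bounded_linear_inner_left smooth_V u] by (simp add: d_def)
    have "d i (d j f) u = d i (\<lambda>w. \<Sum>b\<in>Basis. (V j w \<bullet> b) * frechet_derivative f (at w) b) u"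
      by (rule d_cong[OF _ u]) (simp add: d_def rep[OF f, symmetric])
    also have "\<dots> = (\<Sum>b\<in>Basis. (frechet_derivative (V j) (at u) (V i u) \<bullet> b) * frechet_derivative f (at u) b
       + (V j u \<bullet> b) * d i (\<lambda>w. frechet_derivative f (at w) b) u)"
      by (simp add: d_sum d_mult u smooth_on_mult open_D sm smooth_on_directional f dV)
    also have "\<dots> = frechet_derivative f (at u) (frechet_derivative (V j) (at u) (V i u)) +
      (\<Sum>b\<in>Basis. (V j u \<bullet> b) * d i (\<lambda>w. frechet_derivative f (at w) b) u)"
      by (simp add: sum.distrib rep[OF f u, symmetric])
    also have "(\<Sum>b\<in>Basis. (V j u \<bullet> b) * d i (\<lambda>w. frechet_derivative f (at w) b) u) =
      (\<Sum>b\<in>Basis. \<Sum>c\<in>Basis. (V j u \<bullet> b) * (V i u \<bullet> c) *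
       frechet_derivative (\<lambda>w. frechet_derivative f (at w) b) (at u) c)"
      unfolding d_def
      by (subst rep[OF smooth_on_directional[OF f] u]) (simp add: sum_distrib_left mult.assoc)
    finally show ?thesis .
  qed
  have "(\<Sum>b\<in>Basis. \<Sum>c\<in>Basis. (V j u \<bullet> b) * (V i u \<bullet> c) *
       frechet_derivative (\<lambda>w. frechet_derivative f (at w) b) (at u) c) =
     (\<Sum>b\<in>Basis. \<Sum>c\<in>Basis. (V i u \<bullet> b) * (V j u \<bullet> c) *
       frechet_derivative (\<lambda>w. frechet_derivative f (at w) b) (at u) c)"
    by (subst sum.swap) (simp add: second_derivative_symmetric[OF open_D f u] mult_ac)
  then show ?thesis by (simp add: expand bracket[OF u])
qed

lemma dd_add:
  assumes "smooth_on D f" "smooth_on D g" "u \<in> D"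
  shows "d i (d j (\<lambda>w. f w + g w)) u = d i (d j f) u + d i (d j g) u"
proof -
  have "d i (d j (\<lambda>w. f w + g w)) u = d i (\<lambda>w. d j f w + d j g w) u"
    by (rule d_cong) (simp_all add: d_add assms)
  then show ?thesis by (simp add: d_add smooth_d assms)
qed

lemma dd_diff:
  assumes "smooth_on D f" "smooth_on D g" "u \<in> D"
  shows "d i (d j (\<lambda>w. f w - g w)) u = d i (d j f) u - d i (d j g) u"
proof -
  have "d i (d j (\<lambda>w. f w - g w)) u = d i (\<lambda>w. d j f w - d j g w) u"
    by (rule d_cong) (simp_all add: d_diff assms)
  then show ?thesis by (simp add: d_diff smooth_d assms)
qed

lemma dd_sum:
  assumes "\<And>k. k \<in> K \<Longrightarrow> smooth_on D (f k)" "u \<in> D"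
  shows "d i (d j (\<lambda>w. \<Sum>k\<in>K. f k w)) u = (\<Sum>k\<in>K. d i (d j (f k)) u)"
proof -
  have "d i (d j (\<lambda>w. \<Sum>k\<in>K. f k w)) u = d i (\<lambda>w. \<Sum>k\<in>K. d j (f k) w) u"
    by (rule d_cong) (simp_all add: d_sum assms)
  then show ?thesis by (simp add: d_sum smooth_d assms)
qed

lemma dd_mult:
  fixes f g :: "'a \<Rightarrow> real"
  assumes "smooth_on D f" "smooth_on D g" "u \<in> D"
  shows "d i (d j (\<lambda>w. f w * g w)) u =
    d i (d j f) u * g u + d i f u * d j g u + d j f u * d i g u + f u * d i (d j g) u"
proof -
  have "d i (d j (\<lambda>w. f w * g w)) u = d i (\<lambda>w. d j f w * g w + f w * d j g w) u"
    by (rule d_cong) (simp_all add: d_mult assms)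
  then show ?thesis
    by (simp add: d_add d_mult smooth_d smooth_on_mult open_D assms)
qed

lemma dd_const: "u \<in> D \<Longrightarrow> d i (d j (\<lambda>w. c)) u = 0"
  using d_cong[of "d j (\<lambda>w. c)" "\<lambda>w. 0" u i] by (simp add: d_const)

end

section \<open>The Simons identity at a point with horizontal tangent plane\<close>

text \<open>
  The hypersurface is given by its coordinate functions \<open>(y, z)\<close>, where \<open>V i\<close> is the coordinate
  field of \<open>y i\<close>, and \<open>\<theta>\<close> is the last component of the normal \<open>(\<theta> \<nabla>z, \<theta>)\<close>. In these
  coordinates \<open>g\<^sub>i\<^sub>j = \<delta>\<^sub>i\<^sub>j - z\<^sub>i z\<^sub>j\<close>, with inverse \<open>\<delta>\<^sub>i\<^sub>j + \<nu>\<^sub>i \<nu>\<^sub>j\<close>, and \<open>h\<^sub>i\<^sub>j = \<theta> z\<^sub>i\<^sub>j\<close>, which gives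
  the formulas for the mean curvature and for the squared norm of the second fundamental form.
\<close>

locale lambda_graph = commuting_fields D V
  for D :: "'a::euclidean_space set" and V :: "'n::finite \<Rightarrow> 'a \<Rightarrow> 'a" +
  fixes y :: "'n \<Rightarrow> 'a \<Rightarrow> real" and z \<theta> :: "'a \<Rightarrow> real" and p :: 'a
  assumes smooth_y: "smooth_on D (y i)" and smooth_z: "smooth_on D z" and smooth_\<theta>: "smooth_on D \<theta>"
    and p: "p \<in> D"
    and dy: "u \<in> D \<Longrightarrow> d i (y j) u = (if i = j then 1 else 0)"
    and unit: "u \<in> D \<Longrightarrow> (\<Sum>i\<in>UNIV. (\<theta> u * d i z u) * (\<theta> u * d i z u)) = \<theta> u * \<theta> u - 1"
    and horizontal: "d i z p = 0"
begin

definition \<nu> :: "'n \<Rightarrow> 'a \<Rightarrow> real" where "\<nu> i u = \<theta> u * d i z u"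

definition z2 :: "'n \<Rightarrow> 'n \<Rightarrow> 'a \<Rightarrow> real" where "z2 i j = d j (d i z)"

text \<open>The contraction of the Hessian with \<open>\<nu>\<close>, and \<open>q\<close> is the
  double contraction; they stem from the term \<open>\<nu>\<^sub>i \<nu>\<^sub>j\<close> of the
  inverse metric. At \<open>p\<close> both vanish, \<open>q\<close> even with its first derivatives,
  so that few terms survive there.\<close>

definition r :: "'n \<Rightarrow> 'a \<Rightarrow> real" where "r j u = (\<Sum>i\<in>UNIV. \<nu> i u * z2 i j u)"

definition q :: "'a \<Rightarrow> real" where "q u = (\<Sum>j\<in>UNIV. \<nu> j u * r j u)"

definition mean :: "'a \<Rightarrow> real" where "mean u = \<theta> u * ((\<Sum>i\<in>UNIV. z2 i i u) + q u)"

definition sqn :: "'a \<Rightarrow> real" where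
  "sqn u = (\<theta> u * \<theta> u) * ((\<Sum>i\<in>UNIV. \<Sum>j\<in>UNIV. z2 i j u * z2 i j u)
     + ((\<Sum>j\<in>UNIV. r j u * r j u) + (\<Sum>j\<in>UNIV. r j u * r j u)) + q u * q u)"

text \<open>The function \<langle>x, x\<rangle>; likewise \<open>wx\<close> is \<langle>x,
  N\<rangle>.\<close>

definition sx :: "'a \<Rightarrow> real" where "sx u = (\<Sum>i\<in>UNIV. y i u * y i u) - z u * z u"

definition wx :: "'a \<Rightarrow> real" where "wx u = (\<Sum>i\<in>UNIV. y i u * \<nu> i u) - z u * \<theta> u"

lemma smooth_\<nu>: "smooth_on D (\<nu> i)"
  unfolding \<nu>_def by (intro smooth_on_mult open_D smooth_\<theta> smooth_d smooth_z)

lemma smooth_z2: "smooth_on D (z2 i j)"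
  unfolding z2_def by (intro smooth_d smooth_z)

lemma smooth_r: "smooth_on D (r j)"
  unfolding r_def by (intro smooth_on_sum smooth_on_mult open_D smooth_\<nu> smooth_z2)

lemma smooth_q: "smooth_on D q"
  unfolding q_def by (intro smooth_on_sum smooth_on_mult open_D smooth_\<nu> smooth_r)

lemmas smooths = smooth_y smooth_z smooth_\<theta> smooth_\<nu> smooth_z2 smooth_r smooth_q smooth_d
  smooth_on_sum[OF open_D] smooth_on_mult[OF open_D] smooth_on_add[OF open_D]
  smooth_on_diff[OF open_D] smooth_on_const

lemmas ds = d_add d_diff d_mult d_sum d_const dd_add dd_diff dd_mult dd_sum dd_const

text \<open>At \<open>p\<close> the metric is Euclidean to first order and \<theta> is stationary,
  so \<open>\<epsilon> F\<close> is the second fundamental form and \<open>\<epsilon> T\<close> its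
  covariant derivative. \<open>Q\<close> has no such meaning: the curvature terms that it lacks
  reappear through \<theta>, \<open>r\<close> and \<open>q\<close>.\<close>

definition F where "F i j = z2 i j p"
definition T where "T i j k = d k (z2 i j) p"
definition Q where "Q i j k m = d m (d k (z2 i j)) p"
definition a where "a i = y i p"
definition b where "b = z p"
definition \<epsilon> where "\<epsilon> = \<theta> p"

lemma F_sym: "F i j = F j i"
  unfolding F_def z2_def by (rule d_commute[OF smooth_z p])

lemma z2_sym: "u \<in> D \<Longrightarrow> z2 i j u = z2 j i u"
  unfolding z2_def by (rule d_commute[OF smooth_z])

lemma T_sym1: "T i j k = T j i k"
  unfolding T_def by (rule d_cong[OF z2_sym p])

text \<open>Third derivatives of \<open>z\<close> commute: this is the Codazzi equation at
  \<open>p\<close>.\<close>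

lemma T_sym2: "T i j k = T i k j"
  unfolding T_def z2_def by (rule d_commute[OF smooth_d[OF smooth_z] p])

text \<open>Plays the part of the commutation of covariant derivatives in the Simons identity.
  Fourth derivatives of \<open>z\<close> commute without any curvature term.\<close>

lemma Q_swap: "Q i j k k = Q k k i j"
proof -
  have "Q i j k k = d k (d k (d j (d i z))) p" by (simp add: Q_def z2_def)
  also have "\<dots> = d k (d j (d k (d i z))) p"
    by (rule d_cong[OF d_commute p]) (intro smooths)
  also have "\<dots> = d j (d k (d k (d i z))) p"
    by (rule d_commute[OF _ p]) (intro smooths)
  also have "\<dots> = d j (d k (d i (d k z))) p"
    by (rule d_cong[OF d_cong p], rule d_commute) (intro smooths)
  also have "\<dots> = d j (d i (d k (d k z))) p"
    by (rule d_cong[OF d_commute p]) (intro smooths)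
  finally show ?thesis by (simp add: Q_def z2_def)
qed

lemma \<nu>_p: "\<nu> i p = 0"
  by (simp add: \<nu>_def horizontal)

lemma \<epsilon>_sq: "\<epsilon> * \<epsilon> = 1"
  using unit[OF p] by (simp add: horizontal \<epsilon>_def)

lemma unit_\<nu>: "u \<in> D \<Longrightarrow> (\<Sum>i\<in>UNIV. \<nu> i u * \<nu> i u) = \<theta> u * \<theta> u - 1"
  using unit by (simp add: \<nu>_def)

text \<open>The derivative of \<open>unit_\<nu>\<close> gives
  \<open>\<theta> d\<theta> = \<Sum> \<nu>\<^sub>i d\<nu>\<^sub>i\<close>, and \<open>\<nu>\<close>
  vanishes at \<open>p\<close>.\<close>

lemma d_\<theta>: "d k \<theta> p = 0"
proof -
  have "d k (\<lambda>u. \<Sum>i\<in>UNIV. \<nu> i u * \<nu> i u) p = d k (\<lambda>u. \<theta> u * \<theta> u - 1) p"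
    by (rule d_cong[OF unit_\<nu> p])
  then have "\<epsilon> * d k \<theta> p = 0"
    by (simp add: ds smooths p \<nu>_p \<epsilon>_def)
  then show ?thesis using \<epsilon>_sq by auto
qed

lemma d_\<nu>: "d k (\<nu> i) p = \<epsilon> * F i k"
proof -
  have "d k (\<nu> i) p = d k (\<lambda>u. \<theta> u * d i z u) p" by (simp add: \<nu>_def[abs_def])
  then show ?thesis by (simp add: ds smooths p d_\<theta> F_def z2_def \<epsilon>_def)
qed

text \<open>By symmetry of \<open>F\<close>, the matrices \<open>M\<close> and \<open>C\<close> are
  \<open>F\<^sup>2\<close> and \<open>F\<^sup>3\<close>.\<close>

definition M where "M k m = (\<Sum>i\<in>UNIV. F i k * F i m)"
definition C where "C k m = (\<Sum>j\<in>UNIV. F j k * M j m)"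

text \<open>In the second derivative of \<open>unit_\<nu>\<close> at \<open>p\<close> only products
  of first derivatives of \<open>\<nu>\<close> survive. Through this Hessian quadratic curvature
  terms enter the computation.\<close>

lemma dd_\<theta>: "d m (d k \<theta>) p = \<epsilon> * M k m"
proof -
  have "d m (d k (\<lambda>u. \<Sum>i\<in>UNIV. \<nu> i u * \<nu> i u)) p = d m (d k (\<lambda>u. \<theta> u * \<theta> u - 1)) p"
    by (rule d_cong[OF d_cong p], rule unit_\<nu>)
  then have "(\<Sum>i\<in>UNIV. (\<epsilon> * F i k) * (\<epsilon> * F i m)) = \<epsilon> * d m (d k \<theta>) p"
    by (simp add: ds smooths p \<nu>_p d_\<theta> d_\<nu> \<epsilon>_def[symmetric] sum_distrib_left[symmetric] mult.commute mult.left_commute)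
  also have "(\<Sum>i\<in>UNIV. (\<epsilon> * F i k) * (\<epsilon> * F i m)) = (\<epsilon> * \<epsilon>) * M k m"
    unfolding M_def sum_distrib_left by (simp add: mult_ac)
  finally have "\<epsilon> * (\<epsilon> * M k m) = \<epsilon> * d m (d k \<theta>) p" by (simp add: mult.assoc)
  then show ?thesis using \<epsilon>_sq by auto
qed

lemma dd_\<nu>: "d m (d k (\<nu> i)) p = \<epsilon> * T i k m"
proof -
  have "d m (d k (\<nu> i)) p = d m (d k (\<lambda>u. \<theta> u * d i z u)) p" by (simp add: \<nu>_def[abs_def])
  then show ?thesis by (simp add: ds smooths p d_\<theta> horizontal T_def z2_def \<epsilon>_def)
qed

lemma r_p: "r j p = 0" by (simp add: r_def \<nu>_p)

lemma d_r: "d k (r j) p = \<epsilon> * M j k"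
proof -
  have "d k (r j) p = d k (\<lambda>u. \<Sum>i\<in>UNIV. \<nu> i u * z2 i j u) p" by (simp add: r_def[abs_def])
  also have "\<dots> = (\<Sum>i\<in>UNIV. \<epsilon> * (F i j * F i k))"
    by (simp add: ds smooths p \<nu>_p d_\<nu> F_def mult_ac)
  finally show ?thesis by (simp add: M_def sum_distrib_left)
qed

lemma M_sym: "M i j = M j i" by (simp add: M_def mult.commute)

lemma q_p: "q p = 0" by (simp add: q_def \<nu>_p)

lemma d_q: "d k q p = 0"
proof -
  have "d k q p = d k (\<lambda>u. \<Sum>j\<in>UNIV. \<nu> j u * r j u) p" by (simp add: q_def[abs_def])
  then show ?thesis by (simp add: ds smooths p \<nu>_p r_p)
qed

lemma dd_q: "d m (d k q) p = C m k + C k m"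
proof -
  have "d m (d k q) p = d m (d k (\<lambda>u. \<Sum>j\<in>UNIV. \<nu> j u * r j u)) p" by (simp add: q_def[abs_def])
  also have "\<dots> = (\<Sum>j\<in>UNIV. (\<epsilon> * F j m) * (\<epsilon> * M j k) + (\<epsilon> * F j k) * (\<epsilon> * M j m))"
    by (simp add: ds smooths p \<nu>_p r_p d_\<nu> d_r)
  also have "\<dots> = (\<epsilon> * \<epsilon>) * (C m k + C k m)"
    unfolding C_def distrib_left sum_distrib_left sum.distrib by (simp add: mult_ac)
  finally show ?thesis by (simp add: \<epsilon>_sq)
qed

definition t where "t = (\<Sum>i\<in>UNIV. F i i)"
definition S where "S = (\<Sum>i\<in>UNIV. \<Sum>j\<in>UNIV. F i j * F i j)"
definition \<tau> where "\<tau> k = (\<Sum>i\<in>UNIV. T i i k)"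
definition \<sigma> where "\<sigma> k = (\<Sum>i\<in>UNIV. \<Sum>j\<in>UNIV. F i j * T i j k)"
definition P where "P k m = (\<Sum>i\<in>UNIV. Q i i k m)"

lemma mean_p: "mean p = \<epsilon> * t"
  by (simp add: mean_def q_p t_def F_def \<epsilon>_def)

lemma mean_eq: "mean = (\<lambda>u. \<theta> u * ((\<Sum>i\<in>UNIV. z2 i i u) + q u))"
  by (simp add: mean_def[abs_def])

lemma smooth_mean: "smooth_on D mean"
  unfolding mean_eq by (intro smooths) 

lemma d_mean: "d k mean p = \<epsilon> * \<tau> k"
  unfolding mean_eq by (simp add: ds smooths p q_p d_q d_\<theta> \<epsilon>_def T_def \<tau>_def)

lemma dd_mean: "d m (d k mean) p = \<epsilon> * (M k m * t + P k m + C m k + C k m)"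
  unfolding mean_eq
  by (simp add: ds smooths p q_p d_q dd_q d_\<theta> dd_\<theta> \<epsilon>_def[symmetric] t_def F_def Q_def P_def algebra_simps)

lemma sqn_eq: "sqn = (\<lambda>u. (\<theta> u * \<theta> u) * ((\<Sum>i\<in>UNIV. \<Sum>j\<in>UNIV. z2 i j u * z2 i j u)
     + ((\<Sum>j\<in>UNIV. r j u * r j u) + (\<Sum>j\<in>UNIV. r j u * r j u)) + q u * q u))"
  by (simp add: sqn_def[abs_def])

lemma smooth_sqn: "smooth_on D sqn"
  unfolding sqn_eq by (intro smooths) 

lemma sqn_p: "sqn p = S"
  by (simp add: sqn_def q_p r_p S_def F_def \<epsilon>_sq \<epsilon>_def[symmetric])

lemma d_sqn: "d k sqn p = 2 * \<sigma> k"
proof -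
  have "d k sqn p = (\<epsilon> * \<epsilon>) * (\<Sum>i\<in>UNIV. \<Sum>j\<in>UNIV. T i j k * F i j + F i j * T i j k)"
    unfolding sqn_eq
    by (simp add: ds smooths p q_p r_p d_q d_\<theta> \<epsilon>_def[symmetric] F_def[symmetric] T_def[symmetric])
  then show ?thesis by (simp add: \<epsilon>_sq \<sigma>_def sum_distrib_left mult.commute)
qed

lemma dd_sqn: "d k (d k sqn) p = 2 * (M k k * S + (\<Sum>i\<in>UNIV. \<Sum>j\<in>UNIV. T i j k * T i j k)
    + (\<Sum>i\<in>UNIV. \<Sum>j\<in>UNIV. F i j * Q i j k k) + 2 * (\<Sum>j\<in>UNIV. M j k * M j k))"
proof -
  have "d k (d k sqn) p = 2 * (\<epsilon> * (\<epsilon> * M k k)) * S + (\<epsilon> * \<epsilon>) * ((\<Sum>i\<in>UNIV. \<Sum>j\<in>UNIV.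
     Q i j k k * F i j + T i j k * T i j k + T i j k * T i j k + F i j * Q i j k k)
     + 2 * (\<Sum>j\<in>UNIV. (\<epsilon> * M j k) * (\<epsilon> * M j k) + (\<epsilon> * M j k) * (\<epsilon> * M j k)))"
    unfolding sqn_eq
    by (simp add: ds smooths p q_p r_p d_q d_r d_\<theta> dd_\<theta> \<epsilon>_def[symmetric] F_def[symmetric] T_def[symmetric]
      Q_def[symmetric] S_def sum.distrib algebra_simps)
  also have "\<dots> = 2 * (\<epsilon> * \<epsilon>) * M k k * S + (\<epsilon> * \<epsilon>) * ((\<Sum>i\<in>UNIV. \<Sum>j\<in>UNIV.
     2 * (F i j * Q i j k k) + 2 * (T i j k * T i j k))
     + 4 * (\<Sum>j\<in>UNIV. (\<epsilon> * \<epsilon>) * (M j k * M j k)))"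
    by (simp add: algebra_simps sum_distrib_left)
  finally show ?thesis
    by (simp add: \<epsilon>_sq sum.distrib sum_distrib_left[symmetric])
qed

text \<open>\<open>\<epsilon> g\<close> is the shape operator applied to the tangential part
  \<open>a\<close> of the position vector.\<close>

definition g where "g m = (\<Sum>j\<in>UNIV. F j m * a j)"

lemma sx_eq: "sx = (\<lambda>u. (\<Sum>i\<in>UNIV. y i u * y i u) - z u * z u)" by (simp add: sx_def[abs_def])

lemma wx_eq: "wx = (\<lambda>u. (\<Sum>i\<in>UNIV. y i u * \<nu> i u) - z u * \<theta> u)" by (simp add: wx_def[abs_def])

lemma smooth_sx: "smooth_on D sx" unfolding sx_eq by (intro smooths)

lemma smooth_wx: "smooth_on D wx" unfolding wx_eq by (intro smooths)

lemma dd_y: "d m (d k (y i)) p = 0"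
  using d_cong[of "d k (y i)" "\<lambda>u. if k = i then 1 else 0" p m] dy p by (auto simp: d_const)

lemma dd_z: "d m (d k z) p = F k m" by (simp add: F_def z2_def)

lemma sx_p: "sx p = (\<Sum>i\<in>UNIV. (a i)\<^sup>2) - b\<^sup>2"
  by (simp add: sx_def a_def b_def power2_eq_square)

lemma d_sx: "d k sx p = 2 * a k"
  unfolding sx_eq by (simp add: ds smooths p dy horizontal sum.distrib a_def if_distrib if_distribR cong: if_cong)

lemma dd_sx: "d m (d k sx) p = 2 * ((if k = m then 1 else 0) - b * F k m)"
proof -
  have "d m (d k sx) p = (\<Sum>i\<in>UNIV. (if m = i then 1 else 0) * (if k = i then 1 else 0)
      + (if k = i then 1 else 0) * (if m = i then 1 else 0)) - (F k m * b + b * F k m)"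
    unfolding sx_eq by (simp only: ds smooths p dy dd_y dd_z horizontal b_def) simp
  also have "\<dots> = (\<Sum>i\<in>UNIV. if i = k then if k = m then 2 else 0 else 0) - 2 * (b * F k m)"
    by (intro arg_cong2[where f = "(-)"] sum.cong) auto
  finally show ?thesis by simp
qed

lemma wx_p: "wx p = - b * \<epsilon>"
  by (simp add: wx_def b_def \<epsilon>_def \<nu>_p)

lemma d_wx: "d k wx p = \<epsilon> * g k"
  unfolding wx_eq by (simp add: ds smooths p horizontal \<nu>_p d_\<nu> d_\<theta> g_def sum_distrib_left a_def mult_ac)

lemma dd_wx: "d m (d k wx) p = \<epsilon> * (F k m + (\<Sum>j\<in>UNIV. a j * T j k m) - b * M k m)"
proof -
  have "d m (d k wx) p = (\<Sum>i\<in>UNIV. (if m = i then 1 else 0) * (\<epsilon> * F i k) + (if k = i then 1 else 0) * (\<epsilon> * F i m)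
      + a i * (\<epsilon> * T i k m)) - (F k m * \<epsilon> + b * (\<epsilon> * M k m))"
    unfolding wx_eq by (simp add: ds smooths p dy dd_y dd_z horizontal \<nu>_p d_\<nu> dd_\<nu> d_\<theta> dd_\<theta> a_def b_def \<epsilon>_def[symmetric])
  also have "\<dots> = (\<Sum>i\<in>UNIV. (if i = m then \<epsilon> * F m k else 0) + (if i = k then \<epsilon> * F k m else 0)
      + \<epsilon> * (a i * T i k m)) - (F k m * \<epsilon> + b * (\<epsilon> * M k m))"
    by (intro arg_cong2[where f = "(-)"] sum.cong) auto
  also have "\<dots> = (\<epsilon> * F m k + \<epsilon> * F k m + \<epsilon> * (\<Sum>i\<in>UNIV. a i * T i k m)) - (F k m * \<epsilon> + b * (\<epsilon> * M k m))"
    by (simp add: sum.distrib sum_distrib_left)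
  finally show ?thesis
    by (simp add: F_sym[of m k] algebra_simps)
qed

end

section \<open>The Simons identity under the \<lambda>-equation and the vanishing of its
  summands\<close>

locale pinched_lambda_graph = lambda_graph +
  fixes l B :: real
  assumes lam: "u \<in> D \<Longrightarrow> mean u = l + sx u * wx u"
    and pinched: "u \<in> D \<Longrightarrow> sqn u - (mean u * mean u) / real CARD('b) = B"
begin

definition n where "n = real CARD('b)"
definition s where "s = sx p"
definition f3 where "f3 = (\<Sum>i\<in>UNIV. \<Sum>j\<in>UNIV. F i j * M i j)"
definition m4 where "m4 = (\<Sum>i\<in>UNIV. \<Sum>j\<in>UNIV. M i j * M i j)"
definition FP where "FP = (\<Sum>i\<in>UNIV. \<Sum>j\<in>UNIV. F i j * P i j)"
definition T2 where "T2 = (\<Sum>k\<in>UNIV. \<Sum>i\<in>UNIV. \<Sum>j\<in>UNIV. T i j k * T i j k)"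

lemma n_pos: "n > 0" by (simp add: n_def)

lemma \<epsilon>_cancel: "\<epsilon> * (\<epsilon> * x) = x"
  using \<epsilon>_sq by (simp add: mult.assoc[symmetric])

lemma trace_M: "(\<Sum>k\<in>UNIV. M k k) = S"
  unfolding M_def S_def by (rule sum.swap)

lemma FC1: "(\<Sum>k\<in>UNIV. \<Sum>m\<in>UNIV. F k m * C k m) = m4"
proof -
  have "(\<Sum>k\<in>UNIV. F k m * C k m) = (\<Sum>j\<in>UNIV. M j m * M j m)" for m
  proof -
    have "(\<Sum>k\<in>UNIV. F k m * C k m) = (\<Sum>k\<in>UNIV. \<Sum>j\<in>UNIV. F k m * F k j * M j m)"
      by (simp add: C_def sum_distrib_left mult.assoc F_sym[of _ k for k])
    also have "\<dots> = (\<Sum>j\<in>UNIV. \<Sum>k\<in>UNIV. F k m * F k j * M j m)" by (rule sum.swap)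
    also have "\<dots> = (\<Sum>j\<in>UNIV. M m j * M j m)" by (simp add: M_def[of m] sum_distrib_right)
    finally show ?thesis by (simp add: M_sym[of m])
  qed
  then show ?thesis unfolding m4_def by (subst sum.swap, subst (2) sum.swap) simp
qed

lemma FC2: "(\<Sum>k\<in>UNIV. \<Sum>m\<in>UNIV. F k m * C m k) = m4"
  by (subst sum.swap) (simp add: FC1 F_sym[of m k for m k])

text \<open>Half the Laplacian at \<open>p\<close> of the constant \<open>B\<close>. The fourth
  derivatives enter as a Laplacian of \<open>F\<close>; \<open>Q_swap\<close> turns them into
  \<open>FP\<close>, the pairing of \<open>F\<close> with the second derivatives of the
  trace.\<close>

lemma laplace_pinching: "0 = S * S + T2 + FP + 2 * m4
    - ((\<Sum>k\<in>UNIV. \<tau> k * \<tau> k) + \<epsilon> * t * (\<Sum>k\<in>UNIV. d k (d k mean) p)) / n"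
proof -
  have zero: "0 = d k (d k (\<lambda>u. sqn u - inverse n * (mean u * mean u))) p" for k
  proof -
    have "d k (d k (\<lambda>u. sqn u - inverse n * (mean u * mean u))) p = d k (d k (\<lambda>u. B)) p"
      by (rule d_cong[OF d_cong p]) (use pinched in \<open>simp add: n_def field_simps\<close>)
    then show ?thesis by (simp add: dd_const p)
  qed
  then have "0 = M k k * S + (\<Sum>i\<in>UNIV. \<Sum>j\<in>UNIV. T i j k * T i j k)
      + (\<Sum>i\<in>UNIV. \<Sum>j\<in>UNIV. F i j * Q i j k k) + 2 * (\<Sum>j\<in>UNIV. M j k * M j k)
      - (\<tau> k * \<tau> k + \<epsilon> * t * d k (d k mean) p) / n" for k
  proof -
    have e: "(\<epsilon> * \<tau> k) * (\<epsilon> * \<tau> k) = \<tau> k * \<tau> k"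
      by (simp add: mult_ac \<epsilon>_cancel)
    have "0 = 2 * (M k k * S + (\<Sum>i\<in>UNIV. \<Sum>j\<in>UNIV. T i j k * T i j k)
      + (\<Sum>i\<in>UNIV. \<Sum>j\<in>UNIV. F i j * Q i j k k) + 2 * (\<Sum>j\<in>UNIV. M j k * M j k))
      - inverse n * (2 * ((\<epsilon> * \<tau> k) * (\<epsilon> * \<tau> k)) + 2 * (\<epsilon> * t * d k (d k mean) p))"
      using zero[of k]
      by (simp only: dd_diff dd_mult dd_const d_const d_mean mean_p dd_sqn p smooth_mean smooth_sqn
        smooth_on_mult[OF open_D] smooth_on_const) (simp add: algebra_simps)
    then show ?thesis unfolding e by (simp add: divide_inverse algebra_simps)
  qed
  then have "0 = (\<Sum>k\<in>UNIV. M k k * S + (\<Sum>i\<in>UNIV. \<Sum>j\<in>UNIV. T i j k * T i j k)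
      + (\<Sum>i\<in>UNIV. \<Sum>j\<in>UNIV. F i j * Q i j k k) + 2 * (\<Sum>j\<in>UNIV. M j k * M j k)
      - (\<tau> k * \<tau> k + \<epsilon> * t * d k (d k mean) p) / n)"
    by (simp add: sum.neutral)
  also have "\<dots> = S * S + T2 + (\<Sum>k\<in>UNIV. \<Sum>i\<in>UNIV. \<Sum>j\<in>UNIV. F i j * Q i j k k) + 2 * m4
     - ((\<Sum>k\<in>UNIV. \<tau> k * \<tau> k) + \<epsilon> * t * (\<Sum>k\<in>UNIV. d k (d k mean) p)) / n"
  proof -
    have "(\<Sum>k\<in>UNIV. \<Sum>j\<in>UNIV. M j k * M j k) = m4"
      unfolding m4_def by (rule sum.swap)
    then show ?thesis
      by (simp only: sum_subtractf sum.distrib sum_distrib_left[symmetric] sum_distrib_right[symmetric]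
        sum_divide_distrib[symmetric] trace_M T2_def)
  qed
  also have "(\<Sum>k\<in>UNIV. \<Sum>i\<in>UNIV. \<Sum>j\<in>UNIV. F i j * Q i j k k) = FP"
  proof -
    have "(\<Sum>k\<in>UNIV. \<Sum>i\<in>UNIV. \<Sum>j\<in>UNIV. F i j * Q i j k k) = (\<Sum>i\<in>UNIV. \<Sum>k\<in>UNIV. \<Sum>j\<in>UNIV. F i j * Q i j k k)"
      by (rule sum.swap)
    also have "\<dots> = (\<Sum>i\<in>UNIV. \<Sum>j\<in>UNIV. \<Sum>k\<in>UNIV. F i j * Q i j k k)"
      by (rule sum.cong[OF refl], rule sum.swap)
    finally have *: "(\<Sum>k\<in>UNIV. \<Sum>i\<in>UNIV. \<Sum>j\<in>UNIV. F i j * Q i j k k) =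
      (\<Sum>i\<in>UNIV. \<Sum>j\<in>UNIV. \<Sum>k\<in>UNIV. F i j * Q i j k k)" .
    have "(\<Sum>k\<in>UNIV. F i j * Q i j k k) = F i j * P i j" for i j
      by (simp only: P_def sum_distrib_left Q_swap)
    then show ?thesis unfolding * by (simp only: FP_def)
  qed
  finally show ?thesis .
qed

lemma gradient_pinching: "\<sigma> k = t * \<tau> k / n"
proof -
  have "d k (\<lambda>u. sqn u - inverse n * (mean u * mean u)) p = d k (\<lambda>u. B) p"
    by (rule d_cong[OF _ p]) (use pinched in \<open>simp add: n_def field_simps\<close>)
  then have "2 * \<sigma> k = inverse n * (\<epsilon> * \<tau> k * (\<epsilon> * t) + \<epsilon> * t * (\<epsilon> * \<tau> k))"
    by (simp add: d_diff d_mult d_const d_mean mean_p d_sqn p smooth_mean smooth_sqn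
        smooth_on_mult open_D smooth_on_const)
  also have "\<dots> = 2 * (\<epsilon> * \<epsilon>) * (t * \<tau> k / n)" by (simp add: field_simps)
  finally show ?thesis by (simp add: \<epsilon>_sq)
qed

text \<open>A second formula for the Hessian of H, besides \<open>dd_mean\<close>. Comparing the two
  ties the fourth derivatives of \<open>z\<close> to the position vector.\<close>

lemma dd_mean_lam: "d m (d k mean) p =
  \<epsilon> * (2 * (a k * g m + a m * g k) - 2 * b * ((if k = m then 1 else 0) - b * F k m)
   + s * (F k m + (\<Sum>j\<in>UNIV. a j * T j k m) - b * M k m))"
proof -
  have "d m (d k mean) p = d m (d k (\<lambda>u. l + sx u * wx u)) p"
    by (rule d_cong[OF d_cong p], rule lam)
  then show ?thesis
    by (simp add: dd_add dd_mult dd_const p smooth_sx smooth_wx smooth_on_mult open_D smooth_on_const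
      dd_sx dd_wx d_sx d_wx wx_p s_def[symmetric] algebra_simps)
qed

lemma lam_p: "\<epsilon> * t = l - s * b * \<epsilon>"
  using lam[OF p] by (simp add: mean_p wx_p s_def)

definition ag where "ag = (\<Sum>k\<in>UNIV. a k * g k)"
definition g2 where "g2 = (\<Sum>k\<in>UNIV. g k * g k)"
definition A2 where "A2 = (\<Sum>k\<in>UNIV. (a k)\<^sup>2)"

lemma T_contract: "(\<Sum>k\<in>UNIV. T j k k) = \<tau> j"
  unfolding \<tau>_def by (intro sum.cong refl) (metis T_sym1 T_sym2)

lemma FT_contract: "(\<Sum>k\<in>UNIV. \<Sum>m\<in>UNIV. F k m * T j k m) = \<sigma> j"
  unfolding \<sigma>_def by (intro sum.cong refl arg_cong2[where f = "(*)"]) (metis T_sym1 T_sym2)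

lemma laplace_mean: "(\<Sum>k\<in>UNIV. d k (d k mean) p) =
  \<epsilon> * (4 * ag - 2 * b * (n - b * t) + s * (t + (\<Sum>j\<in>UNIV. a j * \<tau> j) - b * S))"
proof -
  have *: "(\<Sum>k\<in>UNIV. \<Sum>j\<in>UNIV. a j * T j k k) = (\<Sum>j\<in>UNIV. a j * \<tau> j)"
    by (subst sum.swap) (simp add: sum_distrib_left[symmetric] T_contract)
  have "(\<Sum>k\<in>UNIV. d k (d k mean) p) = (\<Sum>k\<in>UNIV. \<epsilon> * (4 * (a k * g k) - 2 * b * (1 - b * F k k)
   + s * (F k k + (\<Sum>j\<in>UNIV. a j * T j k k) - b * M k k)))"
    by (simp add: dd_mean_lam algebra_simps)
  then show ?thesis
    by (simp add: sum.distrib sum_subtractf sum_distrib_left[symmetric] ag_def t_def trace_M * n_def)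
qed

lemma hessian_mean: "(\<Sum>k\<in>UNIV. \<Sum>m\<in>UNIV. F k m * d m (d k mean) p) =
  \<epsilon> * (4 * g2 - 2 * b * (t - b * S) + s * (S + (\<Sum>j\<in>UNIV. a j * \<sigma> j) - b * f3))"
proof -
  have 1: "(\<Sum>k\<in>UNIV. \<Sum>m\<in>UNIV. F k m * (\<Sum>j\<in>UNIV. a j * T j k m)) = (\<Sum>j\<in>UNIV. a j * \<sigma> j)"
  proof -
    have "(\<Sum>k\<in>UNIV. \<Sum>m\<in>UNIV. F k m * (\<Sum>j\<in>UNIV. a j * T j k m)) =
      (\<Sum>k\<in>UNIV. \<Sum>j\<in>UNIV. \<Sum>m\<in>UNIV. a j * (F k m * T j k m))"
      by (rule sum.cong[OF refl], subst sum.swap) (simp add: sum_distrib_left mult_ac)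
    also have "\<dots> = (\<Sum>j\<in>UNIV. \<Sum>k\<in>UNIV. \<Sum>m\<in>UNIV. a j * (F k m * T j k m))" by (rule sum.swap)
    finally show ?thesis by (simp add: FT_contract sum_distrib_left[symmetric])
  qed
  have g: "(\<Sum>k\<in>UNIV. F k m * a k) = g m" for m by (simp add: g_def)
  have g': "(\<Sum>m\<in>UNIV. F k m * a m) = g k" for k by (simp add: g_def F_sym[of k])
  have 2: "(\<Sum>k\<in>UNIV. \<Sum>m\<in>UNIV. F k m * (a k * g m)) = g2"
    by (subst sum.swap) (simp add: mult.assoc[symmetric] sum_distrib_right[symmetric] g g2_def)
  have 3: "(\<Sum>k\<in>UNIV. \<Sum>m\<in>UNIV. F k m * (a m * g k)) = g2"
    by (simp add: mult.assoc[symmetric] sum_distrib_right[symmetric] g' g2_def)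
  have 4: "(\<Sum>k\<in>UNIV. \<Sum>m\<in>UNIV. F k m * (if k = m then 1 else 0)) = t"
    by (simp add: t_def if_distrib cong: if_cong)
  have "F k m * d m (d k mean) p = \<epsilon> * (2 * (F k m * (a k * g m)) + 2 * (F k m * (a m * g k))
     - 2 * b * (F k m * (if k = m then 1 else 0)) + 2 * b * b * (F k m * F k m)
     + s * (F k m * F k m) + s * (F k m * (\<Sum>j\<in>UNIV. a j * T j k m)) - s * b * (F k m * M k m))" for k m
    unfolding dd_mean_lam by (simp only: algebra_simps)
  then have "(\<Sum>k\<in>UNIV. \<Sum>m\<in>UNIV. F k m * d m (d k mean) p) = \<epsilon> * (2 * g2 + 2 * g2
     - 2 * b * t + 2 * b * b * S + s * S + s * (\<Sum>j\<in>UNIV. a j * \<sigma> j) - s * b * f3)"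
    by (simp only: sum.distrib sum_subtractf sum_distrib_left[symmetric] 1 2 3 4 S_def[symmetric] f3_def[symmetric])
  then show ?thesis by (simp add: algebra_simps)
qed

text \<open>Contracts \<open>dd_mean\<close> with \<open>F\<close>. Together with
  \<open>hessian_mean\<close>, the same contraction of \<open>dd_mean_lam\<close>, it eliminates the
  fourth derivatives from \<open>laplace_pinching\<close>.\<close>

lemma FP_eq: "\<epsilon> * (FP + f3 * t + 2 * m4) = (\<Sum>k\<in>UNIV. \<Sum>m\<in>UNIV. F k m * d m (d k mean) p)"
proof -
  have "F k m * d m (d k mean) p = \<epsilon> * (F k m * P k m + (F k m * M k m) * t + F k m * C k m + F k m * C m k)" for k m
    by (simp add: dd_mean algebra_simps)
  then have "(\<Sum>k\<in>UNIV. \<Sum>m\<in>UNIV. F k m * d m (d k mean) p) = \<epsilon> * (FP + f3 * t + m4 + m4)"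
    by (simp only: sum.distrib sum_distrib_left[symmetric] sum_distrib_right[symmetric]
      FC1 FC2 FP_def[symmetric] f3_def[symmetric])
  then show ?thesis by simp
qed

text \<open>The terms \<open>m4\<close> cancel between the Laplacian and the Hessian. So do the
  drift terms, of coefficient \<open>s t / n\<close> on both sides: constancy of \<open>B\<close> to
  first order, \<open>gradient_pinching\<close>, converts \<open>\<sigma>\<close> into
  \<open>\<tau>\<close>.\<close>

lemma simons_identity:
  "(T2 - (\<Sum>k\<in>UNIV. \<tau> k * \<tau> k) / n) + B * b\<^sup>2 + (4 * g2 - 4 * t / n * ag + B * A2)
   + (S\<^sup>2 - t\<^sup>2 * S / n + \<epsilon> * l * t * S / n - \<epsilon> * l * f3) = 0"
proof -
  note e = \<epsilon>_cancel
  have nz: "n \<noteq> 0" using n_pos by simp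
  define aT where "aT = (\<Sum>j\<in>UNIV. a j * \<tau> j)"
  define LH where "LH = 4 * ag - 2 * b * (n - b * t) + s * (t + aT - b * S)"
  have as: "(\<Sum>j\<in>UNIV. a j * \<sigma> j) = t * aT / n"
    by (simp add: gradient_pinching aT_def sum_distrib_left sum_divide_distrib mult_ac)
  have FP: "FP = 4 * g2 - 2 * b * (t - b * S) + s * (S + t * aT / n - b * f3) - f3 * t - 2 * m4"
    using arg_cong[OF FP_eq, of "\<lambda>x. \<epsilon> * x"] unfolding hessian_mean as e by linarith
  have L: "0 = S * S + T2 + FP + 2 * m4 - ((\<Sum>k\<in>UNIV. \<tau> k * \<tau> k) + t * LH) / n"
    using laplace_pinching unfolding laplace_mean aT_def[symmetric] LH_def[symmetric]
    by (simp add: mult_ac e)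
  have B: "B = S - t * t / n"
    using pinched[OF p] by (simp add: sqn_p mean_p n_def mult_ac e)
  have s: "s = A2 - b * b" by (simp add: s_def sx_p A2_def power2_eq_square)
  have sb: "s * b = \<epsilon> * l - t"
    using arg_cong[OF lam_p, of "\<lambda>x. \<epsilon> * x"] by (simp add: e algebra_simps)
  \<comment> \<open>The relations \<open>L\<close>, \<open>sb\<close>, \<open>s\<close> and
    \<open>B\<close> are combined with explicit multipliers, so that the claim becomes a polynomial
    identity.\<close>
  have "(T2 - (\<Sum>k\<in>UNIV. \<tau> k * \<tau> k) / n) + B * b\<^sup>2 + (4 * g2 - 4 * t / n * ag + B * A2)
   + (S\<^sup>2 - t\<^sup>2 * S / n + \<epsilon> * l * t * S / n - \<epsilon> * l * f3) =
   (S * S + T2 + FP + 2 * m4 - ((\<Sum>k\<in>UNIV. \<tau> k * \<tau> k) + t * LH) / n)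
   + (s * b - (\<epsilon> * l - t)) * (f3 - t * S / n) + (A2 - b * b - s) * (S - t * t / n) + (B - (S - t * t / n)) * (b * b + A2)"
    unfolding FP LH_def using nz by (simp add: field_simps power2_eq_square)
  then show ?thesis using L B s sb by simp
qed

text \<open>For each \<open>k\<close> the trace \<open>\<tau> k\<close> sees only the diagonal
  entries of \<open>T\<close>. Cauchy-Schwarz with n terms bounds it by them, and the other entries
  are dropped.\<close>

lemma codazzi_norm: "(\<Sum>k\<in>UNIV. \<tau> k * \<tau> k) / n \<le> T2"
proof -
  have "\<tau> k * \<tau> k / n \<le> (\<Sum>i\<in>UNIV. \<Sum>j\<in>UNIV. T i j k * T i j k)" for k
  proof -
    have "(\<Sum>i\<in>UNIV. T i i k * 1)\<^sup>2 \<le> (\<Sum>i\<in>UNIV. (T i i k)\<^sup>2) * (\<Sum>i\<in>(UNIV::'b set). 1\<^sup>2)"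
      by (rule Cauchy_Schwarz_ineq_sum)
    then have "\<tau> k * \<tau> k / n \<le> (\<Sum>i\<in>UNIV. T i i k * T i i k)"
      using n_pos by (simp add: \<tau>_def n_def power2_eq_square field_simps)
    also have "\<dots> \<le> (\<Sum>i\<in>UNIV. \<Sum>j\<in>UNIV. T i j k * T i j k)"
      by (intro sum_mono member_le_sum[where f = "\<lambda>j. T i j k * T i j k" for i]) auto
    finally show ?thesis .
  qed
  then show ?thesis
    unfolding T2_def sum_divide_distrib by (rule sum_mono)
qed

lemma f3_cyclic: "(\<Sum>i\<in>UNIV. \<Sum>j\<in>UNIV. \<Sum>k\<in>UNIV. F i j * F j k * F k i) = f3"
  unfolding f3_def M_def sum_distrib_left
  by (intro sum.cong refl) (metis F_sym mult.assoc mult.commute)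

lemma cubic_term_nonneg:
  assumes n2: "CARD('b) \<ge> 2"
    and hyp: "(sqrt B - \<bar>l\<bar> * ((n - 2) / (2 * sqrt (n * (n - 1)))))\<^sup>2 + (mean p - l)\<^sup>2 / n - n * l\<^sup>2 / (4 * (n - 1)) \<ge> 0"
  shows "B \<ge> 0" "S\<^sup>2 - t\<^sup>2 * S / n + \<epsilon> * l * t * S / n - \<epsilon> * l * f3 \<ge> 0"
proof -
  have n: "n \<ge> 2" using n2 by (simp add: n_def)
  define \<phi> where "\<phi> i j = F i j - (if i = j then t / n else 0)" for i j
  have sq: "(\<Sum>i\<in>UNIV. \<Sum>j\<in>UNIV. (\<phi> i j)\<^sup>2) = B"
    using sum_square_traceless[of F] pinched[OF p]
    unfolding \<phi>_def n_def t_def[symmetric]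
    by (simp add: S_def sqn_p mean_p power2_eq_square mult_ac \<epsilon>_cancel)
  then show B: "B \<ge> 0" unfolding sq[symmetric] by (intro sum_nonneg) simp
  have tr: "(\<Sum>i\<in>UNIV. \<phi> i i) = 0"
    using n_pos by (simp add: \<phi>_def sum_subtractf t_def n_def)
  have sym: "\<phi> i j = \<phi> j i" for i j by (simp add: \<phi>_def F_sym[of i j])
  define \<beta> where "\<beta> = sqrt B"
  have \<beta>: "\<beta> * \<beta> = B" "\<beta> \<ge> 0" using B by (simp_all add: \<beta>_def)
  define c where "c = (n - 2) / sqrt (n * (n - 1))"
  define F3 where "F3 = (\<Sum>i\<in>UNIV. \<Sum>j\<in>UNIV. \<Sum>k\<in>UNIV. \<phi> i j * \<phi> j k * \<phi> k i)"
  have F3: "\<bar>F3\<bar> \<le> c * \<beta> ^ 3"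
    unfolding F3_def c_def n_def
    by (rule abs_trace_cube_le[where \<phi> = \<phi>, OF n2 sym tr]) (simp add: sq \<beta>_def)
  have f3: "f3 = F3 + 3 * (t / n) * S - 2 * t ^ 3 / n\<^sup>2"
    using sum_cube_traceless[where F = F, OF F_sym]
    unfolding F3_def \<phi>_def t_def[symmetric] n_def f3_cyclic
    by (simp add: S_def power2_eq_square)
  \<comment> \<open>Written through the traceless part, all terms of the cubic expression except
    \<open>F3\<close> acquire the factor \<open>B\<close>.\<close>
  have S: "S = B + t\<^sup>2 / n"
    using sq sum_square_traceless[of F] unfolding \<phi>_def n_def t_def[symmetric]
    by (simp add: S_def power2_eq_square)
  have "S\<^sup>2 - t\<^sup>2 * S / n + \<epsilon> * l * t * S / n - \<epsilon> * l * f3 = B * (B + t\<^sup>2 / n - 2 * \<epsilon> * l * t / n) - \<epsilon> * l * F3"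
    unfolding f3 S using n by (simp add: field_simps power2_eq_square power3_eq_cube)
  moreover have "\<epsilon> * l * F3 \<le> \<bar>l\<bar> * (c * \<beta> ^ 3)"
  proof -
    have "\<bar>\<epsilon>\<bar> = 1" using \<epsilon>_sq abs_square_eq_1[of \<epsilon>] by (simp add: power2_eq_square)
    then have "\<bar>\<epsilon> * l * F3\<bar> \<le> \<bar>l\<bar> * (c * \<beta> ^ 3)"
      using F3 by (simp add: abs_mult mult_left_mono)
    then show ?thesis by linarith
  qed
  moreover have "B * (B + t\<^sup>2 / n - 2 * \<epsilon> * l * t / n) - \<bar>l\<bar> * (c * \<beta> ^ 3) = 
     B * ((\<beta> - \<bar>l\<bar> * (c / 2))\<^sup>2 + (mean p - l)\<^sup>2 / n - n * l\<^sup>2 / (4 * (n - 1)))"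
  proof -
    have "c\<^sup>2 = (n\<^sup>2 - 4 * (n - 1)) / (n * (n - 1))"
      using n by (simp add: c_def power_divide) (simp add: power2_eq_square algebra_simps)
    also have "\<dots> = n\<^sup>2 / (n * (n - 1)) - 4 * (n - 1) / (n * (n - 1))" by (rule diff_divide_distrib)
    also have "n\<^sup>2 / (n * (n - 1)) = n / (n - 1)" using n by (simp add: power2_eq_square)
    also have "4 * (n - 1) / (n * (n - 1)) = 4 / n" using n by (intro mult_divide_mult_cancel_right) simp
    finally have c2: "c\<^sup>2 = n / (n - 1) - 4 / n" .
    have m: "(mean p - l)\<^sup>2 = t\<^sup>2 - 2 * \<epsilon> * l * t + l\<^sup>2"
      using \<epsilon>_sq by (simp add: mean_p power2_eq_square algebra_simps)
    have generic: "l\<^sup>2 * (x - 4 / n) / 4 - l\<^sup>2 * x / 4 = - l\<^sup>2 / n" for x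
      by (simp add: right_diff_distrib diff_divide_distrib)
    have "(\<bar>l\<bar> * (c / 2))\<^sup>2 = l\<^sup>2 * c\<^sup>2 / 4" by (simp add: power_mult_distrib power_divide)
    moreover have "n * l\<^sup>2 / (4 * (n - 1)) = l\<^sup>2 * (n / (n - 1)) / 4" by (simp add: mult.commute)
    ultimately have "(\<bar>l\<bar> * (c / 2))\<^sup>2 - n * l\<^sup>2 / (4 * (n - 1)) = - l\<^sup>2 / n"
      using generic[of "n / (n - 1)"] by (simp only: c2)
    \<comment> \<open>By \<open>c2\<close> two of the terms with \<open>l\<^sup>2\<close> combine to
      \<open>- l\<^sup>2 / n\<close> and cancel the one inside
      \<open>(mean p - l)\<^sup>2 / n\<close>. This explains the constant
      \<open>n / (4 * (n - 1))\<close> in the hypothesis.\<close>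
    then have eq: "(\<beta> - \<bar>l\<bar> * (c / 2))\<^sup>2 + (mean p - l)\<^sup>2 / n - n * l\<^sup>2 / (4 * (n - 1)) =
      \<beta> * \<beta> - \<bar>l\<bar> * c * \<beta> + (t\<^sup>2 - 2 * \<epsilon> * l * t) / n"
      unfolding m by (simp add: power2_diff add_divide_distrib diff_divide_distrib power2_eq_square[of \<beta>])
    show ?thesis
      unfolding eq \<beta>(1)[symmetric] by (simp add: power3_eq_cube algebra_simps diff_divide_distrib)
  qed
  moreover have "\<dots> \<ge> 0"
  proof -
    have "c / 2 = (n - 2) / (2 * sqrt (n * (n - 1)))" by (simp add: c_def mult.commute)
    then show ?thesis using mult_nonneg_nonneg[OF B hyp] by (simp only: \<beta>_def)
  qed
  ultimately show "S\<^sup>2 - t\<^sup>2 * S / n + \<epsilon> * l * t * S / n - \<epsilon> * l * f3 \<ge> 0" by linarith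
qed

lemma pinched_vanishing:
  assumes "CARD('b) \<ge> 2"
    and "(sqrt B - \<bar>l\<bar> * ((n - 2) / (2 * sqrt (n * (n - 1)))))\<^sup>2 + (mean p - l)\<^sup>2 / n - n * l\<^sup>2 / (4 * (n - 1)) \<ge> 0"
    and "4 * g2 - 4 * t / n * ag + B * A2 \<ge> 0"
  shows "B * b\<^sup>2 = 0" "4 * g2 - 4 * t / n * ag + B * A2 = 0"
proof -
  have "B * b\<^sup>2 \<ge> 0" using cubic_term_nonneg(1)[OF assms(1,2)] by simp
  then show "B * b\<^sup>2 = 0" "4 * g2 - 4 * t / n * ag + B * A2 = 0"
    using simons_identity codazzi_norm cubic_term_nonneg(2)[OF assms(1,2)] assms(3) by linarith+
qed

end

section \<open>Lorentz products and orthonormal frames\<close>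

lemma lorentz_sym: "lorentz X Y = lorentz Y X"
  by (simp add: lorentz_def inner_commute mult.commute)

lemma lorentz_add_left: "lorentz (X + Y) Z = lorentz X Z + lorentz Y Z"
  by (simp add: lorentz_def inner_add_left algebra_simps)

lemma lorentz_add_right: "lorentz Z (X + Y) = lorentz Z X + lorentz Z Y"
  by (simp add: lorentz_def inner_add_right algebra_simps)

lemma lorentz_diff_left: "lorentz (X - Y) Z = lorentz X Z - lorentz Y Z"
  by (simp add: lorentz_def inner_diff_left algebra_simps)

lemma lorentz_diff_right: "lorentz Z (X - Y) = lorentz Z X - lorentz Z Y"
  by (simp add: lorentz_def inner_diff_right algebra_simps)

lemma lorentz_scaleR_left: "lorentz (c *\<^sub>R X) Z = c * lorentz X Z"
  by (simp add: lorentz_def algebra_simps)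

lemma lorentz_scaleR_right: "lorentz Z (c *\<^sub>R X) = c * lorentz Z X"
  by (simp add: lorentz_def algebra_simps)

lemma lorentz_0_left: "lorentz 0 Z = 0"
  by (simp add: lorentz_def)

lemma lorentz_sum_left: "lorentz (\<Sum>i\<in>I. f i) Z = (\<Sum>i\<in>I. lorentz (f i) Z)"
  by (induction I rule: infinite_finite_induct) (auto simp: lorentz_add_left lorentz_0_left)

lemma lorentz_sum_right: "lorentz Z (\<Sum>i\<in>I. f i) = (\<Sum>i\<in>I. lorentz Z (f i))"
  by (simp add: lorentz_sym[of Z] lorentz_sum_left)

lemmas lorentz_simps = lorentz_add_left lorentz_add_right lorentz_diff_left lorentz_diff_right
  lorentz_scaleR_left lorentz_scaleR_right lorentz_sum_left lorentz_sum_right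

lemma bounded_bilinear_lorentz:
  "bounded_bilinear (lorentz :: 'n::finite lorentz_space \<Rightarrow> 'n lorentz_space \<Rightarrow> real)"
proof -
  have "\<bar>lorentz X Y\<bar> \<le> norm X * norm Y * 2" for X Y :: "'n lorentz_space"
  proof -
    have le: "norm (fst Z) \<le> norm Z" "norm (snd Z) \<le> norm Z" for Z :: "'n lorentz_space"
      using norm_fst_le[of "fst Z" "snd Z"] norm_snd_le[of "snd Z" "fst Z"] by simp_all
    have "\<bar>fst X \<bullet> fst Y\<bar> \<le> norm X * norm Y"
      using Cauchy_Schwarz_ineq2[of "fst X" "fst Y"] mult_mono[OF le(1)[of X] le(1)[of Y]] by simp
    moreover have "\<bar>snd X * snd Y\<bar> \<le> norm X * norm Y"
      using mult_mono[OF le(2)[of X] le(2)[of Y]] by (simp add: abs_mult)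
    ultimately show ?thesis unfolding lorentz_def by linarith
  qed
  then show ?thesis
    by unfold_locales (auto simp: lorentz_simps intro!: exI[of _ 2])
qed

text \<open>The reflection that exchanges the unit vectors \<open>w\<close> and \<open>(0, \<epsilon>)\<close>, where \<open>\<epsilon>\<close> is chosen so that the
  mirror \<open>w - (0, \<epsilon>)\<close> is time-like.\<close>

lemma lorentz_reflection_exists:
  fixes w :: "'n::finite lorentz_space"
  assumes w: "lorentz w w = -1"
  obtains R :: "'n lorentz_space \<Rightarrow> 'n lorentz_space" and \<epsilon> :: real
  where "bounded_linear R" "\<And>X. R (R X) = X" "\<And>X Y. lorentz (R X) (R Y) = lorentz X Y"
    "R w = (0, \<epsilon>)" "\<epsilon> = 1 \<or> \<epsilon> = -1"
proof -
  \<comment> \<open>The sign opposite to that of \<open>snd w\<close> makes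
    \<open>lorentz w u = -1 + \<epsilon> * snd w\<close> at most -1.\<close>
  define \<epsilon> :: real where "\<epsilon> = (if snd w \<ge> 0 then -1 else 1)"
  define u :: "'n lorentz_space" where "u = w - (0, \<epsilon>)"
  define R :: "'n lorentz_space \<Rightarrow> 'n lorentz_space" where "R X = X - (2 * lorentz X u / lorentz u u) *\<^sub>R u" for X
  have uu: "lorentz u u = 2 * lorentz w u"
    using w by (simp add: u_def lorentz_simps) (simp add: lorentz_def \<epsilon>_def)
  have "lorentz w u = -1 + \<epsilon> * snd w"
    using w by (simp add: u_def lorentz_simps) (simp add: lorentz_def mult.commute)
  also have "\<dots> < 0" by (simp add: \<epsilon>_def)
  finally have neg: "lorentz w u < 0" .
  have "bounded_linear (\<lambda>X. lorentz X u)"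
    using bounded_bilinear.bounded_linear_left[OF bounded_bilinear_lorentz] .
  then have bl: "bounded_linear R"
    unfolding R_def[abs_def]
    by (intro bounded_linear_sub bounded_linear_ident bounded_linear_scaleR_const
        bounded_linear_compose[OF bounded_linear_divide] bounded_linear_const_mult)
  have Ru: "lorentz (R X) u = - lorentz X u" for X
    using neg uu by (simp add: R_def lorentz_simps)
  show thesis
  proof (rule that[OF bl])
    show "R (R X) = X" for X
      unfolding R_def[of "R X"] Ru by (simp add: R_def)
    show "lorentz (R X) (R Y) = lorentz X Y" for X Y
    proof -
      have "lorentz (R X) (R Y) = lorentz (R X) Y - 2 * lorentz Y u / lorentz u u * lorentz (R X) u"
        by (simp add: R_def[of Y] lorentz_simps)
      also have "\<dots> = lorentz X Y"
        unfolding Ru by (simp add: R_def[of X] lorentz_simps lorentz_sym[of u Y])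
      finally show ?thesis .
    qed
    show "R w = (0, \<epsilon>)" using neg uu by (simp add: R_def u_def)
  qed (simp add: \<epsilon>_def)
qed

lemma timelike_orthogonal_snd_zero: "lorentz (0, \<epsilon>) X = 0 \<Longrightarrow> \<epsilon> \<noteq> 0 \<Longrightarrow> snd X = 0"
  by (simp add: lorentz_def)

lemma orthonormal_frame_expansion:
  fixes L :: "real ^ 'n \<Rightarrow> 'n::finite lorentz_space" and e :: "'n \<Rightarrow> real ^ 'n"
  assumes L: "linear L"
    and e: "\<And>i j. lorentz (L (e i)) (L (e j)) = (if i = j then 1 else 0)"
  shows "v = (\<Sum>k\<in>UNIV. lorentz (L v) (L (e k)) *\<^sub>R e k)"
proof -
  have coeff: "lorentz (L (\<Sum>k\<in>UNIV. c k *\<^sub>R e k)) (L (e j)) = c j" for c :: "'n \<Rightarrow> real" and j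
    by (simp add: linear_sum[OF L] linear_cmul[OF L] lorentz_simps e if_distrib[of "(*) _"] cong: if_cong)
  have inj: "inj e"
    by (rule injI) (metis e zero_neq_one)
  have "independent (range e)"
    unfolding independent_explicit
  proof (intro conjI allI impI ballI)
    fix c v assume 0: "(\<Sum>v\<in>range e. c v *\<^sub>R v) = 0" and "v \<in> range e"
    then obtain j where j: "v = e j" by blast
    have "(\<Sum>k\<in>UNIV. c (e k) *\<^sub>R e k) = 0" using 0 by (simp add: sum.reindex[OF inj])
    then show "c v = 0" using coeff[of "\<lambda>k. c (e k)" j] L by (simp add: j linear_0 lorentz_def)
  qed simp
  moreover have "card (range e) = DIM(real ^ 'n)" by (simp add: card_image inj)
  ultimately have "UNIV \<subseteq> span (range e)"
    by (intro card_ge_dim_independent) (simp_all add: dim_UNIV)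
  then obtain c where "v = (\<Sum>w\<in>range e. c w *\<^sub>R w)"
    unfolding span_finite[OF finite_imageI[OF finite_class.finite_UNIV]] by blast
  then have v: "v = (\<Sum>k\<in>UNIV. c (e k) *\<^sub>R e k)" by (simp add: sum.reindex[OF inj])
  have "lorentz (L v) (L (e k)) = c (e k)" for k
    using coeff[of "\<lambda>k. c (e k)" k] v by simp
  then show ?thesis using v by simp
qed

text \<open>Mean curvature and squared norm are defined in an orthonormal frame but are computed in
  coordinate fields \<open>V\<close>, where the inverse Gram matrix \<open>G\<close> has to be
  inserted.\<close>

lemma frame_traces:
  fixes L K :: "real ^ 'n \<Rightarrow> 'n::finite lorentz_space" and V e :: "'n \<Rightarrow> real ^ 'n"
  assumes L: "linear L" and K: "linear K"
    and e: "\<And>i j. lorentz (L (e i)) (L (e j)) = (if i = j then 1 else 0)"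
    and G: "\<And>i j. (\<Sum>k\<in>UNIV. G i k * lorentz (L (V k)) (L (V j))) = (if i = j then 1 else 0)"
  defines "h \<equiv> \<lambda>v w. lorentz (K v) (L w)"
  shows "(\<Sum>k\<in>UNIV. h (e k) (e k)) = (\<Sum>i\<in>UNIV. \<Sum>j\<in>UNIV. G i j * h (V i) (V j))"
    and "(\<Sum>k\<in>UNIV. \<Sum>m\<in>UNIV. (h (e k) (e m))\<^sup>2) =
      (\<Sum>i\<in>UNIV. \<Sum>j\<in>UNIV. (\<Sum>k\<in>UNIV. \<Sum>m\<in>UNIV. G i k * G j m * h (V k) (V m)) * h (V i) (V j))"
proof -
  define a where "a i k = lorentz (L (V i)) (L (e k))" for i k
  have V: "V i = (\<Sum>k\<in>UNIV. a i k *\<^sub>R e k)" for i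
    unfolding a_def by (rule orthonormal_frame_expansion[OF L e])
  have g: "lorentz (L (V i)) (L (V j)) = (\<Sum>k\<in>UNIV. a i k * a j k)" for i j
    by (subst V[of j]) (simp add: linear_sum[OF L] linear_cmul[OF L] lorentz_simps a_def mult.commute)
  have h: "h (V i) (V j) = (\<Sum>k\<in>UNIV. \<Sum>m\<in>UNIV. a i k * a j m * h (e k) (e m))" for i j
    unfolding h_def
    by (subst V[of j], subst V[of i])
      (simp add: linear_sum[OF L] linear_cmul[OF L] linear_sum[OF K] linear_cmul[OF K] lorentz_simps
        sum_distrib_left mult_ac, rule sum.swap)
  \<comment> \<open>The Gram matrix of \<open>V\<close> is \<open>MA ** transpose MA\<close>, with
    left inverse \<open>MG\<close>. Moving the square factor \<open>transpose MA\<close> to the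
    front gives \<open>orth\<close>, by which contraction with \<open>G\<close> becomes summation
    over the orthonormal frame.\<close>
  define MA where "MA = (\<chi> i k. a i k)"
  define MG where "MG = (\<chi> i j. G i j)"
  have "(MG ** MA) ** transpose MA = mat 1"
    unfolding matrix_mul_assoc[symmetric]
    by (simp add: vec_eq_iff matrix_matrix_mult_def MG_def MA_def transpose_def mat_def G[unfolded g])
  then have "transpose MA ** (MG ** MA) = mat 1"
    using matrix_left_right_inverse by blast
  then have orth: "(\<Sum>i\<in>UNIV. a i k * (\<Sum>j\<in>UNIV. G i j * a j m)) = (if k = m then 1 else 0)" for k m
    by (auto simp: vec_eq_iff matrix_matrix_mult_def MG_def MA_def transpose_def mat_def)
  have Gsum: "(\<Sum>i\<in>UNIV. \<Sum>j\<in>UNIV. G i j * (a i k * a j m)) = (if k = m then 1 else 0)" for k m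
    using orth[of k m] by (simp add: sum_distrib_left mult_ac)
  have contract: "(\<Sum>i\<in>UNIV. \<Sum>j\<in>UNIV. G i j * (\<Sum>k\<in>UNIV. \<Sum>m\<in>UNIV. a i k * a j m * W k m)) = (\<Sum>k\<in>UNIV. W k k)"
    for W :: "'n \<Rightarrow> 'n \<Rightarrow> real"
  proof -
    have "(\<Sum>i\<in>UNIV. \<Sum>j\<in>UNIV. G i j * (\<Sum>k\<in>UNIV. \<Sum>m\<in>UNIV. a i k * a j m * W k m)) =
      (\<Sum>k\<in>UNIV. \<Sum>m\<in>UNIV. \<Sum>i\<in>UNIV. \<Sum>j\<in>UNIV. G i j * (a i k * a j m) * W k m)"
    proof -
      have "(\<Sum>i\<in>UNIV. \<Sum>j\<in>UNIV. \<Sum>k\<in>UNIV. \<Sum>m\<in>UNIV. G i j * (a i k * a j m * W k m)) =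
        (\<Sum>i\<in>UNIV. \<Sum>k\<in>UNIV. \<Sum>m\<in>UNIV. \<Sum>j\<in>UNIV. G i j * (a i k * a j m * W k m))"
        by (rule sum.cong[OF refl], subst sum.swap, rule sum.cong[OF refl], rule sum.swap)
      also have "\<dots> = (\<Sum>k\<in>UNIV. \<Sum>m\<in>UNIV. \<Sum>i\<in>UNIV. \<Sum>j\<in>UNIV. G i j * (a i k * a j m * W k m))"
        by (subst sum.swap, rule sum.cong[OF refl], rule sum.swap)
      finally show ?thesis by (simp only: sum_distrib_left mult.assoc)
    qed
    also have "\<dots> = (\<Sum>k\<in>UNIV. \<Sum>m\<in>UNIV. (if k = m then 1 else 0) * W k m)"
      by (simp only: sum_distrib_right[symmetric] Gsum)
    also have "\<dots> = (\<Sum>k\<in>UNIV. W k k)"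
    proof (rule sum.cong[OF refl])
      fix k
      have "(if k = m then 1 else 0) * W k m = (if k = m then W k m else 0)" for m by simp
      then show "(\<Sum>m\<in>UNIV. (if k = m then 1 else 0) * W k m) = W k k" by simp
    qed
    finally show ?thesis .
  qed
  show "(\<Sum>k\<in>UNIV. h (e k) (e k)) = (\<Sum>i\<in>UNIV. \<Sum>j\<in>UNIV. G i j * h (V i) (V j))"
    unfolding h by (rule contract[symmetric])
  show "(\<Sum>k\<in>UNIV. \<Sum>m\<in>UNIV. (h (e k) (e m))\<^sup>2) =
      (\<Sum>i\<in>UNIV. \<Sum>j\<in>UNIV. (\<Sum>k\<in>UNIV. \<Sum>m\<in>UNIV. G i k * G j m * h (V k) (V m)) * h (V i) (V j))"
  proof -
    have h1: "h (V i) w = (\<Sum>k\<in>UNIV. a i k * h (e k) w)" for i w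
      unfolding h_def by (subst V) (simp add: linear_sum[OF K] linear_cmul[OF K] lorentz_simps)
    have h2: "h w (V i) = (\<Sum>k\<in>UNIV. a i k * h w (e k))" for i w
      unfolding h_def by (subst V) (simp add: linear_sum[OF L] linear_cmul[OF L] lorentz_simps)
    have p1: "h (V i) v * h (V k) w = (\<Sum>p\<in>UNIV. \<Sum>q\<in>UNIV. a i p * a k q * (h (e p) v * h (e q) w))" for i k v w
      unfolding h1 sum_product by (simp only: mult_ac)
    have p2: "h v (V i) * h w (V k) = (\<Sum>p\<in>UNIV. \<Sum>q\<in>UNIV. a i p * a k q * (h v (e p) * h w (e q)))" for i k v w
      unfolding h2 sum_product by (simp only: mult_ac)
    have "(\<Sum>i\<in>UNIV. \<Sum>j\<in>UNIV. (\<Sum>k\<in>UNIV. \<Sum>m\<in>UNIV. G i k * G j m * h (V k) (V m)) * h (V i) (V j)) =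
      (\<Sum>j\<in>UNIV. \<Sum>i\<in>UNIV. \<Sum>m\<in>UNIV. \<Sum>k\<in>UNIV. G j m * (G i k * (h (V i) (V j) * h (V k) (V m))))"
      unfolding sum_distrib_right
      by (subst sum.swap, subst (3) sum.swap) (simp only: mult_ac)
    also have "\<dots> = (\<Sum>j\<in>UNIV. \<Sum>m\<in>UNIV. \<Sum>i\<in>UNIV. \<Sum>k\<in>UNIV. G j m * (G i k * (h (V i) (V j) * h (V k) (V m))))"
      by (rule sum.cong[OF refl], rule sum.swap)
    also have "\<dots> = (\<Sum>j\<in>UNIV. \<Sum>m\<in>UNIV. G j m * (\<Sum>p\<in>UNIV. h (e p) (V j) * h (e p) (V m)))"
      by (simp only: sum_distrib_left[symmetric] p1 contract)
    also have "\<dots> = (\<Sum>p\<in>UNIV. \<Sum>j\<in>UNIV. \<Sum>m\<in>UNIV. G j m * (h (e p) (V j) * h (e p) (V m)))"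
      unfolding sum_distrib_left by (subst (2) sum.swap, subst sum.swap) (rule refl)
    also have "\<dots> = (\<Sum>p\<in>UNIV. \<Sum>q\<in>UNIV. h (e p) (e q) * h (e p) (e q))"
      by (simp only: p2 contract)
    finally show ?thesis by (simp only: power2_eq_square)
  qed
qed

section \<open>Differentials in charts\<close>

lemma derivative_along_field:
  fixes f :: "'a::euclidean_space \<Rightarrow> 'b::euclidean_space"
  assumes S: "open S" and f: "smooth_on S f" and W: "smooth_on S W" and u: "u \<in> S"
  shows "frechet_derivative (\<lambda>w. frechet_derivative f (at w) (W w)) (at u) v =
    frechet_derivative f (at u) (frechet_derivative W (at u) v)
    + frechet_derivative (\<lambda>w. frechet_derivative f (at w) (W u)) (at u) v"
proof -
  define f' where "f' w = frechet_derivative f (at w)" for w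
  have lin: "linear (f' w)" if "w \<in> S" for w
    unfolding f'_def using smooth_on_has_derivative[OF f S that] has_derivative_linear by blast
  have rep: "f' w x = (\<Sum>b\<in>Basis. (x \<bullet> b) *\<^sub>R f' w b)" if "w \<in> S" for w x
    using linear_sum[OF lin[OF that], of "\<lambda>b. (x \<bullet> b) *\<^sub>R b" Basis]
    by (simp add: euclidean_representation linear_cmul[OF lin[OF that]])
  have db: "((\<lambda>w. f' w b) has_derivative frechet_derivative (\<lambda>w. f' w b) (at u)) (at u)" for b
    unfolding f'_def by (rule smooth_on_has_derivative[OF smooth_on_directional[OF f] S u])
  have dW: "((\<lambda>w. W w \<bullet> b) has_derivative (\<lambda>x. frechet_derivative W (at u) x \<bullet> b)) (at u)" for b
    by (rule bounded_linear.has_derivative[OF bounded_linear_inner_left smooth_on_has_derivative[OF W S u]])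
  have 1: "((\<lambda>w. \<Sum>b\<in>Basis. (W w \<bullet> b) *\<^sub>R f' w b) has_derivative
     (\<lambda>x. \<Sum>b\<in>Basis. (W u \<bullet> b) *\<^sub>R frechet_derivative (\<lambda>w. f' w b) (at u) x
        + (frechet_derivative W (at u) x \<bullet> b) *\<^sub>R f' u b)) (at u)"
    by (intro has_derivative_sum has_derivative_scaleR dW db)
  have 2: "((\<lambda>w. \<Sum>b\<in>Basis. (W u \<bullet> b) *\<^sub>R f' w b) has_derivative
     (\<lambda>x. \<Sum>b\<in>Basis. (W u \<bullet> b) *\<^sub>R frechet_derivative (\<lambda>w. f' w b) (at u) x)) (at u)"
    by (intro has_derivative_sum bounded_linear.has_derivative[OF bounded_linear_scaleR_right] db)
  have "frechet_derivative (\<lambda>w. f' w (W w)) (at u) =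
      frechet_derivative (\<lambda>w. \<Sum>b\<in>Basis. (W w \<bullet> b) *\<^sub>R f' w b) (at u)"
    by (rule frechet_derivative_cong_open[OF S u]) (rule rep)
  moreover have "frechet_derivative (\<lambda>w. f' w (W u)) (at u) =
      frechet_derivative (\<lambda>w. \<Sum>b\<in>Basis. (W u \<bullet> b) *\<^sub>R f' w b) (at u)"
    by (rule frechet_derivative_cong_open[OF S u]) (rule rep)
  ultimately show ?thesis
    unfolding f'_def[symmetric]
    by (simp add: frechet_derivative_at[OF 1, symmetric] frechet_derivative_at[OF 2, symmetric]
      sum.distrib rep[OF u, of "frechet_derivative W (at u) v"] add.commute)
qed

lemma smooth_on_lorentz:
  "open S \<Longrightarrow> smooth_on S f \<Longrightarrow> smooth_on S g \<Longrightarrow> smooth_on S (\<lambda>u. lorentz (f u) (g u))"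
  by (simp add: smooth_on_def Ck_on_bilinear[OF bounded_bilinear_lorentz])

lemma param_at:
  assumes "smooth_atlas \<A>"
  shows "param_at \<A> p \<in> \<A>" "p \<in> param_range (param_at \<A> p)"
proof -
  have "\<exists>c. c \<in> \<A> \<and> p \<in> param_range c" using assms unfolding smooth_atlas_def by blast
  then show "param_at \<A> p \<in> \<A>" "p \<in> param_range (param_at \<A> p)"
    unfolding param_at_def by (metis (mono_tags, lifting) someI_ex)+
qed

lemma atlasD:
  assumes "smooth_atlas \<A>" "c \<in> \<A>"
  shows "open (fst c)" "open (param_range c)" "homeomorphism (fst c) (param_range c) (snd c) (coords c)"
    "continuous_on (fst c) (snd c)" "continuous_on (param_range c) (coords c)"
    "u \<in> fst c \<Longrightarrow> coords c (snd c u) = u"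
    "q \<in> param_range c \<Longrightarrow> coords c q \<in> fst c"
    "q \<in> param_range c \<Longrightarrow> snd c (coords c q) = q"
proof -
  have *: "open (fst c) \<and> open (param_range c) \<and> homeomorphism (fst c) (param_range c) (snd c) (coords c)"
    using assms unfolding smooth_atlas_def by blast
  then show "open (fst c)" "open (param_range c)" and h: "homeomorphism (fst c) (param_range c) (snd c) (coords c)" by auto
  show "continuous_on (fst c) (snd c)" "continuous_on (param_range c) (coords c)"
    using h by (auto simp: homeomorphism_def)
  show "u \<in> fst c \<Longrightarrow> coords c (snd c u) = u"
    "q \<in> param_range c \<Longrightarrow> coords c q \<in> fst c"
    "q \<in> param_range c \<Longrightarrow> snd c (coords c q) = q"
    using h by (auto simp: homeomorphism_def)
qed

lemma transition_domain_open:
  assumes "smooth_atlas \<A>" "c \<in> \<A>" "c' \<in> \<A>"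
  shows "open {u \<in> fst c. snd c u \<in> param_range c'}"
proof -
  have "open (fst c \<inter> snd c -` param_range c')"
    using continuous_open_preimage[OF atlasD(4)[OF assms(1,2)] atlasD(1)[OF assms(1,2)] atlasD(2)[OF assms(1,3)]] .
  moreover have "fst c \<inter> snd c -` param_range c' = {u \<in> fst c. snd c u \<in> param_range c'}" by blast
  ultimately show ?thesis by metis
qed

lemma transition_derivative:
  assumes \<A>: "smooth_atlas \<A>" "c \<in> \<A>" "c' \<in> \<A>" and u: "u \<in> fst c" "snd c u \<in> param_range c'"
  shows "((coords c' \<circ> snd c) has_derivative frechet_derivative (coords c' \<circ> snd c) (at u)) (at u)"
proof -
  have "smooth_on {u \<in> fst c. snd c u \<in> param_range c'} (coords c' \<circ> snd c)"
    using \<A> unfolding smooth_atlas_def by blast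
  from smooth_on_has_derivative[OF this transition_domain_open[OF \<A>]] u show ?thesis by blast
qed

text \<open>Carries tangent vectors from the chart \<open>c\<close> to the chart chosen by
  \<open>param_at\<close>, in which \<open>differential\<close> reads them.\<close>

definition transition :: "('n::finite, 'm::topological_space) param set \<Rightarrow> ('n, 'm) param \<Rightarrow> real ^ 'n \<Rightarrow> real ^ 'n \<Rightarrow> real ^ 'n" where
  "transition \<A> c u = frechet_derivative (coords (param_at \<A> (snd c u)) \<circ> snd c) (at u)"

text \<open>The chain rule through the chosen chart. The two coordinate changes are mutually inverse
  near the point; by uniqueness of derivatives so are their derivatives, hence the
  bijectivity.\<close>

lemma differential_chart:
  assumes \<A>: "smooth_atlas \<A>" "c \<in> \<A>" and u: "u \<in> fst c" and f: "smooth_map \<A> f"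
  shows "frechet_derivative (f \<circ> snd c) (at u) v = differential \<A> f (snd c u) (transition \<A> c u v)"
    "bij (transition \<A> c u)" "linear (transition \<A> c u)"
proof -
  let ?q = "snd c u"
  define c' where "c' = param_at \<A> ?q"
  have c': "c' \<in> \<A>" "?q \<in> param_range c'" using param_at[OF \<A>(1)] by (simp_all add: c'_def)
  define u' where "u' = coords c' ?q"
  have u': "u' \<in> fst c'" "snd c' u' = ?q" using atlasD(7,8)[OF \<A>(1) c'(1) c'(2)] by (simp_all add: u'_def)
  have uq: "?q \<in> param_range c" using u by blast
  let ?t = "coords c' \<circ> snd c" and ?s = "coords c \<circ> snd c'"
  have t: "(?t has_derivative frechet_derivative ?t (at u)) (at u)"
    by (rule transition_derivative[OF \<A>(1,2) c'(1) u c'(2)])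
  have s: "(?s has_derivative frechet_derivative ?s (at u')) (at u')"
    by (rule transition_derivative[OF \<A>(1) c'(1) \<A>(2) u'(1)]) (simp add: u'(2) uq)
  have tu: "?t u = u'" by (simp add: u'_def)
  have su: "?s u' = u" using atlasD(6)[OF \<A> u] by (simp add: u'(2))
  have st: "((?s \<circ> ?t) has_derivative (frechet_derivative ?s (at u') \<circ> frechet_derivative ?t (at u))) (at u)"
    using diff_chain_at[OF t] s tu by simp
  have ts: "((?t \<circ> ?s) has_derivative (frechet_derivative ?t (at u) \<circ> frechet_derivative ?s (at u'))) (at u')"
    using diff_chain_at[OF s] t su by simp
  have id1: "(?s \<circ> ?t) w = id w" if "w \<in> {u \<in> fst c. snd c u \<in> param_range c'}" for w
    using that atlasD(6,8)[OF \<A>] atlasD(6,8)[OF \<A>(1) c'(1)] by auto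
  have "(id has_derivative (frechet_derivative ?s (at u') \<circ> frechet_derivative ?t (at u))) (at u)"
    using has_derivative_transform_within_open[OF st transition_domain_open[OF \<A> c'(1)] _ id1] u c'(2) by (simp add: id_def)
  then have e1: "frechet_derivative ?s (at u') \<circ> frechet_derivative ?t (at u) = id"
    using has_derivative_unique[OF _ has_derivative_id] by (simp add: id_def)
  have id2: "(?t \<circ> ?s) w = id w" if "w \<in> {u \<in> fst c'. snd c' u \<in> param_range c}" for w
    using that atlasD(6,8)[OF \<A>] atlasD(6,8)[OF \<A>(1) c'(1)] by auto
  have "(id has_derivative (frechet_derivative ?t (at u) \<circ> frechet_derivative ?s (at u'))) (at u')"
    using has_derivative_transform_within_open[OF ts transition_domain_open[OF \<A>(1) c'(1) \<A>(2)] _ id2] u'(1) uq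
    by (simp add: u'(2) id_def)
  then have e2: "frechet_derivative ?t (at u) \<circ> frechet_derivative ?s (at u') = id"
    using has_derivative_unique[OF _ has_derivative_id] by (simp add: id_def)
  have tr: "transition \<A> c u = frechet_derivative ?t (at u)" by (simp add: transition_def c'_def)
  show "bij (transition \<A> c u)" unfolding tr using o_bij[OF e1 e2] .
  show "linear (transition \<A> c u)" unfolding tr using t has_derivative_linear by blast
  have sm: "smooth_on (fst c') (f \<circ> snd c')" using f c'(1) by (simp add: smooth_map_def)
  have df: "((f \<circ> snd c') has_derivative frechet_derivative (f \<circ> snd c') (at u')) (at u')"
    by (rule smooth_on_has_derivative[OF sm atlasD(1)[OF \<A>(1) c'(1)] u'(1)])
  have "((f \<circ> snd c') \<circ> ?t has_derivative frechet_derivative (f \<circ> snd c') (at u') \<circ> frechet_derivative ?t (at u)) (at u)"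
    using diff_chain_at[OF t] df tu by simp
  then have "((f \<circ> snd c) has_derivative frechet_derivative (f \<circ> snd c') (at u') \<circ> frechet_derivative ?t (at u)) (at u)"
    by (rule has_derivative_transform_within_open[OF _ transition_domain_open[OF \<A> c'(1)]])
      (use u c'(2) atlasD(8)[OF \<A>(1) c'(1)] in auto)
  from fun_cong[OF frechet_derivative_at[OF this], of v]
  show "frechet_derivative (f \<circ> snd c) (at u) v = differential \<A> f ?q (transition \<A> c u v)"
    by (simp add: differential_def Let_def c'_def[symmetric] u'_def[symmetric] tr)
qed

section \<open>Curvature quantities in a chart\<close>

locale spacelike =
  fixes \<A> :: "('n::finite, 'm::t2_space) param set" and x N :: "'m \<Rightarrow> 'n lorentz_space"
  assumes hyp: "spacelike_hypersurface \<A> x" and nor: "unit_normal_field \<A> x N"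
begin

lemma atlas: "smooth_atlas \<A>" and conn: "connected (UNIV :: 'm set)" and smooth_x: "smooth_map \<A> x"
  using hyp by (auto simp: spacelike_hypersurface_def)

lemma smooth_N: "smooth_map \<A> N" and N_unit: "lorentz (N p) (N p) = -1"
  and N_orth: "lorentz (N p) (differential \<A> x p v) = 0"
  using nor by (auto simp: unit_normal_field_def)

lemma metric_pos: "v \<noteq> 0 \<Longrightarrow> lorentz (differential \<A> x p v) (differential \<A> x p v) > 0"
  using hyp by (auto simp: spacelike_hypersurface_def induced_metric_def)

lemma linear_differential: 
  assumes "smooth_map \<A> f" shows "linear (differential \<A> f p)"
proof -
  define c where "c = param_at \<A> p"
  have c: "c \<in> \<A>" "p \<in> param_range c" using param_at[OF atlas] by (simp_all add: c_def)
  have "smooth_on (fst c) (f \<circ> snd c)" using assms c(1) by (simp add: smooth_map_def)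
  from smooth_on_has_derivative[OF this atlasD(1)[OF atlas c(1)] atlasD(7)[OF atlas c]]
  show ?thesis unfolding differential_def Let_def c_def using has_derivative_linear by blast
qed

text \<open>A tangent vector whose image under \<open>R\<close> has first component zero has
  nonpositive Lorentz square, so it vanishes on a space-like hypersurface. Equality of dimensions
  gives surjectivity.\<close>

lemma horizontal_projection:
  fixes R :: "'n lorentz_space \<Rightarrow> 'n lorentz_space"
  assumes R: "bounded_linear R" "\<And>X Y. lorentz (R X) (R Y) = lorentz X Y"
  shows "linear (\<lambda>v. fst (R (differential \<A> x p v)))" "bij (\<lambda>v. fst (R (differential \<A> x p v)))"
proof -
  have l: "linear (\<lambda>v. R (differential \<A> x p v))"
    using linear_compose[OF linear_differential[OF smooth_x] bounded_linear.linear[OF R(1)]] by (simp add: o_def)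
  show lin: "linear (\<lambda>v. fst (R (differential \<A> x p v)))"
    using linear_compose[OF l linear_fst] by (simp add: o_def)
  have "v = 0" if "fst (R (differential \<A> x p v)) = 0" for v
  proof (rule ccontr)
    assume "v \<noteq> 0"
    from metric_pos[OF this, of p] have "lorentz (R (differential \<A> x p v)) (R (differential \<A> x p v)) > 0"
      by (simp add: R(2))
    then show False using that by (simp add: lorentz_def)
  qed
  then have "inj (\<lambda>v. fst (R (differential \<A> x p v)))"
    using linear_injective_0[OF lin] by blast
  then show "bij (\<lambda>v. fst (R (differential \<A> x p v)))"
    using linear_injective_imp_surjective[OF lin] by (simp add: bij_def)
qed

lemma adapted_reflection:
  obtains R :: "'n lorentz_space \<Rightarrow> 'n lorentz_space" and \<epsilon> where "bounded_linear R" "\<And>X. R (R X) = X" "\<And>X Y. lorentz (R X) (R Y) = lorentz X Y"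
    "R (N p) = (0, \<epsilon>)" "\<epsilon> = 1 \<or> \<epsilon> = -1"
  using lorentz_reflection_exists[OF N_unit[of p]] by metis

lemma tangent_snd:
  fixes R :: "'n lorentz_space \<Rightarrow> 'n lorentz_space"
  assumes "R (N p) = (0, \<epsilon>)" "\<epsilon> = 1 \<or> \<epsilon> = -1" "\<And>X Y. lorentz (R X) (R Y) = lorentz X Y" "lorentz (N p) X = 0"
  shows "snd (R X) = 0"
  using timelike_orthogonal_snd_zero[of \<epsilon> "R X"] assms(1,2,4) assms(3)[of "N p" X] by auto

text \<open>In horizontal position the induced metric is the Euclidean product of the first
  components, so the standard basis can be pulled back.\<close>

lemma frame_exists: "\<exists>e. orthonormal_frame \<A> x p e"
proof -
  obtain R :: "'n lorentz_space \<Rightarrow> 'n lorentz_space" and \<epsilon> where R: "bounded_linear R" "\<And>X Y. lorentz (R X) (R Y) = lorentz X Y"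
    "R (N p) = (0, \<epsilon>)" "\<epsilon> = 1 \<or> \<epsilon> = -1"
    using adapted_reflection[of p] by metis
  define L where "L v = fst (R (differential \<A> x p v))" for v
  have b: "bij L" unfolding L_def[abs_def] by (rule horizontal_projection(2)[OF R(1,2)])
  have s: "snd (R (differential \<A> x p v)) = 0" for v
    by (rule tangent_snd[OF R(3,4,2) N_orth])
  define e where "e i = inv L (axis i 1)" for i
  have "L (e i) = axis i 1" for i using b by (simp add: e_def bij_is_surj surj_f_inv_f)
  then have "lorentz (differential \<A> x p (e i)) (differential \<A> x p (e j)) = (if i = j then 1 else 0)" for i j
    by (subst R(2)[symmetric]) (simp add: lorentz_def s L_def[symmetric] inner_axis_axis)
  then show ?thesis unfolding orthonormal_frame_def induced_metric_def by blast
qed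

lemma frame_at: "induced_metric \<A> x p (frame_at \<A> x p i) (frame_at \<A> x p j) = (if i = j then 1 else 0)"
  using someI_ex[OF frame_exists[of p]] by (simp add: frame_at_def orthonormal_frame_def)

lemma curvatures_in_basis:
  fixes V :: "'n \<Rightarrow> real ^ 'n"
  assumes c: "c \<in> \<A>" and u: "u \<in> fst c"
  defines "L \<equiv> frechet_derivative (x \<circ> snd c) (at u)" and "K \<equiv> frechet_derivative (N \<circ> snd c) (at u)"
  assumes G: "\<And>i j. (\<Sum>k\<in>UNIV. G i k * lorentz (L (V k)) (L (V j))) = (if i = j then 1 else 0)"
  defines "h \<equiv> \<lambda>v w. lorentz (K v) (L w)"
  shows "mean_curvature \<A> x N (snd c u) = (\<Sum>i\<in>UNIV. \<Sum>j\<in>UNIV. G i j * h (V i) (V j))"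
    and "sq_norm_sff \<A> x N (snd c u) =
      (\<Sum>i\<in>UNIV. \<Sum>j\<in>UNIV. (\<Sum>k\<in>UNIV. \<Sum>m\<in>UNIV. G i k * G j m * h (V k) (V m)) * h (V i) (V j))"
proof -
  let ?q = "snd c u"
  let ?\<tau> = "transition \<A> c u"
  have L: "L v = differential \<A> x ?q (?\<tau> v)" for v
    unfolding L_def by (rule differential_chart(1)[OF atlas c u smooth_x])
  have K: "K v = differential \<A> N ?q (?\<tau> v)" for v
    unfolding K_def by (rule differential_chart(1)[OF atlas c u smooth_N])
  have e: "lorentz (differential \<A> x ?q (frame_at \<A> x ?q i)) (differential \<A> x ?q (frame_at \<A> x ?q j)) = (if i = j then 1 else 0)" for i j
    using frame_at[of ?q i j] by (simp add: induced_metric_def)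
  note tr = frame_traces[OF linear_differential[OF smooth_x, of ?q] linear_differential[OF smooth_N, of ?q] e, of G "\<lambda>i. ?\<tau> (V i)",
    folded L K, OF G]
  show "mean_curvature \<A> x N ?q = (\<Sum>i\<in>UNIV. \<Sum>j\<in>UNIV. G i j * h (V i) (V j))"
    using tr(1) by (simp add: h_def mean_curvature_def second_fundamental_form_def Let_def)
  show "sq_norm_sff \<A> x N ?q =
      (\<Sum>i\<in>UNIV. \<Sum>j\<in>UNIV. (\<Sum>k\<in>UNIV. \<Sum>m\<in>UNIV. G i k * G j m * h (V k) (V m)) * h (V i) (V j))"
    using tr(2) by (simp add: h_def sq_norm_sff_def second_fundamental_form_def Let_def)
qed

end

section \<open>Charts adapted to a tangent plane\<close>

lemma smooth_on_det:
  fixes M :: "'a::euclidean_space \<Rightarrow> real ^ 'n ^ 'n"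
  assumes S: "open S" and M: "\<And>i j. smooth_on S (\<lambda>u. M u $ i $ j)"
  shows "smooth_on S (\<lambda>u. det (M u))"
  unfolding det_def by (intro smooth_on_sum smooth_on_mult smooth_on_prod smooth_on_const S M)

text \<open>\<open>R\<close> is left free: a reflection adapted to a point serves the curvature
  computation at that point, the identity serves the projection of the whole hypersurface.\<close>

locale isometry_chart = spacelike \<A> x N
  for \<A> :: "('n::finite, 'm::t2_space) param set" and x N :: "'m \<Rightarrow> 'n lorentz_space" +
  fixes c :: "('n, 'm) param" and R :: "'n lorentz_space \<Rightarrow> 'n lorentz_space"
  assumes c: "c \<in> \<A>" and R: "bounded_linear R"
    and R_iso: "lorentz (R X) (R Y) = lorentz X Y"
begin

definition X where "X u = R (x (snd c u))"
definition \<mu> where "\<mu> u = R (N (snd c u))"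
definition dX where "dX u = frechet_derivative X (at u)"
definition d\<mu> where "d\<mu> u = frechet_derivative \<mu> (at u)"

lemma open_c: "open (fst c)" by (rule atlasD(1)[OF atlas c])

lemma smooth_xc: "smooth_on (fst c) (x \<circ> snd c)" and smooth_Nc: "smooth_on (fst c) (N \<circ> snd c)"
  using smooth_x smooth_N c by (auto simp: smooth_map_def)

lemma smooth_X: "smooth_on (fst c) X" and smooth_\<mu>: "smooth_on (fst c) \<mu>"
  using smooth_on_linear[OF R open_c smooth_xc] smooth_on_linear[OF R open_c smooth_Nc]
  by (simp_all add: X_def[abs_def] \<mu>_def[abs_def])

lemma dX_eq: "u \<in> fst c \<Longrightarrow> dX u v = R (frechet_derivative (x \<circ> snd c) (at u) v)"
  using frechet_derivative_linear_compose[OF R smooth_on_has_derivative[OF smooth_xc open_c], of u]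
  by (simp add: dX_def X_def[abs_def])

lemma d\<mu>_eq: "u \<in> fst c \<Longrightarrow> d\<mu> u v = R (frechet_derivative (N \<circ> snd c) (at u) v)"
  using frechet_derivative_linear_compose[OF R smooth_on_has_derivative[OF smooth_Nc open_c], of u]
  by (simp add: d\<mu>_def \<mu>_def[abs_def])

lemma has_dX: "u \<in> fst c \<Longrightarrow> (X has_derivative dX u) (at u)"
  unfolding dX_def by (rule smooth_on_has_derivative[OF smooth_X open_c])

lemma dX_differential: "u \<in> fst c \<Longrightarrow> dX u v = R (differential \<A> x (snd c u) (transition \<A> c u v))"
  using differential_chart(1)[OF atlas c _ smooth_x] by (simp add: dX_eq)

lemma d\<mu>_differential: "u \<in> fst c \<Longrightarrow> d\<mu> u v = R (differential \<A> N (snd c u) (transition \<A> c u v))"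
  using differential_chart(1)[OF atlas c _ smooth_N] by (simp add: d\<mu>_eq)

lemma \<mu>_orth: "u \<in> fst c \<Longrightarrow> lorentz (\<mu> u) (dX u v) = 0"
  by (simp add: \<mu>_def dX_differential R_iso N_orth)

lemma \<mu>_unit: "lorentz (\<mu> u) (\<mu> u) = -1"
  by (simp add: \<mu>_def R_iso N_unit)

lemma linear_dX: "u \<in> fst c \<Longrightarrow> linear (dX u)"
  using has_dX has_derivative_linear by blast

lemma linear_dY: "u \<in> fst c \<Longrightarrow> linear (\<lambda>v. fst (dX u v))"
  using linear_compose[OF linear_dX linear_fst] by (simp add: o_def)

lemma inj_dY: 
  assumes u: "u \<in> fst c" shows "inj (\<lambda>v. fst (dX u v))"
proof -
  have "(\<lambda>v. fst (dX u v)) = (\<lambda>v. fst (R (differential \<A> x (snd c u) v))) \<circ> transition \<A> c u"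
    by (simp add: fun_eq_iff dX_differential[OF u])
  moreover have "inj (\<lambda>v. fst (R (differential \<A> x (snd c u) v)))"
    using horizontal_projection(2)[OF R R_iso] by (rule bij_is_inj)
  moreover have "inj (transition \<A> c u)"
    using differential_chart(2)[OF atlas c u smooth_x] by (rule bij_is_inj)
  ultimately show ?thesis by (simp only: inj_compose)
qed

definition J where "J u = matrix (\<lambda>v. fst (dX u v))"

lemma det_J: "u \<in> fst c \<Longrightarrow> det (J u) \<noteq> 0"
  unfolding J_def using linear_dY inj_dY det_nz_iff_inj by blast

lemma J_mult: "u \<in> fst c \<Longrightarrow> J u *v v = fst (dX u v)"
  unfolding J_def using matrix_works[of "\<lambda>v. fst (dX u v)"] linear_dY[of u] by simp

text \<open>Cramer's rule for \<open>J u *v V i u = axis i 1\<close>, so that smoothness in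
  \<open>u\<close> can be read off from determinants.\<close>

definition V :: "'n \<Rightarrow> real ^ 'n \<Rightarrow> real ^ 'n" where
  "V i u = (\<chi> k. det (\<chi> i' j. if j = k then axis i 1 $ i' else J u $ i' $ j) / det (J u))"

lemma dY_V: "u \<in> fst c \<Longrightarrow> fst (dX u (V i u)) = axis i 1"
  using cramer[OF det_J, of u "V i u" "axis i 1"] by (simp add: V_def J_mult)

lemma smooth_J: "smooth_on (fst c) (\<lambda>u. J u $ i $ j)"
  unfolding J_def matrix_def dX_def
  by (simp, intro smooth_on_vec_nth smooth_on_fst open_c smooth_on_directional smooth_X)

lemma smooth_V: "smooth_on (fst c) (V i)"
proof (rule smooth_on_vec_lambda[OF open_c])
  fix k
  have "smooth_on (fst c) (\<lambda>u. if j = k then axis i 1 $ i' else J u $ i' $ j)" for i' j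
    by (cases "j = k") (simp_all add: smooth_on_const smooth_J)
  then have "smooth_on (fst c) (\<lambda>u. det (\<chi> i' j. if j = k then axis i 1 $ i' else J u $ i' $ j))"
    by (intro smooth_on_det open_c) simp
  moreover have "smooth_on (fst c) (\<lambda>u. inverse (det (J u)))"
    by (intro smooth_on_inverse smooth_on_det open_c det_J smooth_J)
  ultimately show "smooth_on (fst c) (\<lambda>u. V i u $ k)"
    using smooth_on_mult[OF open_c] by (simp add: V_def divide_inverse)
qed

lemma smooth_fst_X: "smooth_on (fst c) (\<lambda>u. fst (X u))"
  by (intro smooth_on_fst open_c smooth_X)

lemma dY: "u \<in> fst c \<Longrightarrow> frechet_derivative (\<lambda>u. fst (X u)) (at u) v = fst (dX u v)"
  using frechet_derivative_linear_compose[OF bounded_linear_fst has_dX] frechet_derivative_at[OF has_dX] by simp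

text \<open>The fields \<open>V i\<close> are the coordinate fields of \<open>fst \<circ> X\<close>, hence commute.\<close>

lemma V_bracket:
  assumes u: "u \<in> fst c"
  shows "frechet_derivative (V j) (at u) (V i u) = frechet_derivative (V i) (at u) (V j u)"
proof -
  let ?Y = "\<lambda>u. fst (X u)"
  have "frechet_derivative (\<lambda>w. frechet_derivative ?Y (at w) (V j w)) (at u) =
    frechet_derivative (\<lambda>w. axis j 1) (at u)" for j
    by (rule frechet_derivative_cong_open[OF open_c u]) (simp add: dY dY_V)
  \<comment> \<open>The image of \<open>V j\<close> under the derivative of the projection is
    constant. Differentiating this once more leaves the derivative of \<open>V j\<close> and a
    second derivative, which is symmetric.\<close>
  then have 0: "0 = frechet_derivative ?Y (at u) (frechet_derivative (V j) (at u) v)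
    + frechet_derivative (\<lambda>w. frechet_derivative ?Y (at w) (V j u)) (at u) v" for j v
    using derivative_along_field[OF open_c smooth_fst_X smooth_V u, of j v] by simp
  have "frechet_derivative ?Y (at u) (frechet_derivative (V j) (at u) (V i u)) =
     frechet_derivative ?Y (at u) (frechet_derivative (V i) (at u) (V j u))"
    using 0[of j "V i u"] 0[of i "V j u"] second_derivative_symmetric[OF open_c smooth_fst_X u, of "V j u" "V i u"]
    by (metis add_right_cancel)
  then show ?thesis using inj_dY[OF u] unfolding dY[OF u] by (simp add: inj_def)
qed

definition y where "y i u = fst (X u) $ i"
definition z where "z u = snd (X u)"
definition \<theta> where "\<theta> u = snd (\<mu> u)"

sublocale graph: commuting_fields "fst c" V
  by unfold_locales (rule open_c, rule smooth_V, rule V_bracket)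

lemma d_X: "u \<in> fst c \<Longrightarrow> graph.d i X u = dX u (V i u)" by (simp add: graph.d_def dX_def)
lemma d_\<mu>: "u \<in> fst c \<Longrightarrow> graph.d i \<mu> u = d\<mu> u (V i u)" by (simp add: graph.d_def d\<mu>_def)

lemma d_y: "u \<in> fst c \<Longrightarrow> graph.d i (y j) u = (if i = j then 1 else 0)"
proof -
  assume u: "u \<in> fst c"
  have "bounded_linear (\<lambda>X :: 'n lorentz_space. fst X $ j)"
    using bounded_linear_compose[OF bounded_linear_vec_nth bounded_linear_fst] .
  from graph.d_linear[OF this smooth_X u, of i]
  show ?thesis by (simp add: y_def[abs_def] d_X[OF u] dY_V[OF u] axis_def)
qed

lemma d_z: "u \<in> fst c \<Longrightarrow> graph.d i z u = snd (dX u (V i u))"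
  using graph.d_linear[OF bounded_linear_snd smooth_X, of u i] by (simp add: z_def[abs_def] d_X)

lemma d_\<theta>: "u \<in> fst c \<Longrightarrow> graph.d i \<theta> u = snd (d\<mu> u (V i u))"
  using graph.d_linear[OF bounded_linear_snd smooth_\<mu>, of u i] by (simp add: \<theta>_def[abs_def] d_\<mu>)

lemma dX_V: "u \<in> fst c \<Longrightarrow> dX u (V i u) = (axis i 1, graph.d i z u)"
  by (simp add: prod_eq_iff dY_V d_z)

lemma fst_\<mu>: "u \<in> fst c \<Longrightarrow> fst (\<mu> u) $ i = \<theta> u * graph.d i z u"
  using \<mu>_orth[of u "V i u"] by (simp add: dX_V lorentz_def \<theta>_def inner_axis)

end

locale adapted_chart = isometry_chart \<A> x N c R
  for \<A> :: "('n::finite, 'm::t2_space) param set" and x N :: "'m \<Rightarrow> 'n lorentz_space" and c R +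
  fixes u0 :: "real ^ 'n" and \<epsilon> :: real
  assumes u0: "u0 \<in> fst c" and R_N: "R (N (snd c u0)) = (0, \<epsilon>)" and \<epsilon>: "\<epsilon> = 1 \<or> \<epsilon> = -1"
begin

lemma \<mu>_u0: "\<mu> u0 = (0, \<epsilon>)" by (simp add: \<mu>_def R_N)

sublocale graph: lambda_graph "fst c" V y z \<theta> u0
proof unfold_locales
  show "smooth_on (fst c) (y i)" for i
    unfolding y_def by (intro smooth_on_vec_nth smooth_fst_X open_c)
  show "smooth_on (fst c) z" "smooth_on (fst c) \<theta>"
    unfolding z_def \<theta>_def by (intro smooth_on_snd smooth_X smooth_\<mu> open_c)+
  show "u0 \<in> fst c" by (rule u0)
  show "u \<in> fst c \<Longrightarrow> graph.d i (y j) u = (if i = j then 1 else 0)" for u i j by (rule d_y)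
  show "(\<Sum>i\<in>UNIV. (\<theta> u * graph.d i z u) * (\<theta> u * graph.d i z u)) = \<theta> u * \<theta> u - 1" if "u \<in> fst c" for u
    using \<mu>_unit[of u] by (simp add: fst_\<mu>[OF that] lorentz_def inner_vec_def \<theta>_def)
  show "graph.d i z u0 = 0" for i
    using fst_\<mu>[OF u0, of i] \<mu>_u0 \<epsilon> by (auto simp: \<theta>_def)
qed

lemma \<mu>_eq: "u \<in> fst c \<Longrightarrow> \<mu> u = (\<chi> i. graph.\<nu> i u, \<theta> u)"
  by (simp add: prod_eq_iff vec_eq_iff fst_\<mu> graph.\<nu>_def \<theta>_def)

lemma d\<mu>_V: 
  assumes u: "u \<in> fst c"
  shows "d\<mu> u (V i u) = (\<chi> j. graph.d i (graph.\<nu> j) u, graph.d i \<theta> u)"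
proof -
  have "bounded_linear (\<lambda>X :: 'n lorentz_space. fst X $ j)" for j
    using bounded_linear_compose[OF bounded_linear_vec_nth bounded_linear_fst] .
  from graph.d_linear[OF this smooth_\<mu> u]
  have "fst (d\<mu> u (V i u)) $ j = graph.d i (\<lambda>w. fst (\<mu> w) $ j) u" for j by (simp add: d_\<mu>[OF u])
  also have "graph.d i (\<lambda>w. fst (\<mu> w) $ j) u = graph.d i (graph.\<nu> j) u" for j
    by (rule graph.d_cong[OF _ u]) (simp add: \<mu>_eq)
  finally show ?thesis by (simp add: prod_eq_iff vec_eq_iff d_\<theta>[OF u])
qed

lemma sff_V:
  assumes u: "u \<in> fst c"
  shows "lorentz (d\<mu> u (V i u)) (dX u (V j u)) = \<theta> u * graph.z2 i j u"
proof -
  have "graph.d i (graph.\<nu> j) u = graph.d i \<theta> u * graph.d j z u + \<theta> u * graph.d i (graph.d j z) u"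
    unfolding graph.\<nu>_def[abs_def] using graph.d_mult[OF graph.smooth_\<theta> graph.smooth_d[OF graph.smooth_z] u] .
  then show ?thesis
    by (simp add: d\<mu>_V[OF u] dX_V[OF u] lorentz_def inner_axis graph.z2_sym[OF u, of i j]) (simp add: graph.z2_def)
qed

lemma metric_V:
  assumes u: "u \<in> fst c"
  shows "lorentz (dX u (V i u)) (dX u (V j u)) = (if i = j then 1 else 0) - graph.d i z u * graph.d j z u"
  by (simp add: dX_V[OF u] lorentz_def inner_axis_axis)

text \<open>The inverse of a rank one perturbation of the identity. Its factor
  \<open>1 / (1 - |\<nabla>z|\<^sup>2)\<close> equals \<open>\<theta>\<^sup>2\<close>, because the
  normal has unit length.\<close>

lemma inverse_metric_V:
  assumes u: "u \<in> fst c"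
  shows "(\<Sum>k\<in>UNIV. ((if i = k then 1 else 0) + graph.\<nu> i u * graph.\<nu> k u) * lorentz (dX u (V k u)) (dX u (V j u)))
    = (if i = j then 1 else 0)"
proof -
  let ?f = "\<lambda>i. graph.d i z u"
  have "((if i = k then 1 else 0) + graph.\<nu> i u * graph.\<nu> k u) * lorentz (dX u (V k u)) (dX u (V j u)) =
     (if k = i then (if i = j then 1 else 0) - ?f i * ?f j else 0)
     + (if k = j then graph.\<nu> i u * graph.\<nu> j u else 0) - ?f i * ?f j * (graph.\<nu> k u * graph.\<nu> k u)" for k
    unfolding metric_V[OF u] by (simp add: graph.\<nu>_def algebra_simps)
  then have "(\<Sum>k\<in>UNIV. ((if i = k then 1 else 0) + graph.\<nu> i u * graph.\<nu> k u) * lorentz (dX u (V k u)) (dX u (V j u))) =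
     (if i = j then 1 else 0) - ?f i * ?f j + graph.\<nu> i u * graph.\<nu> j u - ?f i * ?f j * (\<Sum>k\<in>UNIV. graph.\<nu> k u * graph.\<nu> k u)"
    by (simp add: sum.distrib sum_subtractf sum_distrib_left[symmetric])
  then show ?thesis
    unfolding graph.unit_\<nu>[OF u] by (simp add: graph.\<nu>_def algebra_simps)
qed

lemma mean_curvature_eq: 
  assumes u: "u \<in> fst c" shows "mean_curvature \<A> x N (snd c u) = graph.mean u"
  and sq_norm_sff_eq: "sq_norm_sff \<A> x N (snd c u) = graph.sqn u"
proof -
  let ?G = "\<lambda>i k. (if i = k then 1 else 0) + graph.\<nu> i u * graph.\<nu> k u"
  let ?z = "\<lambda>i j. graph.z2 i j u" and ?\<nu> = "\<lambda>i. graph.\<nu> i u" and ?r = "\<lambda>j. graph.r j u"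
  have met: "lorentz (frechet_derivative (x \<circ> snd c) (at u) v) (frechet_derivative (x \<circ> snd c) (at u) w) = lorentz (dX u v) (dX u w)" for v w
    by (simp add: dX_eq[OF u] R_iso)
  have sff: "lorentz (frechet_derivative (N \<circ> snd c) (at u) v) (frechet_derivative (x \<circ> snd c) (at u) w) = lorentz (d\<mu> u v) (dX u w)" for v w
    by (simp add: dX_eq[OF u] d\<mu>_eq[OF u] R_iso)
  note cv = curvatures_in_basis[OF c u, of ?G "\<lambda>i. V i u", unfolded met sff, OF inverse_metric_V[OF u], unfolded sff_V[OF u]]
  \<comment> \<open>Contraction with the inverse metric leaves the tensor itself plus
    \<open>\<nu>\<close> times its contraction with \<open>\<nu>\<close>. Applied to the indices of
    the Hessian, this produces \<open>r\<close> and \<open>q\<close>.\<close>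
  have one: "(\<Sum>k\<in>UNIV. ?G i k * W k) = W i + ?\<nu> i * (\<Sum>k\<in>UNIV. ?\<nu> k * W k)" for i and W :: "'n \<Rightarrow> real"
  proof -
    have "?G i k * W k = (if k = i then W i else 0) + ?\<nu> i * (?\<nu> k * W k)" for k by (simp add: algebra_simps)
    then show ?thesis by (simp add: sum.distrib sum_distrib_left)
  qed
  have zr: "(\<Sum>k\<in>UNIV. ?\<nu> k * ?z i k) = ?r i" for i
    unfolding graph.r_def by (intro sum.cong refl arg_cong2[where f = "(*)"] graph.z2_sym u)
  have rz: "(\<Sum>k\<in>UNIV. ?\<nu> k * ?z k i) = ?r i" for i by (simp add: graph.r_def)
  have q: "(\<Sum>k\<in>UNIV. ?\<nu> k * ?r k) = graph.q u" by (simp add: graph.q_def)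
  have "(\<Sum>i\<in>UNIV. \<Sum>j\<in>UNIV. ?G i j * (\<theta> u * ?z i j)) = (\<Sum>i\<in>UNIV. \<theta> u * (?z i i + ?\<nu> i * ?r i))"
  proof (rule sum.cong[OF refl])
    fix i
    have "(\<Sum>j\<in>UNIV. ?G i j * (\<theta> u * ?z i j)) = \<theta> u * (\<Sum>j\<in>UNIV. ?G i j * ?z i j)"
      by (simp only: sum_distrib_left mult.left_commute)
    then show "(\<Sum>j\<in>UNIV. ?G i j * (\<theta> u * ?z i j)) = \<theta> u * (?z i i + ?\<nu> i * ?r i)"
      by (simp only: one zr)
  qed
  then show "mean_curvature \<A> x N (snd c u) = graph.mean u"
    unfolding cv(1) graph.mean_def by (simp only: sum_distrib_left[symmetric] sum.distrib q)
  have two: "(\<Sum>k\<in>UNIV. \<Sum>m\<in>UNIV. ?G i k * ?G j m * (\<theta> u * ?z k m)) =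
     \<theta> u * (?z i j + ?\<nu> j * ?r i + ?\<nu> i * (?r j + ?\<nu> j * graph.q u))" for i j
  proof -
    have "(\<Sum>k\<in>UNIV. \<Sum>m\<in>UNIV. ?G i k * ?G j m * (\<theta> u * ?z k m)) =
      \<theta> u * (\<Sum>k\<in>UNIV. ?G i k * (\<Sum>m\<in>UNIV. ?G j m * ?z k m))"
      by (simp only: sum_distrib_left mult_ac)
    also have "(\<Sum>k\<in>UNIV. ?G i k * (\<Sum>m\<in>UNIV. ?G j m * ?z k m)) = 
      ?z i j + ?\<nu> j * ?r i + ?\<nu> i * (\<Sum>k\<in>UNIV. ?\<nu> k * (?z k j + ?\<nu> j * ?r k))"
      by (simp only: one zr)
    also have "(\<Sum>k\<in>UNIV. ?\<nu> k * (?z k j + ?\<nu> j * ?r k)) = ?r j + ?\<nu> j * graph.q u"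
    proof -
      have "?\<nu> k * (?z k j + ?\<nu> j * ?r k) = ?\<nu> k * ?z k j + ?\<nu> j * (?\<nu> k * ?r k)" for k by (simp add: algebra_simps)
      then show ?thesis by (simp only: sum.distrib sum_distrib_left[symmetric] rz q)
    qed
    finally show ?thesis .
  qed
  have "sq_norm_sff \<A> x N (snd c u) = (\<Sum>i\<in>UNIV. \<Sum>j\<in>UNIV.
     \<theta> u * (?z i j + ?\<nu> j * ?r i + ?\<nu> i * (?r j + ?\<nu> j * graph.q u)) * (\<theta> u * ?z i j))"
    unfolding cv(2) two ..
  also have "\<dots> = (\<Sum>i\<in>UNIV. \<Sum>j\<in>UNIV. (\<theta> u * \<theta> u) * (?z i j * ?z i j)
     + (\<theta> u * \<theta> u) * (?r i * (?\<nu> j * ?z i j)) + (\<theta> u * \<theta> u) * (?r j * (?\<nu> i * ?z i j))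
     + (\<theta> u * \<theta> u) * (graph.q u * (?\<nu> i * (?\<nu> j * ?z i j))))"
    by (intro sum.cong refl) (simp add: algebra_simps)
  also have "\<dots> = (\<theta> u * \<theta> u) * (\<Sum>i\<in>UNIV. \<Sum>j\<in>UNIV. ?z i j * ?z i j)
     + (\<theta> u * \<theta> u) * (\<Sum>i\<in>UNIV. ?r i * ?r i) + (\<theta> u * \<theta> u) * (\<Sum>i\<in>UNIV. \<Sum>j\<in>UNIV. ?r j * (?\<nu> i * ?z i j))
     + (\<theta> u * \<theta> u) * (graph.q u * graph.q u)"
    by (simp only: sum.distrib sum_distrib_left[symmetric] zr q)
  also have "(\<Sum>i\<in>UNIV. \<Sum>j\<in>UNIV. ?r j * (?\<nu> i * ?z i j)) = (\<Sum>j\<in>UNIV. ?r j * ?r j)"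
    by (subst sum.swap) (simp only: sum_distrib_left[symmetric] rz)
  finally show "sq_norm_sff \<A> x N (snd c u) = graph.sqn u"
    unfolding graph.sqn_def by (simp add: algebra_simps)
qed

end

section \<open>The pinching condition forces total umbilicity\<close>

locale pinched_spacelike = spacelike \<A> x N
  for \<A> :: "('n::finite, 'm::t2_space) param set" and x N :: "'m \<Rightarrow> 'n lorentz_space" +
  fixes l B :: real
  assumes n2: "CARD('n) \<ge> 2"
    and lam: "lambda_hypersurface \<A> x N l"
    and pinched: "sq_norm_sff \<A> x N p - (mean_curvature \<A> x N p)\<^sup>2 / real CARD('n) = B"
    and psd: "pos_semidef \<A> x p (\<lambda>v. 4 *\<^sub>R shape_operator \<A> x N p (shape_operator \<A> x N p v)
        - (4 * mean_curvature \<A> x N p / real CARD('n)) *\<^sub>R shape_operator \<A> x N p v + B *\<^sub>R v)"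
    and pinching: "(sqrt B - \<bar>l\<bar> * ((real CARD('n) - 2) / (2 * sqrt (real CARD('n) * (real CARD('n) - 1)))))\<^sup>2
        + (mean_curvature \<A> x N p - l)\<^sup>2 / real CARD('n) - real CARD('n) * l\<^sup>2 / (4 * (real CARD('n) - 1)) \<ge> 0"

locale pinched_chart = pinched_spacelike \<A> x N l B + adapted_chart \<A> x N c R u0 \<epsilon>
  for \<A> :: "('n::finite, 'm::t2_space) param set" and x N :: "'m \<Rightarrow> 'n lorentz_space"
    and l B c R u0 \<epsilon>
begin

lemma lorentz_x_x: "u \<in> fst c \<Longrightarrow> lorentz (x (snd c u)) (x (snd c u)) = graph.sx u"
  by (subst R_iso[symmetric]) (simp add: X_def[symmetric] lorentz_def graph.sx_def y_def z_def inner_vec_def)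

lemma lorentz_x_N: "u \<in> fst c \<Longrightarrow> lorentz (x (snd c u)) (N (snd c u)) = graph.wx u"
  by (subst R_iso[symmetric])
    (simp add: X_def[symmetric] \<mu>_def[symmetric] \<mu>_eq lorentz_def graph.wx_def y_def z_def inner_vec_def)

sublocale graph: pinched_lambda_graph "fst c" V y z \<theta> u0 l B
proof unfold_locales
  show "graph.mean u = l + graph.sx u * graph.wx u" if u: "u \<in> fst c" for u
    using lam unfolding lambda_hypersurface_def
    by (simp add: mean_curvature_eq[OF u, symmetric] lorentz_x_x[OF u, symmetric] lorentz_x_N[OF u, symmetric] diff_eq_eq)
  show "graph.sqn u - graph.mean u * graph.mean u / real CARD('n) = B" if u: "u \<in> fst c" for u
    using pinched[of "snd c u"] by (simp add: mean_curvature_eq[OF u] sq_norm_sff_eq[OF u] power2_eq_square)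
qed

section \<open>Tangent space and shape operator in horizontal coordinates\<close>

abbreviation q where "q \<equiv> snd c u0"

definition Lq where "Lq v = fst (R (differential \<A> x q v))"
definition E where "E i = transition \<A> c u0 (V i u0)"
definition \<Phi> where "\<Phi> w = (\<chi> j. graph.\<epsilon> * (\<Sum>i\<in>UNIV. graph.F j i * w $ i))"

lemma Lq: "linear Lq" "bij Lq"
  using horizontal_projection[OF R R_iso] by (simp_all add: Lq_def[abs_def])

lemma R_dx: "R (differential \<A> x q v) = (Lq v, 0)"
  using tangent_snd[OF R_N \<epsilon> R_iso N_orth] by (simp add: Lq_def prod_eq_iff)

lemma Lq_E: "Lq (E i) = axis i 1"
  unfolding Lq_def E_def dX_differential[OF u0, symmetric] by (rule dY_V[OF u0])

lemma expand_E: "v = (\<Sum>i\<in>UNIV. Lq v $ i *\<^sub>R E i)"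
proof -
  have "Lq v = Lq (\<Sum>i\<in>UNIV. Lq v $ i *\<^sub>R E i)"
    by (simp add: linear_sum[OF Lq(1)] linear_cmul[OF Lq(1)] Lq_E)
      (simp add: vec_eq_iff axis_def if_distrib cong: if_cong)
  then show ?thesis using bij_is_inj[OF Lq(2)] by (simp add: inj_eq)
qed

lemma R_dN: "R (differential \<A> N q v) = (\<Phi> (Lq v), 0)"
proof -
  have lin: "linear (\<lambda>v. R (differential \<A> N q v))"
    using linear_compose[OF linear_differential[OF smooth_N] bounded_linear.linear[OF R]] by (simp add: o_def)
  have E: "R (differential \<A> N q (E i)) = (\<chi> j. graph.\<epsilon> * graph.F j i, 0)" for i
    unfolding E_def d\<mu>_differential[OF u0, symmetric] d\<mu>_V[OF u0] by (simp add: graph.d_\<nu> graph.d_\<theta>)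
  have "R (differential \<A> N q v) = R (differential \<A> N q (\<Sum>i\<in>UNIV. Lq v $ i *\<^sub>R E i))"
    by (subst expand_E[of v, symmetric]) simp
  also have "\<dots> = (\<Sum>i\<in>UNIV. Lq v $ i *\<^sub>R (\<chi> j. graph.\<epsilon> * graph.F j i, 0))"
    by (simp only: linear_sum[OF lin] linear_cmul[OF lin] E)
  also have "\<dots> = (\<Phi> (Lq v), 0)"
    by (simp add: prod_eq_iff fst_sum snd_sum vec_eq_iff \<Phi>_def sum_distrib_left mult_ac)
  finally show ?thesis .
qed

lemma inj_R:
  assumes "R X' = R Y'"
  shows "X' = Y'"
proof -
  have "lorentz (X' - Y') Z = 0" for Z
    using R_iso[of X' Z] R_iso[of Y' Z] assms by (simp add: lorentz_diff_left)
  from this[of "(fst (X' - Y'), - snd (X' - Y'))"]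
  have "fst (X' - Y') \<bullet> fst (X' - Y') + snd (X' - Y') * snd (X' - Y') = 0"
    by (simp only: lorentz_def fst_conv snd_conv mult_minus_right diff_minus_eq_add)
  then have "fst (X' - Y') = 0 \<and> snd (X' - Y') = 0"
    by (metis add_nonneg_eq_0_iff inner_eq_zero_iff inner_ge_zero mult_eq_0_iff zero_le_square)
  then show ?thesis by (simp add: prod_eq_iff)
qed

text \<open>After \<open>R\<close> both differentials are horizontal, and the equation that defines
  the shape operator becomes \<open>Lq w = \<Phi> (Lq v)\<close>. Bijectivity of \<open>Lq\<close>
  provides the unique solution that the definite description demands.\<close>

lemma shape_operator_eq: "Lq (shape_operator \<A> x N q v) = \<Phi> (Lq v)"
proof -
  have "differential \<A> x q w = differential \<A> N q v \<longleftrightarrow> Lq w = \<Phi> (Lq v)" for w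
  proof
    assume "differential \<A> x q w = differential \<A> N q v"
    then have "R (differential \<A> x q w) = R (differential \<A> N q v)" by simp
    then show "Lq w = \<Phi> (Lq v)" by (simp add: R_dx R_dN)
  next
    assume "Lq w = \<Phi> (Lq v)"
    then have "R (differential \<A> x q w) = R (differential \<A> N q v)"
      by (simp add: R_dx R_dN)
    then show "differential \<A> x q w = differential \<A> N q v" by (rule inj_R)
  qed
  then have "shape_operator \<A> x N q v = (THE w. Lq w = \<Phi> (Lq v))"
    by (simp add: shape_operator_def)
  moreover have "\<exists>!w. Lq w = \<Phi> (Lq v)" using Lq(2) unfolding bij_iff by blast
  ultimately show ?thesis using theI'[of "\<lambda>w. Lq w = \<Phi> (Lq v)"] by simp
qed

lemma shape_operator_hypothesis:
  "4 * graph.g2 - 4 * graph.t / graph.n * graph.ag + B * graph.A2 \<ge> 0"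
proof -
  define a where "a = (\<chi> i. graph.a i)"
  have a: "a $ j = graph.a j" for j by (simp add: a_def)
  \<comment> \<open>\<open>v\<close> is the tangential part of the position vector, since
    \<open>a\<close> is the horizontal part of \<open>R (x q)\<close>.\<close>
  define v where "v = inv Lq a"
  have v: "Lq v = a" using Lq(2) by (simp add: v_def bij_is_surj surj_f_inv_f)
  have m: "induced_metric \<A> x q w w' = Lq w \<bullet> Lq w'" for w w'
    unfolding induced_metric_def by (subst R_iso[symmetric]) (simp add: R_dx lorentz_def)
  let ?A = "shape_operator \<A> x N q" and ?H = "mean_curvature \<A> x N q"
  have \<Phi>a: "\<Phi> a $ j = graph.\<epsilon> * graph.g j" for j
    unfolding \<Phi>_def graph.g_def by (simp add: a graph.F_sym[of j])
  have 1: "\<Phi> a \<bullet> a = graph.\<epsilon> * graph.ag"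
    by (simp add: inner_vec_def \<Phi>a graph.ag_def a sum_distrib_left mult_ac)
  have 2: "\<Phi> (\<Phi> a) \<bullet> a = graph.g2"
  proof -
    have "\<Phi> (\<Phi> a) \<bullet> a = (\<Sum>j\<in>UNIV. \<Sum>i\<in>UNIV. graph.\<epsilon> * (graph.F j i * (graph.\<epsilon> * graph.g i)) * graph.a j)"
      by (simp add: inner_vec_def \<Phi>_def[of "\<Phi> a"] \<Phi>a a sum_distrib_left sum_distrib_right)
    also have "\<dots> = (\<Sum>i\<in>UNIV. \<Sum>j\<in>UNIV. (graph.\<epsilon> * graph.\<epsilon>) * (graph.g i * (graph.F j i * graph.a j)))"
      by (subst sum.swap) (simp only: mult_ac)
    also have "\<dots> = graph.g2"
      by (simp add: graph.\<epsilon>_sq graph.g2_def graph.g_def sum_distrib_left)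
    finally show ?thesis .
  qed
  have 3: "a \<bullet> a = graph.A2" by (simp add: inner_vec_def a graph.A2_def power2_eq_square)
  have H: "?H = graph.\<epsilon> * graph.t" using mean_curvature_eq[OF u0] graph.mean_p by simp
  have "Lq (4 *\<^sub>R ?A (?A v) - (4 * ?H / real CARD('n)) *\<^sub>R ?A v + B *\<^sub>R v) =
    4 *\<^sub>R \<Phi> (\<Phi> a) - (4 * ?H / real CARD('n)) *\<^sub>R \<Phi> a + B *\<^sub>R a"
    by (simp only: linear_add[OF Lq(1)] linear_diff[OF Lq(1)] linear_cmul[OF Lq(1)] shape_operator_eq v)
  then have "0 \<le> (4 *\<^sub>R \<Phi> (\<Phi> a) - (4 * ?H / real CARD('n)) *\<^sub>R \<Phi> a + B *\<^sub>R a) \<bullet> a"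
    using psd[of q] unfolding pos_semidef_def m by (metis v)
  also have "\<dots> = 4 * graph.g2 - 4 * ?H / real CARD('n) * (graph.\<epsilon> * graph.ag) + B * graph.A2"
    by (simp add: inner_add_left inner_diff_left 1 2 3)
  also have "4 * ?H / real CARD('n) * (graph.\<epsilon> * graph.ag) = (graph.\<epsilon> * graph.\<epsilon>) * (4 * graph.t / graph.n * graph.ag)"
    by (simp add: H graph.n_def)
  finally show ?thesis by (simp add: graph.\<epsilon>_sq)
qed

lemma vanishing: "B * graph.b\<^sup>2 = 0" "4 * graph.g2 - 4 * graph.t / graph.n * graph.ag + B * graph.A2 = 0"
proof -
  have *: "(sqrt B - \<bar>l\<bar> * ((graph.n - 2) / (2 * sqrt (graph.n * (graph.n - 1)))))\<^sup>2 + (graph.mean u0 - l)\<^sup>2 / graph.n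
    - graph.n * l\<^sup>2 / (4 * (graph.n - 1)) \<ge> 0"
    using pinching[of q] by (simp only: graph.n_def mean_curvature_eq[OF u0])
  show "B * graph.b\<^sup>2 = 0" "4 * graph.g2 - 4 * graph.t / graph.n * graph.ag + B * graph.A2 = 0"
    using graph.pinched_vanishing[OF n2 * shape_operator_hypothesis] by auto
qed

lemma position_normal_zero: "B \<noteq> 0 \<Longrightarrow> lorentz (x q) (N q) = 0"
  using vanishing(1) by (simp add: lorentz_x_N[OF u0] graph.wx_p)

lemma position_zero:
  assumes "B \<noteq> 0" and "\<And>p. lorentz (x p) (N p) = 0"
  shows "x q = 0"
proof -
  \<comment> \<open>\<langle>x, N\<rangle> vanishes on the whole hypersurface, hence so does its
    gradient \<open>\<epsilon> g\<close>.\<close>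
  have "graph.d k graph.wx u0 = graph.d k (\<lambda>u. 0) u0" for k
    by (rule graph.d_cong[OF _ u0]) (simp add: lorentz_x_N[symmetric] assms(2))
  moreover have "graph.\<epsilon> \<noteq> 0" using graph.\<epsilon>_sq by auto
  ultimately have "graph.g k = 0" for k
    by (simp add: graph.d_wx graph.d_const)
  \<comment> \<open>With \<open>g = 0\<close> the second relation of \<open>vanishing\<close> reads
    \<open>B * A2 = 0\<close>.\<close>
  then have "graph.A2 = 0"
    using vanishing(2) assms(1) by (simp add: graph.g2_def graph.ag_def)
  then have "graph.a k = 0" for k
    by (simp add: graph.A2_def sum_nonneg_eq_0_iff)
  moreover have "graph.b = 0" using vanishing(1) assms(1) by simp
  ultimately have "R (x q) = R 0"
    by (simp add: graph.a_def graph.b_def y_def z_def X_def prod_eq_iff vec_eq_iff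
      linear_0[OF bounded_linear.linear[OF R]])
  then show ?thesis by (rule inj_R)
qed

lemma umbilic_chart:
  assumes "B = 0"
  shows "differential \<A> N q v = (mean_curvature \<A> x N q / real CARD('n)) *\<^sub>R differential \<A> x q v"
proof -
  let ?t = "graph.t / real CARD('n)"
  have "(\<Sum>i\<in>UNIV. \<Sum>j\<in>UNIV. (graph.F i j - (if i = j then ?t else 0))\<^sup>2) = 0"
    using sum_square_traceless[of graph.F] graph.pinched[OF u0] assms
    unfolding graph.t_def[symmetric]
    by (simp add: graph.S_def graph.sqn_p graph.mean_p power2_eq_square mult_ac graph.\<epsilon>_cancel)
  then have "graph.F i j - (if i = j then ?t else 0) = 0" for i j
    by (simp add: sum_nonneg_eq_0_iff sum_nonneg)
  then have F: "graph.F i j = (if i = j then ?t else 0)" for i j by simp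
  have "\<Phi> w = (graph.\<epsilon> * ?t) *\<^sub>R w" for w
    by (simp add: \<Phi>_def F vec_eq_iff if_distribR if_distrib[of "\<lambda>x. x * _"] cong: if_cong)
  then have "R (differential \<A> N q v) = R ((mean_curvature \<A> x N q / real CARD('n)) *\<^sub>R differential \<A> x q v)"
    by (simp add: R_dN linear_cmul[OF bounded_linear.linear[OF R]] R_dx mean_curvature_eq[OF u0] graph.mean_p)
  then show ?thesis by (rule inj_R)
qed

end

context pinched_spacelike
begin

lemma pinched_chart_exists:
  obtains c u0 R \<epsilon> where "pinched_chart \<A> x N l B c R u0 \<epsilon>" "snd c u0 = p"
proof -
  obtain R :: "'n lorentz_space \<Rightarrow> 'n lorentz_space" and \<epsilon> where R: "bounded_linear R" "\<And>X Y. lorentz (R X) (R Y) = lorentz X Y"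
    "R (N p) = (0, \<epsilon>)" "\<epsilon> = 1 \<or> \<epsilon> = -1"
    using adapted_reflection[of p] by metis
  let ?c = "param_at \<A> p"
  have c: "?c \<in> \<A>" "p \<in> param_range ?c" using param_at[OF atlas] by auto
  have "isometry_chart_axioms \<A> ?c R"
    unfolding isometry_chart_axioms_def using R c by simp
  moreover have "adapted_chart_axioms N ?c R (coords ?c p) \<epsilon>"
    unfolding adapted_chart_axioms_def using R c atlasD(7,8)[OF atlas c] by simp
  ultimately have "pinched_chart \<A> x N l B ?c R (coords ?c p) \<epsilon>"
    using pinched_chart.intro[OF pinched_spacelike_axioms
        adapted_chart.intro[OF isometry_chart.intro[OF spacelike_axioms]]] by blast
  then show thesis using that atlasD(8)[OF atlas c] by blast
qed

lemma pinching_zero: "B = 0"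
proof (rule ccontr)
  assume B: "B \<noteq> 0"
  have w: "lorentz (x p) (N p) = 0" for p
  proof -
    obtain c u0 R \<epsilon> where "pinched_chart \<A> x N l B c R u0 \<epsilon>" "snd c u0 = p" using pinched_chart_exists .
    then show ?thesis using pinched_chart.position_normal_zero B by metis
  qed
  have "x p = 0" for p
  proof -
    obtain c u0 R \<epsilon> where "pinched_chart \<A> x N l B c R u0 \<epsilon>" "snd c u0 = p" using pinched_chart_exists .
    then show ?thesis using pinched_chart.position_zero B w by metis
  qed
  then have "x = (\<lambda>p. 0)" by blast
  then have "differential \<A> x p v = 0" for p v
    by (simp add: differential_def Let_def o_def)
  moreover have "axis (undefined :: 'n) (1::real) \<noteq> 0" by (simp add: axis_eq_0_iff)
  ultimately show False using metric_pos by (metis lorentz_0_left less_irrefl)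
qed

lemma umbilic: "differential \<A> N p v = (mean_curvature \<A> x N p / real CARD('n)) *\<^sub>R differential \<A> x p v"
proof -
  obtain c u0 R \<epsilon> where "pinched_chart \<A> x N l B c R u0 \<epsilon>" "snd c u0 = p" using pinched_chart_exists .
  then show ?thesis using pinched_chart.umbilic_chart pinching_zero by metis
qed

end

section \<open>Classification of the umbilic hypersurfaces\<close>

lemma chart_image_open:
  assumes \<A>: "smooth_atlas \<A>" "c \<in> \<A>" and U: "open U" "U \<subseteq> fst c"
  shows "open (snd c ` U)"
proof -
  have "snd c ` U = param_range c \<inter> coords c -` U"
    using U(2) atlasD(6,8)[OF \<A>] by (auto simp: image_iff)
  then show ?thesis
    using continuous_open_preimage[OF atlasD(5,2)[OF \<A>] U(1)] by simp
qed

lemma smooth_map_continuous: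
  fixes f :: "'m::topological_space \<Rightarrow> 'b::euclidean_space"
  assumes \<A>: "smooth_atlas \<A>" and f: "smooth_map \<A> f"
  shows "continuous_on UNIV f"
proof -
  have "continuous_on (param_range c) f" if c: "c \<in> \<A>" for c
  proof -
    have "continuous_on (fst c) (f \<circ> snd c)"
      using f c smooth_on_continuous[of "fst c" "f \<circ> snd c"] by (simp only: smooth_map_def)
    moreover have "coords c ` param_range c = fst c"
      using atlasD(3)[OF \<A> c] by (simp add: homeomorphism_def)
    ultimately have "continuous_on (param_range c) ((f \<circ> snd c) \<circ> coords c)"
      using continuous_on_compose[OF atlasD(5)[OF \<A> c]] by metis
    then show ?thesis
      by (rule continuous_on_eq) (simp add: atlasD(8)[OF \<A> c])
  qed
  then have "continuous_on (\<Union>c\<in>\<A>. param_range c) f"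
    by (intro continuous_on_open_UN) (use atlasD(2)[OF \<A>] in auto)
  then show ?thesis using \<A> unfolding smooth_atlas_def by metis
qed

text \<open>A vanishing derivative in charts makes \<open>f\<close> locally constant, so that each
  level set and its complement are open.\<close>

lemma constant_on_manifold:
  fixes f :: "'m::topological_space \<Rightarrow> 'b::real_normed_vector"
  assumes \<A>: "smooth_atlas \<A>" and conn: "connected (UNIV :: 'm set)"
    and der: "\<And>c u. c \<in> \<A> \<Longrightarrow> u \<in> fst c \<Longrightarrow> ((f \<circ> snd c) has_derivative (\<lambda>h. 0)) (at u)"
  shows "f p = f q"
proof -
  have loc: "\<exists>U. open U \<and> p \<in> U \<and> (\<forall>q\<in>U. f q = f p)" for p
  proof -
    obtain c where c: "c \<in> \<A>" "p \<in> param_range c" using param_at[OF \<A>] by blast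
    have u: "coords c p \<in> fst c" "snd c (coords c p) = p" using atlasD(7,8)[OF \<A> c(1)] c(2) by auto
    obtain r where r: "r > 0" "ball (coords c p) r \<subseteq> fst c"
      using atlasD(1)[OF \<A> c(1)] u(1) openE by blast
    have "\<exists>k. \<forall>w\<in>ball (coords c p) r. (f \<circ> snd c) w = k"
    proof (rule has_derivative_zero_constant[OF convex_ball])
      fix w assume "w \<in> ball (coords c p) r"
      then show "((f \<circ> snd c) has_derivative (\<lambda>h. 0)) (at w within ball (coords c p) r)"
        using der[OF c(1)] r(2) has_derivative_at_withinI by blast
    qed
    then obtain k where k: "\<And>w. w \<in> ball (coords c p) r \<Longrightarrow> f (snd c w) = k" by auto
    have "f p = k" using k[of "coords c p"] u r(1) by simp
    then have "\<forall>q\<in>snd c ` ball (coords c p) r. f q = f p" using k by auto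
    moreover have "p \<in> snd c ` ball (coords c p) r" using u r(1) by (metis centre_in_ball imageI)
    ultimately show ?thesis using chart_image_open[OF \<A> c(1) open_ball r(2)] by blast
  qed
  have op: "open {p. P (f p)}" for P :: "'b \<Rightarrow> bool"
  proof (subst open_subopen, intro ballI)
    fix p assume p: "p \<in> {p. P (f p)}"
    obtain U where U: "open U" "p \<in> U" "\<forall>q\<in>U. f q = f p" using loc by blast
    have "U \<subseteq> {p. P (f p)}"
    proof
      fix w assume "w \<in> U"
      then have "f w = f p" using U(3) by blast
      then show "w \<in> {p. P (f p)}" using p by (simp only: mem_Collect_eq)
    qed
    then show "\<exists>U. open U \<and> p \<in> U \<and> U \<subseteq> {p. P (f p)}" using U(1,2) by blast
  qed
  have "open {p. f p = f q}" "open {p. f p \<noteq> f q}"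
    using op[of "\<lambda>y. y = f q"] op[of "\<lambda>y. y \<noteq> f q"] by auto
  moreover have "{p. f p = f q} \<union> {p. f p \<noteq> f q} = UNIV" "{p. f p = f q} \<inter> {p. f p \<noteq> f q} = {}" by auto
  ultimately have "{p. f p = f q} = {} \<or> {p. f p \<noteq> f q} = {}"
    using connectedD[OF conn, of "{p. f p = f q}" "{p. f p \<noteq> f q}"] by auto
  then show ?thesis by blast
qed

context spacelike
begin

lemma chart_derivative:
  assumes "smooth_map \<A> f" "c \<in> \<A>" "u \<in> fst c"
  shows "((f \<circ> snd c) has_derivative (\<lambda>v. differential \<A> f (snd c u) (transition \<A> c u v))) (at u)"
proof -
  have "smooth_on (fst c) (f \<circ> snd c)" using assms by (simp add: smooth_map_def)
  from smooth_on_has_derivative[OF this atlasD(1)[OF atlas assms(2)] assms(3)]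
  have "((f \<circ> snd c) has_derivative frechet_derivative (f \<circ> snd c) (at u)) (at u)" .
  moreover have "frechet_derivative (f \<circ> snd c) (at u) = (\<lambda>v. differential \<A> f (snd c u) (transition \<A> c u v))"
    using differential_chart(1)[OF atlas assms(2,3,1)] by blast
  ultimately show ?thesis by simp
qed

lemma transition_surj: "c \<in> \<A> \<Longrightarrow> u \<in> fst c \<Longrightarrow> \<exists>w. transition \<A> c u w = v"
  using surjD[OF bij_is_surj[OF differential_chart(2)[OF atlas _ _ smooth_x]], of c u v] by metis

text \<open>In horizontal position, orthogonality to the normal removes the last component. The
  tangent vectors project onto all of the horizontal space, so one of them detects the rest.\<close>

lemma orthogonal_complement_trivial:
  assumes "lorentz X (N p) = 0" "\<And>v. lorentz X (differential \<A> x p v) = 0"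
  shows "X = 0"
proof -
  obtain R :: "'n lorentz_space \<Rightarrow> 'n lorentz_space" and \<epsilon> where R: "bounded_linear R" "\<And>X. R (R X) = X"
    "\<And>X Y. lorentz (R X) (R Y) = lorentz X Y" "R (N p) = (0, \<epsilon>)" "\<epsilon> = 1 \<or> \<epsilon> = -1"
    using adapted_reflection[of p] by metis
  have s: "snd (R X) = 0"
    by (rule tangent_snd[OF R(4,5,3)]) (simp add: assms(1) lorentz_sym)
  obtain v where v: "fst (R (differential \<A> x p v)) = fst (R X)"
    using surjD[OF bij_is_surj[OF horizontal_projection(2)[OF R(1,3), of p]], of "fst (R X)"] by auto
  have "0 = lorentz (R X) (R (differential \<A> x p v))" using assms(2)[of v] by (simp add: R(3))
  also have "\<dots> = fst (R X) \<bullet> fst (R X)" by (simp add: lorentz_def s v)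
  finally have "R X = 0" using s by (simp add: prod_eq_iff)
  then show ?thesis using R(2)[of X] linear_0[OF bounded_linear.linear[OF R(1)]] by simp
qed

end

lemma lorentz_has_derivative:
  assumes "(f has_derivative f') (at u)" "(g has_derivative g') (at u)"
  shows "((\<lambda>u. lorentz (f u) (g u)) has_derivative (\<lambda>v. lorentz (f u) (g' v) + lorentz (f' v) (g u))) (at u)"
  using bounded_bilinear.FDERIV[OF bounded_bilinear_lorentz assms] .

section \<open>Constancy of the principal curvature: hyperplanes and hyperboloids\<close>

context pinched_spacelike
begin

definition \<kappa> where "\<kappa> p = mean_curvature \<A> x N p / real CARD('n)"

lemma dN_eq: "differential \<A> N p v = \<kappa> p *\<^sub>R differential \<A> x p v"
  unfolding \<kappa>_def by (rule umbilic)

lemma mean_curvature_lam: "mean_curvature \<A> x N p = l + lorentz (x p) (x p) * lorentz (x p) (N p)"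
  using lam unfolding lambda_hypersurface_def by (metis add.commute diff_eq_eq)

lemma smooth_\<kappa>: "c \<in> \<A> \<Longrightarrow> smooth_on (fst c) (\<kappa> \<circ> snd c)"
proof -
  assume c: "c \<in> \<A>"
  note o = atlasD(1)[OF atlas c]
  have "smooth_on (fst c) (\<lambda>u. x (snd c u))" "smooth_on (fst c) (\<lambda>u. N (snd c u))"
    using smooth_x smooth_N c by (simp_all add: smooth_map_def o_def)
  then show ?thesis
    unfolding \<kappa>_def[abs_def] mean_curvature_lam o_def divide_inverse
    by (intro smooth_on_mult[OF o] smooth_on_add[OF o] smooth_on_lorentz[OF o] smooth_on_const)
qed

text \<open>The classical argument: symmetry of the second derivatives of \<open>N\<close> and of \<open>x\<close> gives
  \<open>d\<kappa>(w) dx(v) = d\<kappa>(v) dx(w)\<close>.\<close>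

lemma \<kappa>_derivative_zero:
  assumes c: "c \<in> \<A>" and u: "u \<in> fst c"
  shows "((\<kappa> \<circ> snd c) has_derivative (\<lambda>h. 0)) (at u)"
proof -
  note o = atlasD(1)[OF atlas c]
  let ?k = "\<kappa> \<circ> snd c" and ?x = "x \<circ> snd c" and ?N = "N \<circ> snd c"
  have sx: "smooth_on (fst c) ?x" and sN: "smooth_on (fst c) ?N"
    using smooth_x smooth_N c by (simp_all add: smooth_map_def)
  have dk: "(?k has_derivative frechet_derivative ?k (at u)) (at u)"
    by (rule smooth_on_has_derivative[OF smooth_\<kappa>[OF c] o u])
  have N: "frechet_derivative ?N (at w) v = ?k w *\<^sub>R frechet_derivative ?x (at w) v" if "w \<in> fst c" for w v
    using differential_chart(1)[OF atlas c that smooth_N] differential_chart(1)[OF atlas c that smooth_x]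
    by (simp add: dN_eq)
  have NN: "frechet_derivative (\<lambda>w. frechet_derivative ?N (at w) v) (at u) v' =
     ?k u *\<^sub>R frechet_derivative (\<lambda>w. frechet_derivative ?x (at w) v) (at u) v'
       + frechet_derivative ?k (at u) v' *\<^sub>R frechet_derivative ?x (at u) v" for v v'
  proof -
    have e: "frechet_derivative (\<lambda>w. frechet_derivative ?N (at w) v) (at u) =
      frechet_derivative (\<lambda>w. ?k w *\<^sub>R frechet_derivative ?x (at w) v) (at u)"
      by (rule frechet_derivative_cong_open[OF o u]) (rule N)
    have "((\<lambda>w. ?k w *\<^sub>R frechet_derivative ?x (at w) v) has_derivative
      (\<lambda>v'. ?k u *\<^sub>R frechet_derivative (\<lambda>w. frechet_derivative ?x (at w) v) (at u) v'
       + frechet_derivative ?k (at u) v' *\<^sub>R frechet_derivative ?x (at u) v)) (at u)"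
      by (rule has_derivative_scaleR[OF dk smooth_on_has_derivative[OF smooth_on_directional[OF sx] o u]])
    from fun_cong[OF frechet_derivative_at[OF this], of v'] show ?thesis unfolding e by simp
  qed
  have sym: "frechet_derivative ?k (at u) v' *\<^sub>R frechet_derivative ?x (at u) v =
     frechet_derivative ?k (at u) v *\<^sub>R frechet_derivative ?x (at u) v'" for v v'
    using second_derivative_symmetric[OF o sN u, of v v'] second_derivative_symmetric[OF o sx u, of v v']
    unfolding NN by simp
  have lx: "linear (frechet_derivative ?x (at u))"
    using smooth_on_has_derivative[OF sx o u] has_derivative_linear by blast
  have inj: "v = 0" if "frechet_derivative ?x (at u) v = 0" for v
  proof -
    have "differential \<A> x (snd c u) (transition \<A> c u v) = 0"
      using that differential_chart(1)[OF atlas c u smooth_x] by simp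
    then have "transition \<A> c u v = 0" using metric_pos by (metis lorentz_0_left less_irrefl)
    then show "v = 0"
      using differential_chart(2,3)[OF atlas c u smooth_x] by (metis bij_is_inj injD linear_0)
  qed
  have z: "frechet_derivative ?k (at u) (axis i 1) = 0" for i
  proof -
    \<comment> \<open>Here the dimension is at least 2: d\<kappa> in direction \<open>i\<close> is
      tested against a second, independent direction.\<close>
    obtain j where j: "j \<noteq> i"
    proof -
      have "\<exists>j. j \<noteq> i"
      proof (rule ccontr)
        assume "\<not> (\<exists>j. j \<noteq> i)"
        then have "(UNIV :: 'n set) = {i}" by blast
        then have "CARD('n) = 1" by (metis card_1_singleton_iff One_nat_def)
        then show False using n2 by simp
      qed
      then show ?thesis using that by blast
    qed
    let ?d = "\<lambda>i. frechet_derivative ?k (at u) (axis i 1)"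
    have "frechet_derivative ?x (at u) (?d i *\<^sub>R axis j 1 - ?d j *\<^sub>R axis i 1) = 0"
      using sym[of "axis i 1" "axis j 1"] by (simp add: linear_diff[OF lx] linear_cmul[OF lx])
    then have "?d i *\<^sub>R axis j 1 - ?d j *\<^sub>R axis i (1::real) = 0" by (rule inj)
    then have "(?d i *\<^sub>R axis j 1 - ?d j *\<^sub>R axis i (1::real)) $ j = 0" by simp
    then show ?thesis using j by (simp add: axis_def)
  qed
  have lk: "linear (frechet_derivative ?k (at u))" using dk has_derivative_linear by blast
  have "frechet_derivative ?k (at u) v = 0" for v
  proof -
    have "v = (\<Sum>i\<in>UNIV. v $ i *\<^sub>R axis i 1)"
      by (simp add: vec_eq_iff axis_def if_distrib cong: if_cong)
    then have "frechet_derivative ?k (at u) v = (\<Sum>i\<in>UNIV. v $ i *\<^sub>R frechet_derivative ?k (at u) (axis i 1))"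
      using linear_sum[OF lk, of "\<lambda>i. v $ i *\<^sub>R axis i 1" UNIV] by (simp add: linear_cmul[OF lk])
    then show ?thesis by (simp add: z)
  qed
  then have "frechet_derivative ?k (at u) = (\<lambda>h. 0)" by blast
  then show ?thesis using dk by simp
qed

lemma \<kappa>_constant: "\<kappa> p = \<kappa> q"
  by (rule constant_on_manifold[OF atlas conn \<kappa>_derivative_zero])

lemma flat_case:
  assumes "\<kappa> p0 = 0"
  shows "N p = N p0" "lorentz (x p) (N p0) = lorentz (x p0) (N p0)"
proof -
  have k: "\<kappa> p = 0" for p using \<kappa>_constant[of p p0] assms by simp
  have dN: "((N \<circ> snd c) has_derivative (\<lambda>h. 0)) (at u)" if "c \<in> \<A>" "u \<in> fst c" for c u
    using chart_derivative[OF smooth_N that] by (simp add: dN_eq k)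
  show N: "N p = N p0" for p by (rule constant_on_manifold[OF atlas conn dN])
  show "lorentz (x p) (N p0) = lorentz (x p0) (N p0)"
  proof (rule constant_on_manifold[OF atlas conn])
    fix c u assume cu: "c \<in> \<A>" "u \<in> fst c"
    have "lorentz (differential \<A> x q v) (N p0) = 0" for q v
      using N_orth[of q v] unfolding N[of q] by (subst lorentz_sym)
    then show "((\<lambda>p. lorentz (x p) (N p0)) \<circ> snd c has_derivative (\<lambda>h. 0)) (at u)"
      using lorentz_has_derivative[OF chart_derivative[OF smooth_x cu] has_derivative_const[of "N p0"]]
      by (simp add: o_def lorentz_def)
  qed
qed

text \<open>\<open>x - \<rho> N\<close> has derivative zero, and its value \<open>x0\<close> is the
  centre. The \<lambda>-equation is quadratic in \<tau> = \<langle>x0, N\<rangle>, which makes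
  \<tau> constant; then \<open>x0\<close> is orthogonal to every tangent space, so it is a multiple
  of \<open>N\<close> everywhere. As \<open>N\<close> is not constant,
  \<open>x0 = 0\<close>.\<close>

lemma spherical_case:
  assumes k: "\<kappa> p0 \<noteq> 0"
  obtains \<rho> where "\<rho> \<noteq> 0" "\<And>p. x p = \<rho> *\<^sub>R N p" "real CARD('n) \<le> 2 * \<rho> ^ 4"
proof -
  define \<rho> where "\<rho> = 1 / \<kappa> p0"
  have \<rho>: "\<rho> \<noteq> 0" "\<kappa> p = 1 / \<rho>" for p using k \<kappa>_constant[of p p0] by (simp_all add: \<rho>_def)
  have dN: "differential \<A> N p v = (1 / \<rho>) *\<^sub>R differential \<A> x p v" for p v by (simp add: dN_eq \<rho>(2))
  define x0 where "x0 = x p0 - \<rho> *\<^sub>R N p0"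
  have x0: "x p = x0 + \<rho> *\<^sub>R N p" for p
  proof -
    have "x p - \<rho> *\<^sub>R N p = x p0 - \<rho> *\<^sub>R N p0"
    proof (rule constant_on_manifold[OF atlas conn])
      fix c u assume cu: "c \<in> \<A>" "u \<in> fst c"
      have "((\<lambda>p. x p - \<rho> *\<^sub>R N p) \<circ> snd c has_derivative
        (\<lambda>v. differential \<A> x (snd c u) (transition \<A> c u v) - \<rho> *\<^sub>R differential \<A> N (snd c u) (transition \<A> c u v))) (at u)"
        using has_derivative_diff[OF chart_derivative[OF smooth_x cu]
            has_derivative_scaleR_right[OF chart_derivative[OF smooth_N cu], of \<rho>]]
        by (simp add: o_def)
      then show "((\<lambda>p. x p - \<rho> *\<^sub>R N p) \<circ> snd c has_derivative (\<lambda>h. 0)) (at u)"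
        using \<rho>(1) by (simp add: dN)
    qed
    then show ?thesis by (simp add: x0_def algebra_simps)
  qed
  define n where "n = real CARD('n)"
  have n: "n \<ge> 2" using n2 by (simp add: n_def)
  have H: "mean_curvature \<A> x N p = n / \<rho>" for p
    using \<rho>(2)[of p] n by (simp add: \<kappa>_def n_def field_simps)
  define \<tau> where "\<tau> p = lorentz x0 (N p)" for p
  define a where "a = lorentz x0 x0"
  have xx: "lorentz (x p) (x p) = a + 2 * \<rho> * \<tau> p - \<rho>\<^sup>2" and xN: "lorentz (x p) (N p) = \<tau> p - \<rho>" for p
    unfolding x0[of p]
    by (simp_all add: lorentz_add_left lorentz_add_right lorentz_scaleR_left lorentz_scaleR_right N_unit
        a_def \<tau>_def lorentz_sym[of "N p" x0] power2_eq_square right_diff_distrib)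
  have eq: "n / \<rho> = l + (a + 2 * \<rho> * \<tau> p - \<rho>\<^sup>2) * (\<tau> p - \<rho>)" for p
    using mean_curvature_lam[of p] by (simp add: H xx xN)
  text \<open>\<open>\<tau>\<close> is a continuous function whose values are roots of a fixed quadratic polynomial.\<close>
  have \<tau>_const: "\<tau> p = \<tau> p0" for p
  proof -
    define P where "P = [:l - n / \<rho> - (a - \<rho>\<^sup>2) * \<rho>, a - \<rho>\<^sup>2 - 2 * \<rho> * \<rho>, 2 * \<rho>:]"
    have "poly P (\<tau> p) = 0" for p
      using eq[of p] by (simp add: P_def algebra_simps)
    then have "range \<tau> \<subseteq> {t. poly P t = 0}" by blast
    moreover have "P \<noteq> 0" using \<rho>(1) by (simp add: P_def)
    ultimately have fin: "finite (range \<tau>)" using poly_roots_finite finite_subset by blast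
    have "continuous_on UNIV \<tau>"
      unfolding \<tau>_def[abs_def]
      by (rule bounded_linear.continuous_on[OF bounded_bilinear.bounded_linear_right[OF bounded_bilinear_lorentz]
            smooth_map_continuous[OF atlas smooth_N]])
    then have "connected (range \<tau>)" using connected_continuous_image conn by blast
    then obtain t where "range \<tau> = {t}" using fin connected_finite_iff_sing by blast
    then show ?thesis by (metis rangeI singletonD)
  qed
  have "x0 = 0"
  proof -
    have orth: "lorentz x0 (differential \<A> x p v) = 0" for p v
    proof -
      define c where "c = param_at \<A> p"
      have c: "c \<in> \<A>" "p \<in> param_range c" using param_at[OF atlas] by (simp_all add: c_def)
      define u where "u = coords c p"
      have u: "u \<in> fst c" "snd c u = p" using atlasD(7,8)[OF atlas c(1) c(2)] by (simp_all add: u_def)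
      obtain w where w: "transition \<A> c u w = v" using transition_surj[OF c(1) u(1)] by blast
      have "((\<lambda>p. lorentz x0 (N p)) \<circ> snd c has_derivative
         (\<lambda>w. lorentz x0 (differential \<A> N p (transition \<A> c u w)))) (at u)"
        using bounded_linear.has_derivative[OF bounded_bilinear.bounded_linear_right[OF bounded_bilinear_lorentz]
            chart_derivative[OF smooth_N c(1) u(1)], of x0] by (simp add: o_def u(2))
      moreover have "(\<lambda>p. lorentz x0 (N p)) \<circ> snd c = (\<lambda>u. \<tau> p0)" using \<tau>_const by (auto simp: \<tau>_def)
      ultimately have "(\<lambda>w. lorentz x0 (differential \<A> N p (transition \<A> c u w))) = (\<lambda>w. 0)"
        using has_derivative_unique[OF _ has_derivative_const] by metis
      then have "lorentz x0 (differential \<A> N p v) = 0" using w by metis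
      then show ?thesis using \<rho>(1) by (simp add: dN lorentz_scaleR_right)
    qed
    have x0N: "x0 = - \<tau> p0 *\<^sub>R N p" for p
    proof -
      have "x0 + \<tau> p0 *\<^sub>R N p = 0"
      proof (rule orthogonal_complement_trivial)
        show "lorentz (x0 + \<tau> p0 *\<^sub>R N p) (N p) = 0"
          using \<tau>_const[of p] by (simp add: lorentz_add_left lorentz_scaleR_left N_unit \<tau>_def)
        show "lorentz (x0 + \<tau> p0 *\<^sub>R N p) (differential \<A> x p v) = 0" for v
          by (simp add: lorentz_add_left lorentz_scaleR_left orth N_orth)
      qed
      then show ?thesis by (simp add: eq_neg_iff_add_eq_0)
    qed
    \<comment> \<open>Otherwise \<open>x0N\<close> would make \<open>N\<close> constant, against dN
      = dx / \<rho> with dx nonzero.\<close>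
    have "\<tau> p0 = 0"
    proof (rule ccontr)
      assume t: "\<tau> p0 \<noteq> 0"
      have "N p = (- 1 / \<tau> p0) *\<^sub>R x0" for p using x0N[of p] t by simp
      then have "N = (\<lambda>p. (- 1 / \<tau> p0) *\<^sub>R x0)" by blast
      then have "differential \<A> N p v = 0" for p v
        by (simp add: differential_def Let_def o_def)
      then have "differential \<A> x p v = 0" for p v using dN[of p v] \<rho>(1) by simp
      moreover have "axis (undefined :: 'n) (1::real) \<noteq> 0" by (simp add: axis_eq_0_iff)
      ultimately show False using metric_pos by (metis lorentz_0_left less_irrefl)
    qed
    then show ?thesis using x0N[of p0] by simp
  qed
  then have x: "x p = \<rho> *\<^sub>R N p" for p using x0 by simp
  have "\<tau> p0 = 0" "a = 0" by (simp_all add: \<tau>_def a_def \<open>x0 = 0\<close> lorentz_0_left)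
  then have l: "l = n / \<rho> - \<rho> ^ 3"
    using eq[of p0] by (simp add: power2_eq_square power3_eq_cube)
  \<comment> \<open>For \<open>B = 0\<close> the pinching inequality, multiplied by
    \<open>4 n (n - 1)\<close>, has a common factor \<open>4 (n - 1)\<close>, because
    \<open>n\<^sup>2 - (n - 2)\<^sup>2 = 4 (n - 1)\<close>.\<close>
  have "l\<^sup>2 \<le> (n / \<rho> - l)\<^sup>2"
  proof -
    define c where "c = (n - 2) / (2 * sqrt (n * (n - 1)))"
    have "c\<^sup>2 = (n - 2)\<^sup>2 / (4 * (n * (n - 1)))" using n by (simp add: c_def power_divide power_mult_distrib)
    then have c2: "4 * (n * (n - 1)) * c\<^sup>2 = (n - 2)\<^sup>2" using n by simp
    have "0 \<le> (\<bar>l\<bar> * c)\<^sup>2 + (n / \<rho> - l)\<^sup>2 / n - n * l\<^sup>2 / (4 * (n - 1))"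
      using pinching[of p0] by (simp add: pinching_zero H n_def[symmetric] c_def)
    then have "0 \<le> (4 * (n * (n - 1))) * ((\<bar>l\<bar> * c)\<^sup>2 + (n / \<rho> - l)\<^sup>2 / n - n * l\<^sup>2 / (4 * (n - 1)))"
      using n by (intro mult_nonneg_nonneg) auto
    also have "\<dots> = l\<^sup>2 * (4 * (n * (n - 1)) * c\<^sup>2) + (4 * (n - 1)) * (n / \<rho> - l)\<^sup>2 - n * n * l\<^sup>2"
    proof -
      define m where "m = 4 * (n - 1)"
      have m: "4 * (n * (n - 1)) = n * m" "m \<noteq> 0" using n by (simp_all add: m_def)
      have "(n * m) * ((n / \<rho> - l)\<^sup>2 / n) = m * (n / \<rho> - l)\<^sup>2"
        "(n * m) * (n * l\<^sup>2 / m) = n * n * l\<^sup>2" using n m(2) by simp_all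
      then have "(4 * (n * (n - 1))) * ((n / \<rho> - l)\<^sup>2 / n) = (4 * (n - 1)) * (n / \<rho> - l)\<^sup>2"
        "(4 * (n * (n - 1))) * (n * l\<^sup>2 / (4 * (n - 1))) = n * n * l\<^sup>2"
        unfolding m(1) by (simp_all only: m_def)
      then show ?thesis by (simp only: distrib_left right_diff_distrib power_mult_distrib power2_abs) (simp add: mult_ac)
    qed
    also have "\<dots> = (4 * (n - 1)) * ((n / \<rho> - l)\<^sup>2 - l\<^sup>2)"
      unfolding c2 by (simp add: power2_eq_square algebra_simps)
    finally show ?thesis using n by (simp add: zero_le_mult_iff)
  qed
  \<comment> \<open>Since H - l is the cube of \<rho>, multiplication by
    \<open>\<rho>\<^sup>2\<close> leads to
    \<open>(n - \<rho> ^ 4)\<^sup>2 \<le> (\<rho> ^ 4)\<^sup>2\<close>, which is the bound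
    \<open>n \<le> 2 * \<rho> ^ 4\<close> on the radius.\<close>
  then have "(n / \<rho> - \<rho> ^ 3)\<^sup>2 \<le> (\<rho> ^ 3)\<^sup>2" by (simp add: l)
  then have "\<rho>\<^sup>2 * (n / \<rho> - \<rho> ^ 3)\<^sup>2 \<le> \<rho>\<^sup>2 * (\<rho> ^ 3)\<^sup>2" by (rule mult_left_mono) simp
  also have "\<rho>\<^sup>2 * (n / \<rho> - \<rho> ^ 3)\<^sup>2 = (n - \<rho> ^ 4)\<^sup>2"
    using \<rho>(1) by (simp add: power_mult_distrib[symmetric] right_diff_distrib power4_eq_xxxx power3_eq_cube mult_ac)
  also have "\<rho>\<^sup>2 * (\<rho> ^ 3)\<^sup>2 = (\<rho> ^ 4)\<^sup>2" by (simp add: power4_eq_xxxx power3_eq_cube power2_eq_square)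
  finally have "n * n \<le> n * (2 * \<rho> ^ 4)" by (simp add: power2_eq_square algebra_simps)
  then have "n \<le> 2 * \<rho> ^ 4" using n by simp
  then show thesis using that[OF \<rho>(1) x] by (simp add: n_def)
qed

end

section \<open>Lengths of curves\<close>

lemma has_vector_derivative_linear_chain:
  assumes "(g has_vector_derivative w) (at s)" "(f has_derivative f') (at (g s))"
  shows "((f \<circ> g) has_vector_derivative f' w) (at s)"
proof -
  have "((f \<circ> g) has_derivative (f' \<circ> (\<lambda>h. h *\<^sub>R w))) (at s)"
    using diff_chain_at assms unfolding has_vector_derivative_def by blast
  moreover have "f' \<circ> (\<lambda>h. h *\<^sub>R w) = (\<lambda>h. h *\<^sub>R f' w)"
    using has_derivative_linear[OF assms(2)] by (simp add: fun_eq_iff linear_cmul)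
  ultimately show ?thesis by (simp add: has_vector_derivative_def)
qed

text \<open>The condition of \<open>C1_curve_on\<close> at a single parameter. Reparametrization and
  pasting can then be checked pointwise.\<close>

definition regular_at :: "('n::finite, 'm) param set \<Rightarrow> (real \<Rightarrow> 'm) \<Rightarrow> real \<Rightarrow> bool" where
  "regular_at \<A> \<gamma> t \<longleftrightarrow> (\<exists>c\<in>\<A>. \<exists>J. open J \<and> t \<in> J \<and> \<gamma> ` J \<subseteq> param_range c \<and>
        (coords c \<circ> \<gamma>) C1_differentiable_on J)"

lemma C1_curve_on_regular: "C1_curve_on \<A> I \<gamma> \<longleftrightarrow> (\<forall>t\<in>I. regular_at \<A> \<gamma> t)"
  by (simp add: C1_curve_on_def regular_at_def)

lemma C1_differentiable_on_cong:
  assumes "f C1_differentiable_on J" "open J" "\<And>t. t \<in> J \<Longrightarrow> f t = g t"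
  shows "g C1_differentiable_on J"
  using assms(1) unfolding C1_differentiable_on_def
  by (metis assms(2,3) has_vector_derivative_transform_within_open)

lemma C1_differentiable_on_mono: "f C1_differentiable_on J \<Longrightarrow> J' \<subseteq> J \<Longrightarrow> f C1_differentiable_on J'"
  unfolding C1_differentiable_on_def by (meson continuous_on_subset subsetD)

lemma regular_at_cong:
  assumes "regular_at \<A> \<eta> t" "open J" "t \<in> J" "\<And>s. s \<in> J \<Longrightarrow> \<gamma> s = \<eta> s"
  shows "regular_at \<A> \<gamma> t"
proof -
  obtain c J' where c: "c \<in> \<A>" "open J'" "t \<in> J'" "\<eta> ` J' \<subseteq> param_range c" "(coords c \<circ> \<eta>) C1_differentiable_on J'"
    using assms(1) unfolding regular_at_def by blast
  have "(coords c \<circ> \<eta>) C1_differentiable_on (J \<inter> J')"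
    using C1_differentiable_on_mono[OF c(5)] by blast
  then have "(coords c \<circ> \<gamma>) C1_differentiable_on (J \<inter> J')"
    by (rule C1_differentiable_on_cong) (use assms(2,4) c(2) in auto)
  moreover have "\<gamma> ` (J \<inter> J') \<subseteq> param_range c" using assms(4) c(4) by force
  ultimately show ?thesis unfolding regular_at_def using c(1-3) assms(2,3) by (meson IntI open_Int)
qed

lemma velocity_cong:
  fixes \<A> :: "('a::finite, 'b) param set"
  assumes "open J" "t \<in> J" "\<And>s. s \<in> J \<Longrightarrow> \<gamma> s = \<eta> s"
  shows "velocity \<A> \<gamma> t = velocity \<A> \<eta> t"
proof -
  have "((C \<circ> \<gamma>) has_vector_derivative w) (at t) \<longleftrightarrow> ((C \<circ> \<eta>) has_vector_derivative w) (at t)"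
    for C :: "'b \<Rightarrow> real ^ 'a" and w
  proof
    assume "((C \<circ> \<gamma>) has_vector_derivative w) (at t)"
    then show "((C \<circ> \<eta>) has_vector_derivative w) (at t)"
      by (rule has_vector_derivative_transform_within_open[OF _ assms(1,2)]) (simp add: assms(3))
  next
    assume "((C \<circ> \<eta>) has_vector_derivative w) (at t)"
    then show "((C \<circ> \<gamma>) has_vector_derivative w) (at t)"
      by (rule has_vector_derivative_transform_within_open[OF _ assms(1,2)]) (simp add: assms(3))
  qed
  then show ?thesis using assms(2,3) by (simp add: velocity_def vector_derivative_def)
qed

lemma regular_at_affine:
  assumes "regular_at \<A> \<gamma> (m * t + k)"
  shows "regular_at \<A> (\<lambda>s. \<gamma> (m * s + k)) t"
proof -
  obtain c J where c: "c \<in> \<A>" "open J" "m * t + k \<in> J" "\<gamma> ` J \<subseteq> param_range c" "(coords c \<circ> \<gamma>) C1_differentiable_on J"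
    using assms(1) unfolding regular_at_def by blast
  let ?J = "(\<lambda>s. m * s + k) -` J"
  have o: "open ?J" by (rule open_vimage[OF c(2)]) (intro continuous_intros)
  obtain w where w: "\<And>s. s \<in> J \<Longrightarrow> ((coords c \<circ> \<gamma>) has_vector_derivative w s) (at s)" "continuous_on J w"
    using c(5) unfolding C1_differentiable_on_def by blast
  have "((coords c \<circ> (\<lambda>s. \<gamma> (m * s + k))) has_vector_derivative m *\<^sub>R w (m * s + k)) (at s)" if "s \<in> ?J" for s
  proof -
    have "((\<lambda>s. m * s + k) has_vector_derivative m) (at s)" by (auto intro!: derivative_eq_intros)
    from vector_diff_chain_at[OF this] w(1)[of "m * s + k"] that show ?thesis by (simp add: o_def)
  qed
  moreover have "continuous_on ?J (\<lambda>s. m *\<^sub>R w (m * s + k))"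
    by (intro continuous_intros continuous_on_compose2[OF w(2)]) auto
  ultimately have "(coords c \<circ> (\<lambda>s. \<gamma> (m * s + k))) C1_differentiable_on ?J"
    unfolding C1_differentiable_on_def by (intro exI[of _ "\<lambda>s. m *\<^sub>R w (m * s + k)"] conjI ballI)
  moreover have "(\<lambda>s. \<gamma> (m * s + k)) ` ?J \<subseteq> param_range c" using c(4) by auto
  ultimately show ?thesis unfolding regular_at_def
    using c(1,3) o by (intro bexI[of _ c] exI[of _ ?J] conjI) simp_all
qed

section \<open>Velocity, tangent vector and speed of curves\<close>

context spacelike
begin

lemma velocity_chart:
  assumes c: "c \<in> \<A>" and J: "open J" "s \<in> J" "\<gamma> ` J \<subseteq> param_range c"
    and w: "\<And>s. s \<in> J \<Longrightarrow> ((coords c \<circ> \<gamma>) has_vector_derivative w s) (at s)"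
  shows "velocity \<A> \<gamma> s = transition \<A> c (coords c (\<gamma> s)) (w s)"
    and "((coords (param_at \<A> (\<gamma> s)) \<circ> \<gamma>) has_vector_derivative velocity \<A> \<gamma> s) (at s)"
proof -
  define u where "u = coords c (\<gamma> s)"
  have u: "u \<in> fst c" "snd c u = \<gamma> s" using atlasD(7,8)[OF atlas c] J(2,3) by (auto simp: u_def)
  define c' where "c' = param_at \<A> (\<gamma> s)"
  have c': "c' \<in> \<A>" "\<gamma> s \<in> param_range c'" using param_at[OF atlas] by (simp_all add: c'_def)
  define D0 where "D0 = {u \<in> fst c. snd c u \<in> param_range c'}"
  have D0: "open D0" unfolding D0_def by (rule transition_domain_open[OF atlas c c'(1)])
  have cont: "continuous_on J (coords c \<circ> \<gamma>)"
    using w has_vector_derivative_continuous continuous_at_imp_continuous_on by blast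
  let ?S = "J \<inter> (coords c \<circ> \<gamma>) -` D0"
  have S: "open ?S" by (rule continuous_open_preimage[OF cont J(1) D0])
  have sS: "s \<in> ?S" using J(2) u c'(2) by (simp add: D0_def u_def[symmetric])
  have "((coords c' \<circ> snd c) has_derivative frechet_derivative (coords c' \<circ> snd c) (at u)) (at u)"
    by (rule transition_derivative[OF atlas c c'(1) u(1)]) (simp add: u(2) c'(2))
  then have "((coords c' \<circ> snd c) \<circ> (coords c \<circ> \<gamma>) has_vector_derivative frechet_derivative (coords c' \<circ> snd c) (at u) (w s)) (at s)"
    by (intro has_vector_derivative_linear_chain[OF w[OF J(2)]]) (simp only: u_def o_def)
  then have "((coords c' \<circ> \<gamma>) has_vector_derivative frechet_derivative (coords c' \<circ> snd c) (at u) (w s)) (at s)"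
    by (rule has_vector_derivative_transform_within_open[OF _ S sS]) (use J(3) atlasD(8)[OF atlas c] in auto)
  moreover have "transition \<A> c u = frechet_derivative (coords c' \<circ> snd c) (at u)"
    by (simp add: transition_def u(2) c'_def)
  ultimately have *: "((coords c' \<circ> \<gamma>) has_vector_derivative transition \<A> c u (w s)) (at s)" by simp
  then show 1: "velocity \<A> \<gamma> s = transition \<A> c (coords c (\<gamma> s)) (w s)"
    unfolding velocity_def c'_def u_def by (rule vector_derivative_at)
  show "((coords (param_at \<A> (\<gamma> s)) \<circ> \<gamma>) has_vector_derivative velocity \<A> \<gamma> s) (at s)"
    using * unfolding 1 u_def c'_def .
qed

text \<open>\<open>velocity\<close> is read in charts that may jump from point to point, so it need
  not be continuous. Its image in Lorentz space is, and lengths depend on that image alone.\<close>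

lemma regular_atE:
  assumes "regular_at \<A> \<gamma> t"
  obtains J where "open J" "t \<in> J" "continuous_on J \<gamma>"
    "\<And>s. s \<in> J \<Longrightarrow> ((coords (param_at \<A> (\<gamma> s)) \<circ> \<gamma>) has_vector_derivative velocity \<A> \<gamma> s) (at s)"
    "\<And>s. s \<in> J \<Longrightarrow> ((x \<circ> \<gamma>) has_vector_derivative differential \<A> x (\<gamma> s) (velocity \<A> \<gamma> s)) (at s)"
    "continuous_on J (\<lambda>s. differential \<A> x (\<gamma> s) (velocity \<A> \<gamma> s))"
proof -
  obtain c J where c: "c \<in> \<A>" and J: "open J" "t \<in> J" "\<gamma> ` J \<subseteq> param_range c" and C: "(coords c \<circ> \<gamma>) C1_differentiable_on J"
    using assms(1) unfolding regular_at_def by blast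
  obtain w where w: "\<And>s. s \<in> J \<Longrightarrow> ((coords c \<circ> \<gamma>) has_vector_derivative w s) (at s)" and wc: "continuous_on J w"
    using C unfolding C1_differentiable_on_def by blast
  have cont: "continuous_on J (coords c \<circ> \<gamma>)"
    using w has_vector_derivative_continuous continuous_at_imp_continuous_on by blast
  have u: "coords c (\<gamma> s) \<in> fst c" "snd c (coords c (\<gamma> s)) = \<gamma> s" if "s \<in> J" for s
    using atlasD(7,8)[OF atlas c] J(3) that by auto
  have vel: "velocity \<A> \<gamma> s = transition \<A> c (coords c (\<gamma> s)) (w s)"
    "((coords (param_at \<A> (\<gamma> s)) \<circ> \<gamma>) has_vector_derivative velocity \<A> \<gamma> s) (at s)" if "s \<in> J" for s
    by (rule velocity_chart[OF c J(1) that J(3) w], assumption)+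
  show ?thesis
  proof (rule that[OF J(1,2)])
    have "continuous_on J (snd c \<circ> (coords c \<circ> \<gamma>))"
      by (rule continuous_on_compose[OF cont continuous_on_subset[OF atlasD(4)[OF atlas c]]]) (use u in auto)
    then show "continuous_on J \<gamma>" by (rule continuous_on_eq) (simp add: u)
    show "((coords (param_at \<A> (\<gamma> s)) \<circ> \<gamma>) has_vector_derivative velocity \<A> \<gamma> s) (at s)" if "s \<in> J" for s
      using vel(2)[OF that] .
    show "((x \<circ> \<gamma>) has_vector_derivative differential \<A> x (\<gamma> s) (velocity \<A> \<gamma> s)) (at s)" if s: "s \<in> J" for s
    proof -
      have "(x \<circ> snd c \<circ> (coords c \<circ> \<gamma>) has_vector_derivative differential \<A> x (\<gamma> s) (velocity \<A> \<gamma> s)) (at s)"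
        using has_vector_derivative_linear_chain[OF w[OF s], of "x \<circ> snd c"
            "\<lambda>v. differential \<A> x (\<gamma> s) (transition \<A> c (coords c (\<gamma> s)) v)"]
          chart_derivative[OF smooth_x c u(1)[OF s]]
        by (simp only: vel(1)[OF s] u(2)[OF s] o_def)
      then show ?thesis
        by (rule has_vector_derivative_transform_within_open[OF _ J(1) s]) (simp add: u)
    qed
    have sm: "smooth_on (fst c) (x \<circ> snd c)" using smooth_x c by (simp add: smooth_map_def)
    have "differential \<A> x (\<gamma> s) (velocity \<A> \<gamma> s) =
      (\<Sum>b\<in>Basis. (w s \<bullet> b) *\<^sub>R frechet_derivative (x \<circ> snd c) (at ((coords c \<circ> \<gamma>) s)) b)" if s: "s \<in> J" for s
    proof -
      let ?f = "frechet_derivative (x \<circ> snd c) (at (coords c (\<gamma> s)))"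
      have lin: "linear ?f"
        using smooth_on_has_derivative[OF sm atlasD(1)[OF atlas c] u(1)[OF s]] has_derivative_linear by blast
      have "differential \<A> x (\<gamma> s) (velocity \<A> \<gamma> s) = ?f (w s)"
        using differential_chart(1)[OF atlas c u(1)[OF s] smooth_x] unfolding vel(1)[OF s] by (simp add: u(2)[OF s])
      also have "\<dots> = (\<Sum>b\<in>Basis. (w s \<bullet> b) *\<^sub>R ?f b)"
        using linear_sum[OF lin, of "\<lambda>b. (w s \<bullet> b) *\<^sub>R b" Basis]
        by (simp add: euclidean_representation linear_cmul[OF lin])
      finally show ?thesis by simp
    qed
    moreover have "continuous_on J (\<lambda>s. \<Sum>b\<in>Basis. (w s \<bullet> b) *\<^sub>R frechet_derivative (x \<circ> snd c) (at ((coords c \<circ> \<gamma>) s)) b)"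
      by (intro continuous_intros wc
        continuous_on_compose2[OF smooth_on_continuous[OF smooth_on_directional[OF sm]] cont]) (use u in auto)
    ultimately show "continuous_on J (\<lambda>s. differential \<A> x (\<gamma> s) (velocity \<A> \<gamma> s))"
      by (simp cong: continuous_on_cong)
  qed
qed

definition tangent where "tangent \<gamma> t = differential \<A> x (\<gamma> t) (velocity \<A> \<gamma> t)"

definition speed where "speed \<gamma> t = sqrt (lorentz (tangent \<gamma> t) (tangent \<gamma> t))"

lemma curve_length_speed: "curve_length \<A> x \<gamma> = integral {0..1} (speed \<gamma>)"
  by (simp add: curve_length_def speed_def[abs_def] tangent_def induced_metric_def)

lemma metric_nonneg: "lorentz (differential \<A> x p v) (differential \<A> x p v) \<ge> 0"
  using metric_pos[of v p] linear_0[OF linear_differential[OF smooth_x, of p]]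
  by (cases "v = 0") (auto simp: lorentz_0_left)

lemma speed_nonneg: "speed \<gamma> t \<ge> 0"
  by (simp add: speed_def tangent_def metric_nonneg)

lemma speed_cong: "open J \<Longrightarrow> t \<in> J \<Longrightarrow> (\<And>s. s \<in> J \<Longrightarrow> \<gamma> s = \<eta> s) \<Longrightarrow> speed \<gamma> t = speed \<eta> t"
  unfolding speed_def tangent_def using velocity_cong[of J t \<gamma> \<eta> \<A>] by auto

lemma speed_affine:
  assumes "regular_at \<A> \<gamma> (m * t + k)"
  shows "speed (\<lambda>s. \<gamma> (m * s + k)) t = \<bar>m\<bar> * speed \<gamma> (m * t + k)"
proof -
  obtain J where J: "m * t + k \<in> J" "\<And>s. s \<in> J \<Longrightarrow> ((coords (param_at \<A> (\<gamma> s)) \<circ> \<gamma>) has_vector_derivative velocity \<A> \<gamma> s) (at s)"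
    using regular_atE[OF assms] by metis
  let ?c = "coords (param_at \<A> (\<gamma> (m * t + k)))"
  have "((\<lambda>s. m * s + k) has_vector_derivative m) (at t)" by (auto intro!: derivative_eq_intros)
  from vector_diff_chain_at[OF this] J(2)[OF J(1)]
  have "((?c \<circ> (\<lambda>s. \<gamma> (m * s + k))) has_vector_derivative m *\<^sub>R velocity \<A> \<gamma> (m * t + k)) (at t)" by (simp add: o_def)
  then have "velocity \<A> (\<lambda>s. \<gamma> (m * s + k)) t = m *\<^sub>R velocity \<A> \<gamma> (m * t + k)"
    unfolding velocity_def by (rule vector_derivative_at)
  then have "tangent (\<lambda>s. \<gamma> (m * s + k)) t = m *\<^sub>R tangent \<gamma> (m * t + k)"
    by (simp add: tangent_def linear_cmul[OF linear_differential[OF smooth_x]])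
  then show ?thesis
    by (simp add: speed_def lorentz_scaleR_left lorentz_scaleR_right mult.assoc[symmetric] real_sqrt_mult real_sqrt_mult_self)
qed

lemma speed_continuous:
  assumes "\<And>t. t \<in> I \<Longrightarrow> regular_at \<A> \<gamma> t"
  shows "continuous_on I (speed \<gamma>)" "continuous_on I \<gamma>"
proof -
  have "continuous (at t within I) (tangent \<gamma>)" "continuous (at t within I) \<gamma>" if t: "t \<in> I" for t
  proof -
    obtain J where J: "open J" "t \<in> J" "continuous_on J \<gamma>" "continuous_on J (\<lambda>s. differential \<A> x (\<gamma> s) (velocity \<A> \<gamma> s))"
      using regular_atE[OF assms[OF t]] by metis
    then show "continuous (at t within I) (tangent \<gamma>)" "continuous (at t within I) \<gamma>"
      unfolding tangent_def by (metis continuous_at_imp_continuous_at_within continuous_on_eq_continuous_at)+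
  qed
  then have c: "continuous_on I (tangent \<gamma>)" and "continuous_on I \<gamma>"
    by (simp_all add: continuous_on_eq_continuous_within)
  then show "continuous_on I \<gamma>" by simp
  show "continuous_on I (speed \<gamma>)"
    unfolding speed_def by (intro continuous_on_real_sqrt bounded_bilinear.continuous_on[OF bounded_bilinear_lorentz] c)
qed

end

text \<open>At the first subdivision point where \<open>P\<close> fails, the preceding point of
  \<open>T\<close> still satisfies it, and no point of \<open>T\<close> lies between the
  two.\<close>

lemma subdivision_induct:
  fixes T :: "real set"
  assumes T: "finite T" "{0, 1} \<subseteq> T" "T \<subseteq> {0..1}" and P0: "P 0"
    and step: "\<And>a b. a \<in> T \<Longrightarrow> b \<in> T \<Longrightarrow> a < b \<Longrightarrow> {a<..<b} \<inter> T = {} \<Longrightarrow> P a \<Longrightarrow> P b"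
  shows "P 1"
proof (rule ccontr)
  assume "\<not> P 1"
  let ?B = "{t \<in> T. \<not> P t}"
  have B: "finite ?B" "?B \<noteq> {}" using T \<open>\<not> P 1\<close> by auto
  define b where "b = Min ?B"
  have b: "b \<in> T" "\<not> P b" using Min_in[OF B] by (auto simp: b_def)
  have "b > 0" using b T(3) P0 by (metis atLeastAtMost_iff less_eq_real_def subsetD)
  let ?A = "{t \<in> T. t < b}"
  have A: "finite ?A" "?A \<noteq> {}" using T \<open>b > 0\<close> by auto
  define a where "a = Max ?A"
  have a: "a \<in> T" "a < b" using Max_in[OF A] by (auto simp: a_def)
  have "{a<..<b} \<inter> T = {}" using Max_ge[OF A(1)] by (force simp: a_def)
  moreover have "P a"
  proof (rule ccontr)
    assume "\<not> P a"
    then have "b \<le> a" unfolding b_def using a(1) B(1) by (intro Min_le) auto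
    then show False using a(2) by simp
  qed
  ultimately show False using step a b by blast
qed

lemma subdivision_gap:
  fixes T :: "real set"
  assumes T: "finite T" "{0, 1} \<subseteq> T" and t: "0 < t" "t < 1" "t \<notin> T"
  obtains a b where "a \<in> T" "b \<in> T" "a < t" "t < b" "{a<..<b} \<inter> T = {}"
proof -
  let ?A = "{s \<in> T. s < t}" and ?B = "{s \<in> T. t < s}"
  have A: "finite ?A" "?A \<noteq> {}" and B: "finite ?B" "?B \<noteq> {}" using T t by auto
  have "Max ?A \<in> ?A" "Min ?B \<in> ?B" using Max_in[OF A] Min_in[OF B] .
  moreover have "{Max ?A<..<Min ?B} \<inter> T = {}"
  proof -
    have "s \<le> Max ?A \<or> Min ?B \<le> s" if "s \<in> T" for s
    proof (cases "s < t")
      case True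
      then show ?thesis using Max_ge[OF A(1)] that by blast
    next
      case False
      then have "t < s" using that t(3) by (metis not_less_iff_gr_or_eq)
      then show ?thesis using Min_le[OF B(1)] that by blast
    qed
    then show ?thesis by fastforce
  qed
  ultimately show thesis using that by auto
qed

context spacelike
begin

lemma piecewiseE:
  assumes "piecewise_C1_curve \<A> \<gamma>"
  obtains T where "finite T" "{0, 1} \<subseteq> T" "T \<subseteq> {0..1}"
    "\<And>a b. a \<in> T \<Longrightarrow> b \<in> T \<Longrightarrow> a < b \<Longrightarrow> {a<..<b} \<inter> T = {} \<Longrightarrow>
       \<exists>\<eta>. C1_curve_on \<A> {a..b} \<eta> \<and> (\<forall>t\<in>{a..b}. \<gamma> t = \<eta> t)"
proof -
  obtain T where TT: "finite T \<and> {0, 1} \<subseteq> T \<and> T \<subseteq> {0..1} \<and>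
        (\<forall>a\<in>T. \<forall>b\<in>T. a < b \<and> {a<..<b} \<inter> T = {} \<longrightarrow>
           (\<exists>\<eta>. C1_curve_on \<A> {a..b} \<eta> \<and> (\<forall>t\<in>{a..b}. \<gamma> t = \<eta> t)))"
    using assms unfolding piecewise_C1_curve_def ..
  show thesis
    by (rule that[OF conjunct1[OF TT] conjunct1[OF conjunct2[OF TT]] conjunct1[OF conjunct2[OF conjunct2[OF TT]]]],
      rule conjunct2[OF conjunct2[OF conjunct2[OF TT]], rule_format]) simp_all
qed

text \<open>At subdivision points the curve may have a corner, where the value of
  \<open>speed\<close> is arbitrary. These are finitely many points, which do not affect
  integrability.\<close>

lemma piecewise_regular:
  assumes "piecewise_C1_curve \<A> \<gamma>"
  obtains T where "finite T" "\<And>t. 0 < t \<Longrightarrow> t < 1 \<Longrightarrow> t \<notin> T \<Longrightarrow> regular_at \<A> \<gamma> t"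
    "continuous_on {0..1} \<gamma>" "speed \<gamma> integrable_on {0..1}"
proof -
  obtain T where T: "finite T" "{0, 1} \<subseteq> T" "T \<subseteq> {0..1}"
    and pc: "\<And>a b. a \<in> T \<Longrightarrow> b \<in> T \<Longrightarrow> a < b \<Longrightarrow> {a<..<b} \<inter> T = {} \<Longrightarrow>
       \<exists>\<eta>. C1_curve_on \<A> {a..b} \<eta> \<and> (\<forall>t\<in>{a..b}. \<gamma> t = \<eta> t)"
    using piecewiseE[OF assms] by metis
  show ?thesis
  proof (rule that[OF T(1)])
    fix t :: real assume t: "0 < t" "t < 1" "t \<notin> T"
    obtain a b where ab: "a \<in> T" "b \<in> T" "a < t" "t < b" "{a<..<b} \<inter> T = {}"
      using subdivision_gap[OF T(1,2) t] .
    then obtain \<eta> where \<eta>: "C1_curve_on \<A> {a..b} \<eta>" "\<forall>t\<in>{a..b}. \<gamma> t = \<eta> t" using pc[of a b] by auto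
    show "regular_at \<A> \<gamma> t"
      by (rule regular_at_cong[of _ \<eta> _ "{a<..<b}"]) (use \<eta> ab in \<open>auto simp: C1_curve_on_regular\<close>)
  next
    show "continuous_on {0..1} \<gamma>"
    proof (rule subdivision_induct[OF T, where P = "\<lambda>b. continuous_on {0..b} \<gamma>"])
      fix a b assume ab: "a \<in> T" "b \<in> T" "a < b" "{a<..<b} \<inter> T = {}" and IH: "continuous_on {0..a} \<gamma>"
      obtain \<eta> where \<eta>: "C1_curve_on \<A> {a..b} \<eta>" "\<forall>t\<in>{a..b}. \<gamma> t = \<eta> t" using pc[OF ab] by blast
      have "continuous_on {a..b} \<eta>" by (rule speed_continuous(2)) (use \<eta> in \<open>simp add: C1_curve_on_regular\<close>)
      then have "continuous_on {a..b} \<gamma>" by (rule continuous_on_eq) (use \<eta> in auto)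
      moreover have "{0..a} \<union> {a..b} = {0..b}" using ab T(3) by (auto simp: subset_iff)
      ultimately show "continuous_on {0..b} \<gamma>"
        using continuous_on_closed_Un[OF closed_atLeastAtMost closed_atLeastAtMost IH, of a b] by simp
    qed simp
    show "speed \<gamma> integrable_on {0..1}"
    proof (rule subdivision_induct[OF T, where P = "\<lambda>b. speed \<gamma> integrable_on {0..b}"])
      fix a b assume ab: "a \<in> T" "b \<in> T" "a < b" "{a<..<b} \<inter> T = {}" and IH: "speed \<gamma> integrable_on {0..a}"
      obtain \<eta> where \<eta>: "C1_curve_on \<A> {a..b} \<eta>" "\<forall>t\<in>{a..b}. \<gamma> t = \<eta> t" using pc[OF ab] by blast
      have "continuous_on {a..b} (speed \<eta>)" by (rule speed_continuous(1)) (use \<eta> in \<open>simp add: C1_curve_on_regular\<close>)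
      then have "speed \<eta> integrable_on {a..b}" by (rule integrable_continuous_real)
      then have "speed \<gamma> integrable_on {a..b}"
      proof (rule integrable_spike_finite[of "{a, b}", rotated 2])
        fix t assume "t \<in> {a..b} - {a, b}"
        then show "speed \<gamma> t = speed \<eta> t" by (intro speed_cong[of "{a<..<b}"]) (use \<eta> in auto)
      qed simp
      moreover have "0 \<le> a" using ab T(3) by auto
      ultimately show "speed \<gamma> integrable_on {0..b}" using Henstock_Kurzweil_Integration.integrable_combine[OF _ _ IH] ab(3) by simp
    qed (use integrable_on_refl[of "speed \<gamma>" "0::real"] in simp)
  qed
qed

lemma curve_length_nonneg: "curve_length \<A> x \<gamma> \<ge> 0"
proof (cases "speed \<gamma> integrable_on {0..1}")
  case True
  then show ?thesis unfolding curve_length_speed by (rule integral_nonneg) (simp add: speed_nonneg)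
next
  case False
  then show ?thesis unfolding curve_length_speed by (simp add: not_integrable_integral)
qed

lemma C1_piecewise: "C1_curve_on \<A> {0..1} \<gamma> \<Longrightarrow> piecewise_C1_curve \<A> \<gamma>"
  unfolding piecewise_C1_curve_def by (intro exI[of _ "{0, 1}"]) auto

end

lemma has_integral_affine:
  fixes f :: "real \<Rightarrow> real"
  assumes "(f has_integral I) {0..1}" "m \<noteq> 0"
  shows "((\<lambda>t. \<bar>m\<bar> * f (m * t + k)) has_integral I) ((\<lambda>x. x / m - k / m) ` {0..1})"
proof -
  have "((\<lambda>t. f (m *\<^sub>R t + k)) has_integral (1 / \<bar>m\<bar> ^ DIM(real)) *\<^sub>R I)
    ((\<lambda>x. (1 / m) *\<^sub>R x + - ((1 / m) *\<^sub>R k)) ` cbox 0 1)"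
    by (rule has_integral_affinity) (use assms in auto)
  from has_integral_mult_right[OF this, of "\<bar>m\<bar>"] show ?thesis using assms(2) by simp
qed

section \<open>Reversing and joining curves\<close>

context spacelike
begin

abbreviation curve_between where
  "curve_between p q \<gamma> \<equiv> piecewise_C1_curve \<A> \<gamma> \<and> \<gamma> 0 = p \<and> \<gamma> 1 = q"

lemma length_has_integral: "piecewise_C1_curve \<A> \<gamma> \<Longrightarrow> (speed \<gamma> has_integral curve_length \<A> x \<gamma>) {0..1}"
  unfolding curve_length_speed using piecewise_regular by (metis integrable_integral)

text \<open>Serves the reversal of a curve with \<open>m = -1\<close> and both halves of a join with
  \<open>m = 2\<close>. Agreement on the open interval suffices, since end points are null.\<close>

lemma reparametrized_length:
  assumes \<gamma>: "piecewise_C1_curve \<A> \<gamma>" and m: "m \<noteq> 0"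
    and ab: "a < b" "(\<lambda>x. x / m - k / m) ` {0..1} = {a..b}"
    and \<eta>: "\<And>t. a < t \<Longrightarrow> t < b \<Longrightarrow> \<eta> t = \<gamma> (m * t + k)"
  shows "(speed \<eta> has_integral curve_length \<A> x \<gamma>) {a..b}"
proof -
  obtain T where T: "finite T" "\<And>t. 0 < t \<Longrightarrow> t < 1 \<Longrightarrow> t \<notin> T \<Longrightarrow> regular_at \<A> \<gamma> t"
    using piecewise_regular[OF \<gamma>] by metis
  let ?T = "(\<lambda>x. x / m - k / m) ` (T \<union> {0, 1})"
  have "((\<lambda>t. \<bar>m\<bar> * speed \<gamma> (m * t + k)) has_integral curve_length \<A> x \<gamma>) {a..b}"
    using has_integral_affine[OF length_has_integral[OF \<gamma>] m, of k] ab(2) by simp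
  then show ?thesis
  proof (rule has_integral_spike_finite[of "?T \<union> {a, b}", rotated 2])
    fix t assume t: "t \<in> {a..b} - (?T \<union> {a, b})"
    then have "t \<in> (\<lambda>x. x / m - k / m) ` {0..1}" unfolding ab(2) by blast
    then obtain y where y: "y \<in> {0..1}" "t = y / m - k / m" by blast
    then have "y \<notin> T \<union> {0, 1}" using t by blast
    moreover have e: "m * t + k = y" using y(2) m by (simp add: right_diff_distrib)
    ultimately have "regular_at \<A> \<gamma> (m * t + k)" using T(2)[of y] y(1) by auto
    from speed_affine[OF this] have "speed (\<lambda>s. \<gamma> (m * s + k)) t = \<bar>m\<bar> * speed \<gamma> (m * t + k)" .
    moreover have "speed \<eta> t = speed (\<lambda>s. \<gamma> (m * s + k)) t"
      by (rule speed_cong[of "{a<..<b}"]) (use t \<eta> in auto)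
    ultimately show "speed \<eta> t = \<bar>m\<bar> * speed \<gamma> (m * t + k)" by simp
  qed (use T(1) in simp)
qed

lemma C1_curve_affine:
  assumes "C1_curve_on \<A> I \<eta>" "\<And>t. t \<in> I' \<Longrightarrow> m * t + k \<in> I"
  shows "C1_curve_on \<A> I' (\<lambda>t. \<eta> (m * t + k))"
  using assms unfolding C1_curve_on_regular by (blast intro: regular_at_affine)

lemma reverse_curve:
  assumes "curve_between p q \<gamma>"
  shows "curve_between q p (\<lambda>t. \<gamma> (1 - t))" "curve_length \<A> x (\<lambda>t. \<gamma> (1 - t)) = curve_length \<A> x \<gamma>"
proof -
  obtain T where T: "finite T" "{0, 1} \<subseteq> T" "T \<subseteq> {0..1}"
    and pc: "\<And>a b. a \<in> T \<Longrightarrow> b \<in> T \<Longrightarrow> a < b \<Longrightarrow> {a<..<b} \<inter> T = {} \<Longrightarrow>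
       \<exists>\<eta>. C1_curve_on \<A> {a..b} \<eta> \<and> (\<forall>t\<in>{a..b}. \<gamma> t = \<eta> t)"
    using assms piecewiseE by metis
  have "piecewise_C1_curve \<A> (\<lambda>t. \<gamma> (1 - t))"
    unfolding piecewise_C1_curve_def
  proof (intro exI[of _ "(\<lambda>t. 1 - t) ` T"] conjI ballI impI)
    show "finite ((\<lambda>t. 1 - t) ` T)" using T(1) by simp
    show "{0, 1} \<subseteq> (\<lambda>t. 1 - t) ` T" using T(2) by (force simp: image_iff)
    show "(\<lambda>t. 1 - t) ` T \<subseteq> {0..1}" using T(3) by force
    fix a b assume a: "a \<in> (\<lambda>t. 1 - t) ` T" and b: "b \<in> (\<lambda>t. 1 - t) ` T" and ab: "a < b \<and> {a<..<b} \<inter> (\<lambda>t. 1 - t) ` T = {}"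
    have "1 - b \<in> T" "1 - a \<in> T" using a b by force+
    moreover have "{1 - b<..<1 - a} \<inter> T = {}"
    proof (rule ccontr)
      assume "\<not> ?thesis"
      then obtain s where "1 - b < s" "s < 1 - a" "s \<in> T" by auto
      then have "1 - s \<in> {a<..<b} \<inter> (\<lambda>t. 1 - t) ` T" by auto
      then show False using ab by blast
    qed
    ultimately obtain \<eta> where \<eta>: "C1_curve_on \<A> {1 - b..1 - a} \<eta>" "\<forall>t\<in>{1 - b..1 - a}. \<gamma> t = \<eta> t"
      using pc[of "1 - b" "1 - a"] ab by auto
    have "C1_curve_on \<A> {a..b} (\<lambda>t. \<eta> ((-1) * t + 1))" by (rule C1_curve_affine[OF \<eta>(1)]) auto
    then show "\<exists>\<eta>. C1_curve_on \<A> {a..b} \<eta> \<and> (\<forall>t\<in>{a..b}. \<gamma> (1 - t) = \<eta> t)"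
      using \<eta>(2) by (intro exI[of _ "\<lambda>t. \<eta> ((-1) * t + 1)"] conjI ballI) auto
  qed
  then show "curve_between q p (\<lambda>t. \<gamma> (1 - t))" using assms by simp
  have "(\<lambda>x::real. x / (-1) - 1 / (-1)) ` {0..1} = {0..1}"
    by (auto simp: image_iff intro!: bexI[of _ "1 - x" for x])
  then have "(speed (\<lambda>t. \<gamma> (1 - t)) has_integral curve_length \<A> x \<gamma>) {0..1}"
    using assms by (intro reparametrized_length[of \<gamma> "-1" 0 1 1]) auto
  then show "curve_length \<A> x (\<lambda>t. \<gamma> (1 - t)) = curve_length \<A> x \<gamma>"
    unfolding curve_length_speed[of "\<lambda>t. \<gamma> (1 - t)"] by (rule integral_unique)
qed

definition join :: "(real \<Rightarrow> 'm) \<Rightarrow> (real \<Rightarrow> 'm) \<Rightarrow> real \<Rightarrow> 'm" where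
  "join \<gamma> \<delta> t = (if t \<le> 1 / 2 then \<gamma> (2 * t) else \<delta> (2 * t - 1))"

lemma join_curve:
  assumes \<gamma>: "curve_between p q \<gamma>" and \<delta>: "curve_between q r \<delta>"
  shows "curve_between p r (join \<gamma> \<delta>)"
    "curve_length \<A> x (join \<gamma> \<delta>) = curve_length \<A> x \<gamma> + curve_length \<A> x \<delta>"
proof -
  obtain T where T: "finite T" "{0, 1} \<subseteq> T" "T \<subseteq> {0..1}"
    and pc: "\<And>a b. a \<in> T \<Longrightarrow> b \<in> T \<Longrightarrow> a < b \<Longrightarrow> {a<..<b} \<inter> T = {} \<Longrightarrow>
       \<exists>\<eta>. C1_curve_on \<A> {a..b} \<eta> \<and> (\<forall>t\<in>{a..b}. \<gamma> t = \<eta> t)"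
    using \<gamma> piecewiseE by metis
  obtain U where U: "finite U" "{0, 1} \<subseteq> U" "U \<subseteq> {0..1}"
    and pd: "\<And>a b. a \<in> U \<Longrightarrow> b \<in> U \<Longrightarrow> a < b \<Longrightarrow> {a<..<b} \<inter> U = {} \<Longrightarrow>
       \<exists>\<eta>. C1_curve_on \<A> {a..b} \<eta> \<and> (\<forall>t\<in>{a..b}. \<delta> t = \<eta> t)"
    using \<delta> piecewiseE by metis
  let ?W = "{t. 2 * t \<in> T} \<union> {t. 2 * t - 1 \<in> U}"
  \<comment> \<open>A point that comes from \<open>U\<close> and lies in the first half can only be
    1 / 2, which also comes from \<open>1 \<in> T\<close>. So each half sees exactly its own
    subdivision.\<close>
  have W1: "2 * t \<in> T" if "t \<in> ?W" "t \<le> 1 / 2" for t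
  proof (cases "2 * t \<in> T")
    case False
    then have "2 * t - 1 \<in> U" using that by simp
    then have "2 * t - 1 \<ge> 0" using U(3) by auto
    then have "2 * t = 1" using that(2) by linarith
    then show ?thesis using T(2) by simp
  qed
  have W2: "2 * t - 1 \<in> U" if "t \<in> ?W" "t \<ge> 1 / 2" for t
  proof (cases "2 * t - 1 \<in> U")
    case False
    then have "2 * t \<in> T" using that by simp
    then have "2 * t \<le> 1" using T(3) by auto
    then have "2 * t - 1 = 0" using that(2) by linarith
    then show ?thesis using U(2) by simp
  qed
  have "piecewise_C1_curve \<A> (join \<gamma> \<delta>)"
    unfolding piecewise_C1_curve_def
  proof (intro exI[of _ ?W] conjI ballI impI)
    have "finite ((\<lambda>t. 2 * t) -` T)" "finite ((\<lambda>t. 2 * t - 1) -` U)"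
      using T(1) U(1) by (auto intro!: finite_vimageI simp: inj_def)
    then show "finite ?W" by (simp add: vimage_def)
    show "{0, 1} \<subseteq> ?W" using T(2) U(2) by auto
    show "?W \<subseteq> {0..1}"
    proof
      fix t assume "t \<in> ?W"
      then have "2 * t \<in> {0..1} \<or> 2 * t - 1 \<in> {0..1}" using T(3) U(3) by blast
      then show "t \<in> {0..1}" by auto
    qed
    fix a b assume a: "a \<in> ?W" and b: "b \<in> ?W" and ab: "a < b \<and> {a<..<b} \<inter> ?W = {}"
    have "1 / 2 \<in> ?W" using T(2) by simp
    then have "1 / 2 \<notin> {a<..<b}" using ab by blast
    then consider "b \<le> 1 / 2" | "1 / 2 \<le> a" by fastforce
    then show "\<exists>\<eta>. C1_curve_on \<A> {a..b} \<eta> \<and> (\<forall>t\<in>{a..b}. join \<gamma> \<delta> t = \<eta> t)"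
    proof cases
      case 1
      have "{2 * a<..<2 * b} \<inter> T = {}"
      proof (rule ccontr)
        assume "\<not> ?thesis"
        then obtain s where "2 * a < s" "s < 2 * b" "s \<in> T" by auto
        then have "s / 2 \<in> {a<..<b} \<inter> ?W" by auto
        then show False using ab by blast
      qed
      then obtain \<eta> where \<eta>: "C1_curve_on \<A> {2 * a..2 * b} \<eta>" "\<forall>t\<in>{2 * a..2 * b}. \<gamma> t = \<eta> t"
        using pc[of "2 * a" "2 * b"] W1[OF a] W1[OF b] ab 1 by auto
      have "C1_curve_on \<A> {a..b} (\<lambda>t. \<eta> (2 * t + 0))" by (rule C1_curve_affine[OF \<eta>(1)]) auto
      then show ?thesis
        using \<eta>(2) 1 by (intro exI[of _ "\<lambda>t. \<eta> (2 * t + 0)"] conjI ballI) (auto simp: join_def)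
    next
      case 2
      have "{2 * a - 1<..<2 * b - 1} \<inter> U = {}"
      proof (rule ccontr)
        assume "\<not> ?thesis"
        then obtain s where "2 * a - 1 < s" "s < 2 * b - 1" "s \<in> U" by auto
        then have "(s + 1) / 2 \<in> {a<..<b} \<inter> ?W" by (auto simp: field_simps)
        then show False using ab by blast
      qed
      then obtain \<eta> where \<eta>: "C1_curve_on \<A> {2 * a - 1..2 * b - 1} \<eta>" "\<forall>t\<in>{2 * a - 1..2 * b - 1}. \<delta> t = \<eta> t"
        using pd[of "2 * a - 1" "2 * b - 1"] W2[OF a] W2[OF b] ab 2 by auto
      have C: "C1_curve_on \<A> {a..b} (\<lambda>t. \<eta> (2 * t + -1))" by (rule C1_curve_affine[OF \<eta>(1)]) auto
      have "join \<gamma> \<delta> t = \<delta> (2 * t - 1)" if "t \<in> {a..b}" for t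
      proof (cases "t = 1 / 2")
        case True
        show ?thesis unfolding True using \<gamma> \<delta> by (simp add: join_def)
      next
        case False
        then show ?thesis using that 2 by (simp add: join_def)
      qed
      then show ?thesis using \<eta>(2) by (intro exI[of _ "\<lambda>t. \<eta> (2 * t + -1)"] conjI ballI C) auto
    qed
  qed
  then show "curve_between p r (join \<gamma> \<delta>)" using \<gamma> \<delta> by (simp add: join_def)
  have i1: "(\<lambda>x::real. x / 2 - 0 / 2) ` {0..1} = {0..1 / 2}"
    using image_affinity_atLeastAtMost[of "1/2::real" 0 0 1] by simp
  have i2: "(\<lambda>x::real. x / 2 - (-1) / 2) ` {0..1} = {1 / 2..1}"
    using image_affinity_atLeastAtMost[of "1/2::real" "1/2" 0 1] by simp
  have 1: "(speed (join \<gamma> \<delta>) has_integral curve_length \<A> x \<gamma>) {0..1 / 2}"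
    by (rule reparametrized_length[OF _ _ _ i1]) (use \<gamma> in \<open>auto simp: join_def\<close>)
  have 2: "(speed (join \<gamma> \<delta>) has_integral curve_length \<A> x \<delta>) {1 / 2..1}"
    by (rule reparametrized_length[OF _ _ _ i2]) (use \<delta> in \<open>auto simp: join_def\<close>)
  have "(speed (join \<gamma> \<delta>) has_integral curve_length \<A> x \<gamma> + curve_length \<A> x \<delta>) {0..1}"
    by (rule has_integral_combine[OF _ _ 1 2]) auto
  then show "curve_length \<A> x (join \<gamma> \<delta>) = curve_length \<A> x \<gamma> + curve_length \<A> x \<delta>"
    unfolding curve_length_speed[of "join \<gamma> \<delta>"] by (rule integral_unique)
qed

lemma segment_regular:
  assumes c: "c \<in> \<A>" and J: "open J" "\<And>t. t \<in> J \<Longrightarrow> w t \<in> fst c" "w C1_differentiable_on J" and t: "t \<in> J"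
    and \<gamma>: "\<And>s. s \<in> J \<Longrightarrow> \<gamma> s = snd c (w s)"
  shows "regular_at \<A> \<gamma> t"
proof -
  have "(coords c \<circ> \<gamma>) C1_differentiable_on J"
    by (rule C1_differentiable_on_cong[OF J(3,1)]) (simp add: \<gamma> atlasD(6)[OF atlas c] J(2))
  moreover have "\<gamma> ` J \<subseteq> param_range c" using \<gamma> J(2) by auto
  ultimately show ?thesis unfolding regular_at_def using c J(1) t by blast
qed

lemma segment_C1: "(\<lambda>t. u + t *\<^sub>R (v - u)) C1_differentiable_on J"
  unfolding C1_differentiable_on_def
  by (intro exI[of _ "\<lambda>t. v - u"] conjI ballI continuous_intros) (auto intro!: derivative_eq_intros)

text \<open>Segments in coordinate balls make every class of mutually joinable points open, so by
  connectedness there is one class. Thus the infimum in \<open>riemannian_dist\<close> is over a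
  nonempty set.\<close>

lemma curve_exists: "\<exists>\<gamma>. curve_between p q \<gamma>"
proof -
  define C where "C p = {q. \<exists>\<gamma>. curve_between p q \<gamma>}" for p
  have sym: "p \<in> C q" if "q \<in> C p" for p q using that reverse_curve(1) unfolding C_def by blast
  have trans: "r \<in> C p" if "q \<in> C p" "r \<in> C q" for p q r using that join_curve(1) unfolding C_def by blast
  have nbhd: "\<exists>U. open U \<and> p \<in> U \<and> U \<subseteq> C p" for p
  proof -
    define c where "c = param_at \<A> p"
    have c: "c \<in> \<A>" "p \<in> param_range c" using param_at[OF atlas] by (simp_all add: c_def)
    define u where "u = coords c p"
    have u: "u \<in> fst c" "snd c u = p" using atlasD(7,8)[OF atlas c] by (simp_all add: u_def)
    obtain r where r: "r > 0" "ball u r \<subseteq> fst c" using atlasD(1)[OF atlas c(1)] u(1) openE by blast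
    have "snd c v \<in> C p" if v: "v \<in> ball u r" for v
    proof -
      let ?w = "\<lambda>t. u + t *\<^sub>R (v - u)"
      let ?J = "?w -` ball u r"
      have o: "open ?J" by (rule open_vimage[OF open_ball]) (intro continuous_intros)
      have mem: "t \<in> ?J" if "t \<in> {0..1}" for t
      proof -
        have "norm (t *\<^sub>R (v - u)) \<le> norm (v - u)" using that by (simp add: mult_left_le_one_le)
        then show ?thesis using v by (simp add: dist_norm norm_minus_commute)
      qed
      have "regular_at \<A> (\<lambda>t. snd c (?w t)) t" if "t \<in> {0..1}" for t
        by (rule segment_regular[OF c(1) o _ segment_C1 mem[OF that]]) (use r(2) in auto)
      then have "piecewise_C1_curve \<A> (\<lambda>t. snd c (?w t))"
        by (intro C1_piecewise) (simp add: C1_curve_on_regular)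
      then have "curve_between p (snd c v) (\<lambda>t. snd c (?w t))" using u(2) by simp
      then show ?thesis unfolding C_def by blast
    qed
    then have "snd c ` ball u r \<subseteq> C p" by blast
    moreover have "p \<in> snd c ` ball u r" using u(2) r(1) by (metis centre_in_ball imageI)
    ultimately show ?thesis using chart_image_open[OF atlas c(1) open_ball r(2)] by blast
  qed
  have "open (C p)"
  proof (subst open_subopen, intro ballI)
    fix q assume q: "q \<in> C p"
    obtain U where U: "open U" "q \<in> U" "U \<subseteq> C q" using nbhd[of q] by (elim exE conjE)
    have "U \<subseteq> C p"
    proof
      fix r assume "r \<in> U"
      then show "r \<in> C p" using U(3) trans[OF q] by (simp add: subset_iff)
    qed
    then show "\<exists>U. open U \<and> q \<in> U \<and> U \<subseteq> C p" using U(1,2) by (intro exI[of _ U] conjI)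
  qed
  moreover have "open (- C p)"
  proof (subst open_subopen, intro ballI)
    fix q assume q: "q \<in> - C p"
    obtain U where U: "open U" "q \<in> U" "U \<subseteq> C q" using nbhd[of q] by (elim exE conjE)
    have "U \<subseteq> - C p"
    proof
      fix r assume "r \<in> U"
      then have "q \<in> C r" using U(3) sym by (simp add: subset_iff)
      then show "r \<in> - C p" using q trans[of r p q] by auto
    qed
    then show "\<exists>U. open U \<and> q \<in> U \<and> U \<subseteq> - C p" using U(1,2) by (intro exI[of _ U] conjI)
  qed
  moreover have pp: "p \<in> C p"
  proof -
    obtain U where "p \<in> U" "U \<subseteq> C p" using nbhd[of p] by (elim exE conjE)
    then show ?thesis by (rule rev_subsetD)
  qed
  ultimately have "- C p = {}" using connectedD[OF conn, of "C p" "- C p"] by auto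
  then have "q \<in> C p" by blast
  then show ?thesis by (simp add: C_def)
qed

end

section \<open>Local homeomorphisms with continuation of sections\<close>

definition section_on :: "('m::topological_space \<Rightarrow> 'b::euclidean_space) \<Rightarrow> 'b set \<Rightarrow> ('b \<Rightarrow> 'm) \<Rightarrow> bool" where
  "section_on f S g \<longleftrightarrow> continuous_on S g \<and> (\<forall>y\<in>S. f (g y) = y)"

lemma section_on_subset: "section_on f S g \<Longrightarrow> T \<subseteq> S \<Longrightarrow> section_on f T g"
  unfolding section_on_def using continuous_on_subset by blast

locale local_homeo =
  fixes f :: "'m::t2_space \<Rightarrow> 'b::euclidean_space"
  assumes cont: "continuous_on UNIV f"
    and loc: "\<exists>W r h. open W \<and> p \<in> W \<and> r > 0 \<and> homeomorphism W (ball (f p) r) f h"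
begin

lemma inj_nbhd: "\<exists>W. open W \<and> p \<in> W \<and> inj_on f W"
proof -
  obtain W r h where "open W" "p \<in> W" "homeomorphism W (ball (f p) r) f h" using loc[of p] by blast
  then show ?thesis by (intro exI[of _ W]) (auto simp: homeomorphism_def intro: inj_on_inverseI)
qed

text \<open>The set where the sections agree is open because \<open>f\<close> is locally injective,
  and closed because the manifold is Hausdorff.\<close>

lemma section_unique:
  assumes S: "connected S" and g: "section_on f S g" and h: "section_on f S h"
    and y: "y \<in> S" "g y = h y" and z: "z \<in> S"
  shows "g z = h z"
proof -
  let ?E = "{z \<in> S. g z = h z}"
  have cg: "continuous_on S g" and ch: "continuous_on S h"
    and fg: "\<And>z. z \<in> S \<Longrightarrow> f (g z) = z" and fh: "\<And>z. z \<in> S \<Longrightarrow> f (h z) = z"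
    using g h by (auto simp: section_on_def)
  have "openin (top_of_set S) ?E"
  proof (subst openin_subopen, intro ballI)
    fix w assume w: "w \<in> ?E"
    obtain W where W: "open W" "g w \<in> W" "inj_on f W" using inj_nbhd[of "g w"] by blast
    let ?T = "(S \<inter> g -` W) \<inter> (S \<inter> h -` W)"
    have "openin (top_of_set S) ?T"
      by (intro openin_Int continuous_openin_preimage_gen cg ch W(1))
    moreover have "w \<in> ?T" using w W(2) by auto
    moreover have "?T \<subseteq> ?E"
    proof
      fix v assume v: "v \<in> ?T"
      then have "f (g v) = f (h v)" using fg fh by simp
      then have "g v = h v" using W(3) v by (simp add: inj_on_def)
      then show "v \<in> ?E" using v by simp
    qed
    ultimately show "\<exists>T. openin (top_of_set S) T \<and> w \<in> T \<and> T \<subseteq> ?E" by blast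
  qed
  moreover have "openin (top_of_set S) (S - ?E)"
  proof (subst openin_subopen, intro ballI)
    fix w assume w: "w \<in> S - ?E"
    then have "g w \<noteq> h w" by simp
    then obtain A B where AB: "open A" "open B" "g w \<in> A" "h w \<in> B" "A \<inter> B = {}"
      using hausdorff by metis
    let ?T = "(S \<inter> g -` A) \<inter> (S \<inter> h -` B)"
    have "openin (top_of_set S) ?T"
      by (intro openin_Int continuous_openin_preimage_gen cg ch AB)
    moreover have "w \<in> ?T" using w AB by auto
    moreover have "?T \<subseteq> S - ?E" using AB(5) by auto
    ultimately show "\<exists>T. openin (top_of_set S) T \<and> w \<in> T \<and> T \<subseteq> S - ?E" by blast
  qed
  then have "closedin (top_of_set S) ?E" by (simp add: closedin_def)
  ultimately have "?E = {} \<or> ?E = S" using S unfolding connected_clopen by blast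
  then show ?thesis using y z by blast
qed

lemma section_glue:
  assumes "\<And>i. i \<in> I \<Longrightarrow> open (U i)" and sec: "\<And>i. i \<in> I \<Longrightarrow> section_on f (U i) (g i)"
    and agree: "\<And>i j y. i \<in> I \<Longrightarrow> j \<in> I \<Longrightarrow> y \<in> U i \<Longrightarrow> y \<in> U j \<Longrightarrow> g i y = g j y"
  obtains G where "section_on f (\<Union>i\<in>I. U i) G" "\<And>i y. i \<in> I \<Longrightarrow> y \<in> U i \<Longrightarrow> G y = g i y"
proof -
  define G where "G y = g (SOME i. i \<in> I \<and> y \<in> U i) y" for y
  have G: "G y = g i y" if "i \<in> I" "y \<in> U i" for i y
  proof -
    have "(SOME i. i \<in> I \<and> y \<in> U i) \<in> I \<and> y \<in> U (SOME i. i \<in> I \<and> y \<in> U i)"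
      by (rule someI[where P = "\<lambda>i. i \<in> I \<and> y \<in> U i"]) (use that in simp)
    then show ?thesis unfolding G_def using agree that by blast
  qed
  have "continuous_on (U i) G" if "i \<in> I" for i
    by (rule continuous_on_eq[of _ "g i"]) (use sec[OF that] G[OF that] in \<open>auto simp: section_on_def\<close>)
  then have "continuous_on (\<Union>i\<in>I. U i) G"
    using assms(1) by (intro continuous_on_open_UN) auto
  moreover have "f (G y) = y" if "y \<in> (\<Union>i\<in>I. U i)" for y
    using that G sec by (auto simp: section_on_def)
  ultimately have "section_on f (\<Union>i\<in>I. U i) G" unfolding section_on_def by blast
  then show thesis using that G by blast
qed

end

text \<open>\<open>limit\<close> is the form in which completeness is used: towards each boundary
  point of the ball the section converges along at least one sequence.\<close>

locale complete_local_homeo = local_homeo f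
  for f :: "'m::t2_space \<Rightarrow> 'b::euclidean_space" +
  assumes conn: "connected (UNIV :: 'm set)"
    and limit: "R > 0 \<Longrightarrow> section_on f (ball a R) g \<Longrightarrow> dist a y = R \<Longrightarrow>
      \<exists>\<sigma> q. (\<forall>k::nat. \<sigma> k \<in> ball a R) \<and> \<sigma> \<longlonglongrightarrow> y \<and> (\<lambda>k. g (\<sigma> k)) \<longlonglongrightarrow> q"
begin

text \<open>At a boundary point, the local inverse around the limit of the section extends it to a
  small ball. These extensions agree on overlaps, and compactness of the closed ball yields a
  uniform gain in radius.\<close>

lemma section_extend:
  assumes R: "R > 0" and g: "section_on f (ball a R) g"
  obtains R' G where "R' > R" "section_on f (ball a R') G" "\<And>y. y \<in> ball a R \<Longrightarrow> G y = g y"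
proof -
  have "\<exists>r h. r > 0 \<and> section_on f (ball y r) h \<and> (\<forall>z\<in>ball a R \<inter> ball y r. g z = h z)"
    if y: "dist a y = R" for y
  proof -
    obtain \<sigma> q where \<sigma>: "\<And>k::nat. \<sigma> k \<in> ball a R" "\<sigma> \<longlonglongrightarrow> y" "(\<lambda>k. g (\<sigma> k)) \<longlonglongrightarrow> q"
      using limit[OF R g y] by blast
    have "(\<lambda>k. f (g (\<sigma> k))) \<longlonglongrightarrow> f q"
      using continuous_on_tendsto_compose[OF cont \<sigma>(3)] by simp
    moreover have "(\<lambda>k. f (g (\<sigma> k))) = \<sigma>" using g \<sigma>(1) by (auto simp: section_on_def)
    ultimately have fq: "f q = y" using LIMSEQ_unique \<sigma>(2) by metis
    obtain W r h where W: "open W" "q \<in> W" "r > 0" and hm: "homeomorphism W (ball y r) f h"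
      using loc[of q] fq by blast
    have h: "section_on f (ball y r) h"
      using hm by (auto simp: section_on_def homeomorphism_def)
    have "\<forall>\<^sub>F k in sequentially. g (\<sigma> k) \<in> W" using topological_tendstoD[OF \<sigma>(3) W(1,2)] .
    moreover have "\<forall>\<^sub>F k in sequentially. \<sigma> k \<in> ball y r"
      using topological_tendstoD[OF \<sigma>(2) open_ball] W(3) by simp
    ultimately have "\<forall>\<^sub>F k in sequentially. g (\<sigma> k) \<in> W \<and> \<sigma> k \<in> ball y r" by eventually_elim simp
    then obtain k where k: "g (\<sigma> k) \<in> W" "\<sigma> k \<in> ball y r" unfolding eventually_sequentially by blast
    have "h (f (g (\<sigma> k))) = g (\<sigma> k)" using hm k(1) by (auto simp: homeomorphism_def)
    then have eq: "g (\<sigma> k) = h (\<sigma> k)" using g \<sigma>(1)[of k] by (auto simp: section_on_def)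
    have "g z = h z" if z: "z \<in> ball a R \<inter> ball y r" for z
    proof (rule section_unique[of "ball a R \<inter> ball y r" g h "\<sigma> k" z])
      show "connected (ball a R \<inter> ball y r)" by (intro convex_connected convex_Int convex_ball)
    qed (use g h k \<sigma>(1) eq z in \<open>auto intro: section_on_subset\<close>)
    then show ?thesis using W(3) h by blast
  qed
  then obtain r h where r: "\<And>y. dist a y = R \<Longrightarrow> r y > 0"
    and h: "\<And>y. dist a y = R \<Longrightarrow> section_on f (ball y (r y)) (h y)"
    and gh: "\<And>y z. dist a y = R \<Longrightarrow> z \<in> ball a R \<Longrightarrow> z \<in> ball y (r y) \<Longrightarrow> g z = h y z"
    by (metis IntI)
  \<comment> \<open>Two overlapping boundary balls need a common point inside the large ball, where
    both extensions equal \<open>g\<close>. The point dividing the segment in the ratio of the radii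
    lies in both balls, and strictly inside the large one as an interior point of a chord.\<close>
  have hh: "h y z = h y' z" if y: "dist a y = R" "dist a y' = R" and z: "z \<in> ball y (r y)" "z \<in> ball y' (r y')" for y y' z
  proof (cases "y = y'")
    case False
    define t where "t = r y / (r y + r y')"
    have rr: "r y > 0" "r y' > 0" using r y by auto
    have d: "dist y y' < r y + r y'" using z dist_triangle2[of y y' z] by (auto simp: dist_commute)
    define w where "w = (1 - t) *\<^sub>R y + t *\<^sub>R y'"
    have t: "0 < t" "t < 1" using rr by (auto simp: t_def)
    have "w \<in> open_segment y y'" unfolding in_segment w_def using False t by blast
    then have wR: "dist a w < R" using dist_decreases_open_segment[of w y y' a] y by auto
    have "y - w = t *\<^sub>R (y - y')" "y' - w = (1 - t) *\<^sub>R (y' - y)"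
      by (simp_all add: w_def algebra_simps)
    then have "dist y w = t * dist y y'" "dist y' w = (1 - t) * dist y y'"
      using t by (simp_all add: dist_norm norm_minus_commute)
    moreover have "t * dist y y' < t * (r y + r y')" "(1 - t) * dist y y' < (1 - t) * (r y + r y')"
      using d t by (simp_all add: mult_strict_left_mono)
    moreover have "t * (r y + r y') = r y" "(1 - t) * (r y + r y') = r y'"
      using rr by (simp_all add: t_def field_simps)
    ultimately have w: "w \<in> ball y (r y)" "w \<in> ball y' (r y')" by simp_all
    have hw: "h y w = h y' w" using gh[OF y(1) _ w(1)] gh[OF y(2) _ w(2)] wR by simp
    show ?thesis
    proof (rule section_unique[of "ball y (r y) \<inter> ball y' (r y')" "h y" "h y'" w z])
      show "connected (ball y (r y) \<inter> ball y' (r y'))" by (intro convex_connected convex_Int convex_ball)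
    qed (use section_on_subset[OF h[OF y(1)]] section_on_subset[OF h[OF y(2)]] w z hw in auto)
  qed simp
  \<comment> \<open>\<open>None\<close> stands for the original ball, \<open>Some y\<close> for the
    ball around the boundary point \<open>y\<close>.\<close>
  define U where "U i = (case i of None \<Rightarrow> ball a R | Some y \<Rightarrow> ball y (r y))" for i
  define k where "k i = (case i of None \<Rightarrow> g | Some y \<Rightarrow> h y)" for i
  define I where "I = insert None (Some ` {y. dist a y = R})"
  obtain G where G: "section_on f (\<Union>i\<in>I. U i) G" "\<And>i y. i \<in> I \<Longrightarrow> y \<in> U i \<Longrightarrow> G y = k i y"
  proof (rule section_glue[of I U k])
    show "open (U i)" for i by (cases i) (simp_all add: U_def)
    show "i \<in> I \<Longrightarrow> section_on f (U i) (k i)" for i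
      using g h by (auto simp: I_def U_def k_def)
    show "k i y = k j y" if ij: "i \<in> I" "j \<in> I" "y \<in> U i" "y \<in> U j" for i j y
    proof (cases i)
      case None
      show ?thesis
      proof (cases j)
        case None
        then show ?thesis using \<open>i = None\<close> by simp
      next
        case (Some v)
        then have "dist a v = R" "y \<in> ball a R" "y \<in> ball v (r v)"
          using ij \<open>i = None\<close> by (simp_all add: I_def U_def image_iff)
        from gh[OF this] show ?thesis using \<open>i = None\<close> Some by (simp add: k_def)
      qed
    next
      case (Some w)
      then have w: "dist a w = R" "y \<in> ball w (r w)" using ij by (simp_all add: I_def U_def image_iff)
      show ?thesis
      proof (cases j)
        case None
        then have "y \<in> ball a R" using ij by (simp add: U_def)
        from gh[OF w(1) this w(2)] show ?thesis using \<open>i = Some w\<close> None by (simp add: k_def)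
      next
        case (Some v)
        then have "dist a v = R" "y \<in> ball v (r v)" using ij by (simp_all add: I_def U_def image_iff)
        from hh[OF w(1) this(1) w(2) this(2)] show ?thesis using \<open>i = Some w\<close> Some by (simp add: k_def)
      qed
    qed
  qed auto
  have op: "open (\<Union>i\<in>I. U i)"
    by (intro open_UN ballI) (auto simp: U_def split: option.split)
  have sub: "cball a R \<subseteq> (\<Union>i\<in>I. U i)"
  proof
    fix z assume "z \<in> cball a R"
    then consider "z \<in> ball a R" | "dist a z = R" by fastforce
    then show "z \<in> (\<Union>i\<in>I. U i)"
    proof cases
      case 1
      then have "z \<in> U None" by (simp add: U_def)
      then show ?thesis by (auto simp: I_def)
    next
      case 2
      then have "z \<in> U (Some z)" using r by (simp add: U_def)
      then show ?thesis using 2 by (auto simp: I_def)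
    qed
  qed
  obtain e where e: "e > 0" "(\<Union>x\<in>cball a R. ball x e) \<subseteq> (\<Union>i\<in>I. U i)"
    using compact_subset_open_imp_ball_epsilon_subset[OF compact_cball op sub] by metis
  have "ball a (R + e) \<subseteq> (\<Union>x\<in>cball a R. ball x e)"
  proof
    fix z assume z: "z \<in> ball a (R + e)"
    show "z \<in> (\<Union>x\<in>cball a R. ball x e)"
    proof (cases "z \<in> cball a R")
      case True
      then show ?thesis using e(1) by force
    next
      case False
      \<comment> \<open>The radial projection of \<open>z\<close> to the sphere has distance
        \<open>norm (z - a) - R\<close> from \<open>z\<close>, which is less than
        \<open>e\<close>.\<close>
      define s where "s = R / norm (z - a)"
      have n: "norm (z - a) > R" using False by (simp add: dist_norm norm_minus_commute)
      have n0: "norm (z - a) > 0" using n R by linarith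
      have s: "0 < s" "s < 1" using n R divide_less_eq_1_pos[OF n0, of R] divide_pos_pos[OF R n0]
        by (simp_all only: s_def)
      have sn: "s * norm (z - a) = R" using n0 by (simp add: s_def)
      define w where "w = a + s *\<^sub>R (z - a)"
      have "dist a w = R" using sn s(1) by (simp add: w_def dist_norm)
      moreover have "w - z = - ((1 - s) *\<^sub>R (z - a))" by (simp add: w_def algebra_simps)
      then have "dist w z = (1 - s) * norm (z - a)" using s by (simp add: dist_norm)
      then have "dist w z = norm (z - a) - R" using sn by (simp add: left_diff_distrib)
      then have "dist w z < e" using z by (simp add: dist_norm norm_minus_commute)
      ultimately show ?thesis by force
    qed
  qed
  then have "section_on f (ball a (R + e)) G"
    by (rule section_on_subset[OF G(1) order_trans[OF _ e(2)]])
  moreover have "G y = g y" if "y \<in> ball a R" for y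
    using G(2)[of None y] that by (simp add: I_def U_def k_def)
  ultimately show thesis using that[of "R + e" G] e(1) by simp
qed

text \<open>If the admissible radii were bounded, the sections through \<open>p\<close> would glue
  to one on the ball of the supremal radius, which \<open>section_extend\<close> enlarges.\<close>

lemma global_section: "\<exists>G. section_on f UNIV G \<and> G (f p) = p"
proof -
  let ?B = "\<lambda>R. ball (f p) R"
  define I where "I = {R. R > 0 \<and> (\<exists>g. section_on f (?B R) g \<and> g (f p) = p)}"
  have "\<forall>R\<in>I. \<exists>g. section_on f (?B R) g \<and> g (f p) = p" by (simp add: I_def)
  from bchoice[OF this] obtain g
    where g: "\<And>R. R \<in> I \<Longrightarrow> section_on f (?B R) (g R)" "\<And>R. R \<in> I \<Longrightarrow> g R (f p) = p"
    by blast
  have pos: "R > 0" if "R \<in> I" for R using that by (simp add: I_def)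
  have agree: "g R y = g R' y" if "R \<in> I" "R' \<in> I" "y \<in> ?B R" "y \<in> ?B R'" for R R' y
    by (rule section_unique[of "?B R \<inter> ?B R'" "g R" "g R'" "f p" y])
      (use that g pos in \<open>auto intro: section_on_subset convex_connected convex_Int\<close>)
  obtain G where G: "section_on f (\<Union>R\<in>I. ?B R) G" "\<And>R y. R \<in> I \<Longrightarrow> y \<in> ?B R \<Longrightarrow> G y = g R y"
    using section_glue[of I ?B g] g(1) agree by (metis open_ball)
  obtain W r h where W: "p \<in> W" "r > 0" "homeomorphism W (?B r) f h" using loc[of p] by blast
  then have rI: "r \<in> I" unfolding I_def by (auto simp: section_on_def homeomorphism_def)
  then have Gp: "G (f p) = p" using G(2)[OF rI] g(2) W(2) by simp
  have "\<not> bdd_above I"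
  proof
    assume bdd: "bdd_above I"
    have S: "Sup I > 0" using cSup_upper[OF rI bdd] W(2) by linarith
    have "?B (Sup I) \<subseteq> (\<Union>R\<in>I. ?B R)"
    proof
      fix z assume "z \<in> ?B (Sup I)"
      then have "dist (f p) z < Sup I" by simp
      then obtain R where "R \<in> I" "dist (f p) z < R" using less_cSup_iff[of I] rI bdd by blast
      then show "z \<in> (\<Union>R\<in>I. ?B R)" by auto
    qed
    then have "section_on f (?B (Sup I)) G" by (rule section_on_subset[OF G(1)])
    then obtain R' G' where R': "R' > Sup I" "section_on f (?B R') G'" "\<And>y. y \<in> ?B (Sup I) \<Longrightarrow> G' y = G y"
      using section_extend[OF S] by metis
    have "R' > 0" using S R'(1) by linarith
    moreover have "G' (f p) = p" using R'(3)[of "f p"] S Gp by simp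
    ultimately have "R' \<in> I" unfolding I_def using R'(2) by blast
    from cSup_upper[OF this bdd] show False using R'(1) by linarith
  qed
  then have "(\<Union>R\<in>I. ?B R) = UNIV"
    unfolding bdd_above_def by (force simp: not_le)
  then have "section_on f UNIV G" using G(1) by simp
  then show ?thesis using Gp by blast
qed

text \<open>The points that a global section reproduces form an open and closed set: closed by the
  Hausdorff property, open by local injectivity. Connectedness makes the section an inverse on both
  sides.\<close>

lemma homeomorphism_UNIV: "\<exists>G. homeomorphism UNIV UNIV f G"
proof -
  obtain p :: 'm where True by simp
  obtain G where sec: "section_on f UNIV G" and Gp: "G (f p) = p" using global_section[of p] by blast
  have cG: "continuous_on UNIV G" and fG: "\<And>y. f (G y) = y" using sec by (auto simp: section_on_def)
  let ?E = "{q. G (f q) = q}"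
  have c: "continuous_on UNIV (\<lambda>q. G (f q))" by (rule continuous_on_compose2[OF cG cont]) simp
  have "closed ?E" by (rule closed_Collect_eq[OF c continuous_on_id])
  moreover have "open ?E"
  proof (subst open_subopen, intro ballI)
    fix q assume q: "q \<in> ?E"
    obtain W where W: "open W" "q \<in> W" "inj_on f W" using inj_nbhd[of q] by blast
    let ?T = "W \<inter> (\<lambda>q. G (f q)) -` W"
    have "open ?T" using W(1) c by (intro open_Int open_vimage) auto
    moreover have "q \<in> ?T" using q W(2) by simp
    moreover have "?T \<subseteq> ?E"
    proof
      fix v assume v: "v \<in> ?T"
      have "f (G (f v)) = f v" by (rule fG)
      then have "G (f v) = v" using W(3) v by (auto simp: inj_on_def)
      then show "v \<in> ?E" by simp
    qed
    ultimately show "\<exists>T. open T \<and> q \<in> T \<and> T \<subseteq> ?E" by blast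
  qed
  ultimately have "?E = {} \<or> ?E = UNIV" using conn clopen unfolding connected_clopen by auto
  then have "G (f q) = q" for q using Gp by blast
  then have "homeomorphism UNIV UNIV f G"
    using cont cG fG by (intro homeomorphismI) auto
  then show ?thesis by (intro exI[of _ G])
qed

end

section \<open>Complete space-like hypersurfaces are entire graphs\<close>

context spacelike
begin

definition proj :: "'m \<Rightarrow> real ^ 'n" where "proj p = fst (x p)"

lemma continuous_x: "continuous_on UNIV x" and continuous_N: "continuous_on UNIV N"
  by (rule smooth_map_continuous[OF atlas smooth_x], rule smooth_map_continuous[OF atlas smooth_N])

lemma continuous_proj: "continuous_on UNIV proj"
  unfolding proj_def[abs_def] by (intro continuous_intros continuous_x)

text \<open>The inverse function theorem for the projection, read in a chart. The last clause makes
  lifts of straight lines regular, so that their lengths can be estimated.\<close>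

lemma local_inverse:
  assumes U: "open U" "p \<in> U"
  obtains W r g where "open W" "p \<in> W" "W \<subseteq> U" "r > 0" "homeomorphism W (ball (proj p) r) proj g"
    "\<And>a v t. a + t *\<^sub>R v \<in> ball (proj p) r \<Longrightarrow> regular_at \<A> (\<lambda>t. g (a + t *\<^sub>R v)) t"
proof -
  define c where "c = param_at \<A> p"
  have c: "c \<in> \<A>" "p \<in> param_range c" using param_at[OF atlas] by (simp_all add: c_def)
  define u0 where "u0 = coords c p"
  have u0: "u0 \<in> fst c" "snd c u0 = p" using atlasD(7,8)[OF atlas c] by (simp_all add: u0_def)
  interpret iso: isometry_chart \<A> x N c "\<lambda>X. X"
    by (rule isometry_chart.intro[OF spacelike_axioms])
      (simp add: isometry_chart_axioms_def c(1) bounded_linear_ident)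
  define D where "D = fst c \<inter> snd c -` U"
  have D: "open D" unfolding D_def
    by (rule continuous_open_preimage[OF atlasD(4)[OF atlas c(1)] iso.open_c U(1)])
  have u0D: "u0 \<in> D" using u0 U(2) by (simp add: D_def)
  have DD: "u \<in> D \<Longrightarrow> u \<in> fst c" for u by (simp add: D_def)
  define Y where "Y = (\<lambda>u. fst (iso.X u))"
  have Y: "Y u = proj (snd c u)" for u by (simp add: Y_def iso.X_def proj_def)
  define f' where "f' u = Blinfun (\<lambda>v. fst (iso.dX u v))" for u
  have bl: "bounded_linear (\<lambda>v. fst (iso.dX u v))" if "u \<in> D" for u
    using iso.linear_dY[OF DD[OF that]] by (simp add: linear_linear)
  have f': "blinfun_apply (f' u) = (\<lambda>v. fst (iso.dX u v))" if "u \<in> D" for u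
    unfolding f'_def by (rule bounded_linear_Blinfun_apply[OF bl[OF that]])
  have der: "(Y has_derivative blinfun_apply (f' u)) (at u)" if "u \<in> D" for u
    unfolding f'[OF that] Y_def by (rule bounded_linear.has_derivative[OF bounded_linear_fst iso.has_dX[OF DD[OF that]]])
  have cf: "continuous_on D f'"
  proof (rule continuous_on_blinfun_componentwise)
    fix i :: "real ^ 'n"
    have "continuous_on (fst c) (\<lambda>u. fst (iso.dX u i))"
      unfolding iso.dX_def
      by (intro smooth_on_continuous smooth_on_fst iso.open_c smooth_on_directional iso.smooth_X)
    then have "continuous_on D (\<lambda>u. fst (iso.dX u i))" by (rule continuous_on_subset) (simp add: D_def)
    then show "continuous_on D (\<lambda>u. blinfun_apply (f' u) i)"
      by (rule continuous_on_eq) (simp add: f')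
  qed
  obtain L where L: "linear L" "L \<circ> (\<lambda>v. fst (iso.dX u0 v)) = id"
    using linear_injective_left_inverse[OF iso.linear_dY[OF u0(1)] iso.inj_dY[OF u0(1)]] by blast
  have "bounded_linear L" using L(1) by (simp add: linear_linear)
  then have inv: "Blinfun L o\<^sub>L f' u0 = id_blinfun"
    by (intro blinfun_eqI) (use L(2) in \<open>simp add: bounded_linear_Blinfun_apply f'[OF u0D] fun_eq_iff\<close>)
  obtain U' V' \<psi> \<psi>' where U': "open U'" "U' \<subseteq> D" "u0 \<in> U'" and V': "open V'" "Y u0 \<in> V'"
    and hm: "homeomorphism U' V' Y \<psi>"
    and d\<psi>: "\<And>y. y \<in> V' \<Longrightarrow> (\<psi> has_derivative \<psi>' y) (at y)"
    and \<psi>': "\<And>y. y \<in> V' \<Longrightarrow> \<psi>' y = Hilbert_Choice.inv (blinfun_apply (f' (\<psi> y)))"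
    and bij: "\<And>y. y \<in> V' \<Longrightarrow> bij (blinfun_apply (f' (\<psi> y)))"
    using inverse_function_theorem[OF D der cf u0D inv] by metis
  have hm1: "\<And>u. u \<in> U' \<Longrightarrow> \<psi> (Y u) = u" "\<And>y. y \<in> V' \<Longrightarrow> Y (\<psi> y) = y" "\<And>y. y \<in> V' \<Longrightarrow> \<psi> y \<in> U'"
    "continuous_on U' Y" "continuous_on V' \<psi>" "\<And>u. u \<in> U' \<Longrightarrow> Y u \<in> V'"
    using hm by (auto simp: homeomorphism_def)
  obtain r where r: "r > 0" "ball (proj p) r \<subseteq> V'" using V' openE Y u0(2) by metis
  let ?B = "ball (proj p) r"
  have Bim: "\<psi> ` ?B = U' \<inter> Y -` ?B"
  proof
    show "\<psi> ` ?B \<subseteq> U' \<inter> Y -` ?B"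
    proof (rule image_subsetI)
      fix y assume "y \<in> ?B"
      then show "\<psi> y \<in> U' \<inter> Y -` ?B" using r(2) hm1(2,3)[of y] by auto
    qed
    show "U' \<inter> Y -` ?B \<subseteq> \<psi> ` ?B"
    proof
      fix u assume "u \<in> U' \<inter> Y -` ?B"
      then show "u \<in> \<psi> ` ?B" using hm1(1)[of u] by (intro image_eqI[of _ _ "Y u"]) auto
    qed
  qed
  have oB: "open (\<psi> ` ?B)" unfolding Bim by (rule continuous_open_preimage[OF hm1(4) U'(1) open_ball])
  have sB: "\<psi> ` ?B \<subseteq> fst c" using Bim U'(2) DD by auto
  define W where "W = snd c ` (\<psi> ` ?B)"
  define g where "g y = snd c (\<psi> y)" for y
  have \<psi>c: "\<psi> y \<in> fst c" if "y \<in> ?B" for y using sB that by blast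
  have pg: "proj (g y) = y" if "y \<in> ?B" for y using hm1(2)[of y] r(2) that by (auto simp: g_def Y)
  have gp: "g (proj q) = q" if q: "q \<in> W" for q
  proof -
    obtain y where "y \<in> ?B" "q = g y" using q by (auto simp: W_def g_def)
    then show ?thesis using pg by simp
  qed
  show thesis
  proof (rule that[of W r g])
    show "open W" unfolding W_def by (rule chart_image_open[OF atlas c(1) oB sB])
    have "\<psi> (Y u0) = u0" using hm1(1) U'(3) by blast
    then show "p \<in> W" unfolding W_def using u0(2) Y r(1) by (metis centre_in_ball imageI)
    show "W \<subseteq> U" unfolding W_def Bim using U'(2) by (auto simp: D_def)
    show "r > 0" by (rule r(1))
    show "homeomorphism W ?B proj g"
    proof (rule homeomorphismI)
      show "continuous_on W proj" by (rule continuous_on_subset[OF continuous_proj]) simp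
      show "continuous_on ?B g" unfolding g_def
        by (rule continuous_on_compose2[OF atlasD(4)[OF atlas c(1)] continuous_on_subset[OF hm1(5) r(2)] sB])
      show "proj ` W \<subseteq> ?B" using pg by (auto simp: W_def g_def[symmetric])
      show "g ` ?B \<subseteq> W" by (auto simp: W_def g_def)
    qed (use pg gp in auto)
    fix a v t assume t: "a + t *\<^sub>R v \<in> ?B"
    let ?J = "(\<lambda>t. a + t *\<^sub>R v) -` ?B"
    have oJ: "open ?J" by (rule open_vimage[OF open_ball]) (intro continuous_intros)
    \<comment> \<open>The velocity of the lifted line in terms of the coordinate fields. Its
      continuity follows from their smoothness, without a study of \<open>\<psi>'\<close>.\<close>
    define w where "w s = (\<Sum>i\<in>UNIV. v $ i *\<^sub>R iso.V i (\<psi> (a + s *\<^sub>R v)))" for s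
    have c\<psi>: "continuous_on ?J (\<lambda>s. \<psi> (a + s *\<^sub>R v))"
      by (rule continuous_on_compose2[OF continuous_on_subset[OF hm1(5) r(2)]]) (auto intro!: continuous_intros)
    have "((\<lambda>s. \<psi> (a + s *\<^sub>R v)) has_vector_derivative w s) (at s)" if s: "s \<in> ?J" for s
    proof -
      let ?y = "a + s *\<^sub>R v"
      have y: "?y \<in> ?B" "?y \<in> V'" using s r(2) by auto
      have yD: "\<psi> ?y \<in> D" using hm1(3)[OF y(2)] U'(2) by blast
      have "((\<lambda>s. a + s *\<^sub>R v) has_vector_derivative v) (at s)" by (auto intro!: derivative_eq_intros)
      from has_vector_derivative_linear_chain[OF this d\<psi>[OF y(2)]]
      have "((\<lambda>s. \<psi> (a + s *\<^sub>R v)) has_vector_derivative \<psi>' ?y v) (at s)" by (simp add: o_def)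
      moreover have "blinfun_apply (f' (\<psi> ?y)) (w s) = v"
      proof -
        have "blinfun_apply (f' (\<psi> ?y)) (w s) = (\<Sum>i\<in>UNIV. v $ i *\<^sub>R axis i 1)"
          unfolding f'[OF yD] w_def
          by (simp add: linear_sum[OF iso.linear_dY[OF DD[OF yD]]] linear_cmul[OF iso.linear_dY[OF DD[OF yD]]] iso.dY_V[OF DD[OF yD]])
        then show ?thesis by (simp add: vec_eq_iff axis_def if_distrib cong: if_cong)
      qed
      then have "w s = \<psi>' ?y v" unfolding \<psi>'[OF y(2)] using bij[OF y(2)] by (metis bij_is_inj inv_f_f)
      ultimately show ?thesis by simp
    qed
    moreover have "continuous_on ?J w" unfolding w_def
      by (intro continuous_intros continuous_on_compose2[OF smooth_on_continuous[OF iso.smooth_V] c\<psi>]) (use \<psi>c in auto)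
    ultimately have "(\<lambda>s. \<psi> (a + s *\<^sub>R v)) C1_differentiable_on ?J"
      unfolding C1_differentiable_on_def by (intro exI[of _ w] conjI ballI)
    then show "regular_at \<A> (\<lambda>t. g (a + t *\<^sub>R v)) t"
      by (intro segment_regular[OF c(1) oJ]) (use \<psi>c t in \<open>auto simp: g_def\<close>)
  qed
qed

lemma regular_tangent:
  assumes "regular_at \<A> \<gamma> t"
  shows "((x \<circ> \<gamma>) has_vector_derivative tangent \<gamma> t) (at t)"
  unfolding tangent_def using regular_atE[OF assms] by metis

text \<open>Orthogonality to \<open>N\<close> and Cauchy-Schwarz bound the last component of a
  tangent vector by its first. The stretching of the projection is thereby controlled by the normal,
  hence locally bounded.\<close>

lemma norm_fst_tangent:
  "norm (fst (differential \<A> x p v)) \<le> \<bar>snd (N p)\<bar> * sqrt (lorentz (differential \<A> x p v) (differential \<A> x p v))"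
proof -
  define X where "X = differential \<A> x p v"
  define a where "a = fst X \<bullet> fst X"
  have "fst (N p) \<bullet> fst X = snd (N p) * snd X" using N_orth[of p v] by (simp add: lorentz_def X_def)
  then have "(snd (N p) * snd X)\<^sup>2 \<le> (fst (N p) \<bullet> fst (N p)) * a"
    using Cauchy_Schwarz_ineq[of "fst (N p)" "fst X"] by (simp add: a_def)
  also have "fst (N p) \<bullet> fst (N p) = (snd (N p))\<^sup>2 - 1"
    using N_unit[of p] by (simp add: lorentz_def power2_eq_square)
  finally have "a \<le> (snd (N p))\<^sup>2 * lorentz X X"
    by (simp add: lorentz_def a_def power2_eq_square algebra_simps)
  then have "sqrt a \<le> sqrt ((snd (N p))\<^sup>2 * lorentz X X)" by simp
  then show ?thesis by (simp add: X_def a_def norm_eq_sqrt_inner real_sqrt_mult)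
qed

text \<open>The normal is bounded only up to time \<open>s\<close>, since later the curve may reach
  regions where the projection stretches more.\<close>

lemma proj_length_le:
  assumes \<gamma>: "piecewise_C1_curve \<A> \<gamma>" and s: "0 \<le> s" "s \<le> 1"
    and C: "\<And>t. t \<in> {0..s} \<Longrightarrow> \<bar>snd (N (\<gamma> t))\<bar> \<le> C"
  shows "norm (proj (\<gamma> s) - proj (\<gamma> 0)) \<le> C * curve_length \<A> x \<gamma>"
proof -
  obtain T where T: "finite T" "\<And>t. 0 < t \<Longrightarrow> t < 1 \<Longrightarrow> t \<notin> T \<Longrightarrow> regular_at \<A> \<gamma> t"
    and c\<gamma>: "continuous_on {0..1} \<gamma>" and int: "speed \<gamma> integrable_on {0..1}"
    using piecewise_regular[OF \<gamma>] by metis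
  have sub: "{0..s} \<subseteq> {0..1}" using s by auto
  have ints: "speed \<gamma> integrable_on {0..s}" by (rule integrable_on_subinterval[OF int sub])
  have C0: "C \<ge> 0" using C[of 0] s by (simp add: order_trans[OF abs_ge_zero])
  have "((\<lambda>t. fst (tangent \<gamma> t)) has_integral proj (\<gamma> s) - proj (\<gamma> 0)) {0..s}"
  proof (rule fundamental_theorem_of_calculus_interior_strong[OF T(1) s(1)])
    show "continuous_on {0..s} (\<lambda>t. proj (\<gamma> t))"
      by (rule continuous_on_compose2[OF continuous_proj continuous_on_subset[OF c\<gamma> sub]]) simp
    fix t assume t: "t \<in> {0<..<s} - T"
    then have "regular_at \<A> \<gamma> t" using T(2) s by auto
    then have "((x \<circ> \<gamma>) has_vector_derivative tangent \<gamma> t) (at t)"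
      by (rule regular_tangent)
    then show "((\<lambda>t. proj (\<gamma> t)) has_vector_derivative fst (tangent \<gamma> t)) (at t)"
      using bounded_linear.has_vector_derivative[OF bounded_linear_fst] by (fastforce simp: proj_def o_def)
  qed
  note I = this
  have "norm (integral {0..s} (\<lambda>t. fst (tangent \<gamma> t))) \<le> integral {0..s} (\<lambda>t. C * speed \<gamma> t)"
  proof (rule integral_norm_bound_integral)
    show "(\<lambda>t. fst (tangent \<gamma> t)) integrable_on {0..s}" using I by blast
    show "(\<lambda>t. C * speed \<gamma> t) integrable_on {0..s}" by (rule integrable_on_mult_right[OF ints])
    fix t assume t: "t \<in> {0..s}"
    have "norm (fst (tangent \<gamma> t)) \<le> \<bar>snd (N (\<gamma> t))\<bar> * speed \<gamma> t"
      unfolding tangent_def speed_def by (rule norm_fst_tangent)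
    also have "\<dots> \<le> C * speed \<gamma> t" by (rule mult_right_mono[OF C[OF t] speed_nonneg])
    finally show "norm (fst (tangent \<gamma> t)) \<le> C * speed \<gamma> t" .
  qed
  also have "\<dots> = C * integral {0..s} (speed \<gamma>)" by simp
  also have "\<dots> \<le> C * integral {0..1} (speed \<gamma>)"
    by (intro mult_left_mono C0 integral_subset_le[OF sub ints int]) (simp add: speed_nonneg)
  finally show ?thesis unfolding integral_unique[OF I] curve_length_speed .
qed

text \<open>Until it leaves a small neighbourhood the curve stays where the normal is bounded by
  \<open>C\<close>, and meanwhile its projection moves at least by r / 2. This costs length at least
  r / (2 C).\<close>

lemma length_lower_bound:
  assumes U: "open U" "p \<in> U"
  obtains \<delta> where "\<delta> > 0" "\<And>\<gamma> q. curve_between p q \<gamma> \<Longrightarrow> q \<notin> U \<Longrightarrow> \<delta> \<le> curve_length \<A> x \<gamma>"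
proof -
  define C where "C = \<bar>snd (N p)\<bar> + 1"
  define U1 where "U1 = U \<inter> {q. \<bar>snd (N q)\<bar> < C}"
  have "open {q. \<bar>snd (N q)\<bar> < C}"
    by (intro open_Collect_less continuous_intros continuous_N)
  then have "open U1" unfolding U1_def using U(1) by blast
  moreover have "p \<in> U1" using U(2) by (simp add: U1_def C_def)
  ultimately obtain W r g where W: "open W" "p \<in> W" "W \<subseteq> U1" "r > 0" "homeomorphism W (ball (proj p) r) proj g"
    using local_inverse[of U1 p] by metis
  have gW: "\<And>y. y \<in> ball (proj p) r \<Longrightarrow> g y \<in> W" "\<And>y. y \<in> ball (proj p) r \<Longrightarrow> proj (g y) = y"
    "\<And>q. q \<in> W \<Longrightarrow> g (proj q) = q" "continuous_on (ball (proj p) r) g"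
    using W(5) by (auto simp: homeomorphism_def)
  \<comment> \<open>The half radius makes \<open>K\<close> compact and thus closed, so the curve is
    still inside \<open>W\<close> at its exit from \<open>V\<close>.\<close>
  define K where "K = g ` cball (proj p) (r / 2)"
  define V where "V = W \<inter> proj -` ball (proj p) (r / 2)"
  have "compact K" unfolding K_def
    by (rule compact_continuous_image[OF continuous_on_subset[OF gW(4)] compact_cball]) (use W(4) in auto)
  then have clK: "closed K" by (rule compact_imp_closed)
  have KW: "K \<subseteq> W" unfolding K_def using gW(1) W(4) by (force simp: cball_subset_ball_iff)
  have oV: "open V" unfolding V_def using W(1) continuous_proj by (intro open_Int open_vimage) auto
  have VK: "V \<subseteq> K"
  proof
    fix q assume "q \<in> V"
    then have "q = g (proj q)" "proj q \<in> cball (proj p) (r / 2)" using gW(3) by (auto simp: V_def)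
    then show "q \<in> K" unfolding K_def by blast
  qed
  have pV: "p \<in> V" using W(2,4) by (simp add: V_def)
  have C1: "C > 0" by (simp add: C_def add_nonneg_pos)
  show thesis
  proof (rule that[of "r / 2 / C"])
    show "r / 2 / C > 0" using W(4) C1 by simp
    fix \<gamma> q assume \<gamma>: "curve_between p q \<gamma>" and q: "q \<notin> U"
    have c\<gamma>: "continuous_on {0..1} \<gamma>" using piecewise_regular \<gamma> by metis
    define Z where "Z = {0..1} \<inter> \<gamma> -` (- V)"
    have "closed Z" unfolding Z_def
      using continuous_closed_preimage[OF c\<gamma> closed_atLeastAtMost] oV by (simp add: closed_Compl)
    moreover have "q \<notin> V" using q W(3) by (auto simp: V_def U1_def)
    then have "1 \<in> Z" using \<gamma> by (simp add: Z_def)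
    then have Zne: "Z \<noteq> {}" by blast
    moreover have bZ: "bdd_below Z" by (rule bdd_belowI[of _ 0]) (simp add: Z_def)
    ultimately have sZ: "Inf Z \<in> Z" by (intro closed_contains_Inf)
    \<comment> \<open>The first exit time from \<open>V\<close>, attained because \<open>Z\<close>
      is closed. Up to and including \<open>s\<close> the curve lies in \<open>K\<close>, and at
      \<open>s\<close> its projection is at distance at least r / 2 from the start.\<close>
    define s where "s = Inf Z"
    have s: "0 \<le> s" "s \<le> 1" "\<gamma> s \<notin> V" using sZ by (auto simp: s_def Z_def)
    have before: "\<gamma> t \<in> V" if "0 \<le> t" "t < s" for t
    proof (rule ccontr)
      assume "\<gamma> t \<notin> V"
      then have "t \<in> Z" using that s(2) by (simp add: Z_def)
      then show False using cInf_lower[OF _ bZ] that(2) by (force simp: s_def)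
    qed
    have "s > 0" using s(1,3) pV \<gamma> by (cases "s = 0") auto
    have cl: "closure {0..<s} = {0..s}" using \<open>s > 0\<close> by (simp add: closure_atLeastLessThan)
    have "\<gamma> ` closure {0..<s} \<subseteq> closure (\<gamma> ` {0..<s})"
    proof (rule image_closure_subset[OF _ closed_closure closure_subset])
      show "continuous_on (closure {0..<s}) \<gamma>"
        unfolding cl by (rule continuous_on_subset[OF c\<gamma>]) (use s in auto)
    qed
    moreover have "closure (\<gamma> ` {0..<s}) \<subseteq> K"
      by (rule closure_minimal[OF _ clK]) (use before VK in auto)
    ultimately have inK: "\<gamma> t \<in> K" if "t \<in> {0..s}" for t
      using that unfolding cl by blast
    have "dist (proj p) (proj (\<gamma> s)) \<ge> r / 2"
      using s(3) inK[of s] KW s(1) by (auto simp: V_def)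
    then have "r / 2 \<le> norm (proj (\<gamma> s) - proj (\<gamma> 0))" using \<gamma> by (simp add: dist_norm norm_minus_commute)
    also have "\<dots> \<le> C * curve_length \<A> x \<gamma>"
      by (rule proj_length_le) (use \<gamma> s inK KW W(3) in \<open>force simp: U1_def\<close>)+
    finally show "r / 2 / C \<le> curve_length \<A> x \<gamma>" using C1 by (simp only: pos_divide_le_eq mult.commute)
  qed
qed

section \<open>The Riemannian distance and completeness\<close>

abbreviation rdist where "rdist \<equiv> riemannian_dist \<A> x"

lemma rdist_le: "curve_between p q \<gamma> \<Longrightarrow> rdist p q \<le> curve_length \<A> x \<gamma>"
  unfolding riemannian_dist_def
  by (rule cInf_lower) (auto intro!: bdd_belowI[of _ 0] simp: curve_length_nonneg)

lemma rdist_ge: "(\<And>\<gamma>. curve_between p q \<gamma> \<Longrightarrow> k \<le> curve_length \<A> x \<gamma>) \<Longrightarrow> k \<le> rdist p q"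
  unfolding riemannian_dist_def using curve_exists[of p q] by (intro cInf_greatest) auto

lemma rdist_nbhd:
  assumes "open U" "p \<in> U"
  shows "\<exists>\<delta>>0. \<forall>q. rdist p q < \<delta> \<longrightarrow> q \<in> U"
proof -
  obtain \<delta> where \<delta>: "\<delta> > 0" "\<And>\<gamma> q. curve_between p q \<gamma> \<Longrightarrow> q \<notin> U \<Longrightarrow> \<delta> \<le> curve_length \<A> x \<gamma>"
    using length_lower_bound[OF assms] by metis
  have "q \<in> U" if "rdist p q < \<delta>" for q
    using rdist_ge[of p q \<delta>] \<delta>(2)[of _ q] that by fastforce
  then show ?thesis using \<delta>(1) by blast
qed

lemma rdist_refl: "rdist p p = 0"
proof -
  have reg: "regular_at \<A> (\<lambda>t. p) t" for t
  proof -
    have "(coords (param_at \<A> p) \<circ> (\<lambda>t. p)) C1_differentiable_on UNIV" by (simp add: o_def)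
    then show ?thesis unfolding regular_at_def using param_at[OF atlas, of p] by (metis UNIV_I image_constant_conv empty_subsetI insert_subset open_UNIV subset_refl)
  qed
  then have cv: "curve_between p p (\<lambda>t. p)" by (simp add: C1_piecewise C1_curve_on_regular)
  have "tangent (\<lambda>t. p) t = 0" for t
    unfolding tangent_def velocity_def
    by (simp add: o_def linear_0[OF linear_differential[OF smooth_x]])
  then have "speed (\<lambda>t. p) = (\<lambda>t. 0)" by (simp add: speed_def fun_eq_iff lorentz_0_left)
  then have "curve_length \<A> x (\<lambda>t. p) = 0" by (simp add: curve_length_speed)
  then show ?thesis using rdist_le[OF cv] rdist_ge[of p p 0] curve_length_nonneg by force
qed

text \<open>Symmetry and the triangle inequality come from reversing and joining curves.
  Definiteness is where the topology enters: distance zero puts a point into every neighbourhood of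
  the other.\<close>

lemma Metric_space_rdist: "Metric_space UNIV rdist"
proof
  show nonneg: "0 \<le> rdist p q" for p q by (rule rdist_ge) (rule curve_length_nonneg)
  have le: "rdist q p \<le> rdist p q" for p q
    by (rule rdist_ge) (use reverse_curve rdist_le in metis)
  then show "rdist p q = rdist q p" for p q by (simp add: order_antisym)
  show "rdist p q = 0 \<longleftrightarrow> p = q" for p q
  proof
    assume 0: "rdist p q = 0"
    show "p = q"
    proof (rule ccontr)
      assume "p \<noteq> q"
      then obtain U where "open U" "p \<in> U" "q \<notin> U" using t2_space_class.hausdorff[of p q] by blast
      then show False using rdist_nbhd[of U p] 0 by auto
    qed
  qed (simp add: rdist_refl)
  show "rdist p r \<le> rdist p q + rdist q r" for p q r
  proof -
    have "rdist p r \<le> curve_length \<A> x \<gamma> + curve_length \<A> x \<delta>" if "curve_between p q \<gamma>" "curve_between q r \<delta>" for \<gamma> \<delta>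
      using rdist_le[OF join_curve(1)[OF that]] join_curve(2)[OF that] by simp
    then have "rdist p r - curve_length \<A> x \<delta> \<le> rdist p q" if "curve_between q r \<delta>" for \<delta>
      by (intro rdist_ge) (use that in force)
    then have "rdist p r - rdist p q \<le> rdist q r" by (intro rdist_ge) force
    then show ?thesis by simp
  qed
qed

text \<open>Here the signature helps: the lift of a segment has tangents with first component
  \<open>v - u\<close>, and the last component only lowers their Lorentz square.\<close>

lemma section_dist_le:
  assumes g: "section_on proj (ball a R) g" and uv: "u \<in> ball a R" "v \<in> ball a R"
  shows "rdist (g u) (g v) \<le> dist u v"
proof -
  let ?l = "\<lambda>t. u + t *\<^sub>R (v - u)"
  let ?\<gamma> = "\<lambda>t. g (?l t)"
  have cg: "continuous_on (ball a R) g" and pg: "\<And>y. y \<in> ball a R \<Longrightarrow> proj (g y) = y"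
    using g by (auto simp: section_on_def)
  have line: "?l t \<in> ball a R" if "t \<in> {0..1}" for t
  proof -
    have "?l t = (1 - t) *\<^sub>R u + t *\<^sub>R v" by (simp add: algebra_simps)
    then show ?thesis using convexD[OF convex_ball uv, of "1 - t" t] that by simp
  qed
  have reg: "regular_at \<A> ?\<gamma> t" if t: "t \<in> {0..1}" for t
  proof -
    let ?y = "?l t"
    obtain W r h where W: "open W" "g ?y \<in> W" "r > 0" "homeomorphism W (ball (proj (g ?y)) r) proj h"
      and hr: "\<And>a v t. a + t *\<^sub>R v \<in> ball (proj (g ?y)) r \<Longrightarrow> regular_at \<A> (\<lambda>t. h (a + t *\<^sub>R v)) t"
      using local_inverse[OF open_UNIV UNIV_I, of "g ?y"] by metis
    have y: "proj (g ?y) = ?y" by (rule pg[OF line[OF t]])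
    define S where "S = ball a R \<inter> g -` W"
    have S: "open S" unfolding S_def by (rule continuous_open_preimage[OF cg open_ball W(1)])
    have eq: "g z = h z" if "z \<in> S" for z
      using that pg[of z] W(4) by (auto simp: S_def homeomorphism_def)
    show ?thesis
    proof (rule regular_at_cong[of _ "\<lambda>t. h (?l t)" t "?l -` S"])
      show "regular_at \<A> (\<lambda>t. h (?l t)) t" by (rule hr) (simp add: y W(3))
      show "open (?l -` S)" by (rule open_vimage[OF S]) (intro continuous_intros)
      show "t \<in> ?l -` S" using line[OF t] W(2) by (simp add: S_def)
    qed (use eq in auto)
  qed
  have cv: "curve_between (g u) (g v) ?\<gamma>"
    using reg by (simp add: C1_piecewise C1_curve_on_regular)
  have sp: "speed ?\<gamma> t \<le> dist u v" if t: "t \<in> {0..1}" for t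
  proof -
    have "((x \<circ> ?\<gamma>) has_vector_derivative tangent ?\<gamma> t) (at t)"
      by (rule regular_tangent[OF reg[OF t]])
    from bounded_linear.has_vector_derivative[OF bounded_linear_fst this]
    have "((\<lambda>t. proj (?\<gamma> t)) has_vector_derivative fst (tangent ?\<gamma> t)) (at t)" by (simp add: proj_def o_def)
    then have "(?l has_vector_derivative fst (tangent ?\<gamma> t)) (at t)"
    proof (rule has_vector_derivative_transform_within_open[of _ _ _ "?l -` ball a R"])
      show "open (?l -` ball a R)" by (rule open_vimage[OF open_ball]) (intro continuous_intros)
    qed (use line[OF t] pg in auto)
    moreover have "(?l has_vector_derivative v - u) (at t)" by (auto intro!: derivative_eq_intros)
    ultimately have "fst (tangent ?\<gamma> t) = v - u" by (rule vector_derivative_unique_at)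
    then have "lorentz (tangent ?\<gamma> t) (tangent ?\<gamma> t) \<le> (norm (v - u))\<^sup>2"
      by (simp add: lorentz_def power2_norm_eq_inner)
    then have "speed ?\<gamma> t \<le> sqrt ((norm (v - u))\<^sup>2)" unfolding speed_def by (rule real_sqrt_le_mono)
    then show ?thesis by (simp add: dist_norm norm_minus_commute)
  qed
  have "rdist (g u) (g v) \<le> curve_length \<A> x ?\<gamma>" by (rule rdist_le[OF cv])
  also have "\<dots> \<le> integral {0..1} (\<lambda>t::real. dist u v)"
    unfolding curve_length_speed
    by (rule integral_le) (use sp length_has_integral cv in \<open>auto intro: has_integral_integrable\<close>)
  finally show ?thesis by simp
qed

lemma mtopology_limit:
  assumes "limitin (Metric_space.mtopology UNIV rdist) \<sigma> q sequentially"
  shows "\<sigma> \<longlonglongrightarrow> q"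
proof (rule topological_tendstoI)
  interpret M: Metric_space UNIV rdist by (rule Metric_space_rdist)
  fix U assume U: "open U" "q \<in> U"
  obtain \<delta> where \<delta>: "\<delta> > 0" "\<And>r. rdist q r < \<delta> \<Longrightarrow> r \<in> U" using rdist_nbhd[OF U] by blast
  have "\<forall>\<^sub>F k in sequentially. rdist (\<sigma> k) q < \<delta>"
    using assms \<delta>(1) unfolding M.limitin_metric by (auto elim: eventually_mono)
  then show "\<forall>\<^sub>F k in sequentially. \<sigma> k \<in> U"
    by (rule eventually_mono) (use \<delta>(2) M.commute in metis)
qed

theorem complete_projection_homeomorphism:
  assumes "complete_hypersurface \<A> x"
  shows "\<exists>G. homeomorphism UNIV UNIV proj G"
proof -
  interpret M: Metric_space UNIV rdist by (rule Metric_space_rdist)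
  interpret complete_local_homeo proj
  proof
    show "continuous_on UNIV proj" by (rule continuous_proj)
    show "\<exists>W r h. open W \<and> p \<in> W \<and> r > 0 \<and> homeomorphism W (ball (proj p) r) proj h" for p
      using local_inverse[OF open_UNIV UNIV_I, of p] by metis
    show "connected (UNIV :: 'm set)" by (rule conn)
    fix R a g y assume R: "R > 0" and g: "section_on proj (ball a R) g" and y: "dist a y = R"
    \<comment> \<open>A sequence on the radius towards \<open>y\<close>. It is Cauchy, so by
      \<open>section_dist_le\<close> its lift is Cauchy for the Riemannian distance, and
      completeness supplies the limit.\<close>
    define \<sigma> where "\<sigma> k = a + (1 - 1 / real (Suc (Suc k))) *\<^sub>R (y - a)" for k :: nat
    have in_ball: "\<sigma> k \<in> ball a R" for k
    proof -
      have s: "0 \<le> 1 - 1 / real (Suc (Suc k))" "1 - 1 / real (Suc (Suc k)) < 1" by simp_all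
      have "dist a (\<sigma> k) = (1 - 1 / real (Suc (Suc k))) * R"
        using s(1) y by (simp add: \<sigma>_def dist_norm norm_minus_commute)
      also have "\<dots> < 1 * R" using s(2) R by (rule mult_strict_right_mono)
      finally show ?thesis by simp
    qed
    have "(\<lambda>k. 1 / real (Suc (Suc k))) \<longlonglongrightarrow> 0"
      using LIMSEQ_Suc[OF LIMSEQ_inverse_real_of_nat] by (simp add: inverse_eq_divide)
    then have "\<sigma> \<longlonglongrightarrow> a + (1 - 0) *\<^sub>R (y - a)" unfolding \<sigma>_def[abs_def] by (intro tendsto_intros)
    then have \<sigma>: "\<sigma> \<longlonglongrightarrow> y" by simp
    have "M.MCauchy (\<lambda>k. g (\<sigma> k))"
      unfolding M.MCauchy_def
    proof (intro conjI allI impI)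
      fix e :: real assume "e > 0"
      then obtain K where "\<forall>m\<ge>K. \<forall>n\<ge>K. dist (\<sigma> m) (\<sigma> n) < e"
        using LIMSEQ_imp_Cauchy[OF \<sigma>] unfolding Cauchy_def by blast
      then show "\<exists>K. \<forall>n n'. K \<le> n \<longrightarrow> K \<le> n' \<longrightarrow> rdist (g (\<sigma> n)) (g (\<sigma> n')) < e"
        using section_dist_le[OF g in_ball in_ball] by (meson order_le_less_trans)
    qed simp
    then obtain q where "limitin M.mtopology (\<lambda>k. g (\<sigma> k)) q sequentially"
      using assms unfolding complete_hypersurface_def M.mcomplete_def by blast
    from mtopology_limit[OF this] show "\<exists>\<sigma> q. (\<forall>k::nat. \<sigma> k \<in> ball a R) \<and> \<sigma> \<longlonglongrightarrow> y \<and> (\<lambda>k. g (\<sigma> k)) \<longlonglongrightarrow> q"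
      using in_ball \<sigma> by blast
  qed
  show ?thesis by (rule homeomorphism_UNIV)
qed

end

section \<open>The rigidity theorem\<close>

lemma lorentz_isometry_affine:
  fixes R :: "'n::finite lorentz_space \<Rightarrow> 'n lorentz_space"
  assumes R: "bounded_linear R" "\<And>X. R (R X) = X" "\<And>X Y. lorentz (R X) (R Y) = lorentz X Y"
  shows "lorentz_isometry (\<lambda>X. R X + b)"
proof -
  have l: "linear R" using R(1) by (rule bounded_linear.linear)
  have inv1: "R (R X + b - b) = X" "R (R (X - b)) + b = X" for X using R(2) by simp_all
  have inv: "inv (\<lambda>X. R X + b) = (\<lambda>X. R X - R b)"
    by (rule inv_equality) (simp_all add: linear_add[OF l] linear_diff[OF l] R(2))
  have "bij (\<lambda>X. R X + b)"
    by (rule bij_betw_byWitness[where f' = "\<lambda>X. R (X - b)"]) (use inv1 in auto)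
  moreover have "smooth_on UNIV (\<lambda>X. R X + b)"
    by (intro smooth_on_add smooth_on_linear_UNIV smooth_on_const R(1) open_UNIV)
  moreover have "smooth_on UNIV (\<lambda>X. R X - R b)"
    by (intro smooth_on_diff smooth_on_linear_UNIV smooth_on_const R(1) open_UNIV)
  moreover have "frechet_derivative (\<lambda>X. R X + b) (at X) = R" for X
  proof -
    have "((\<lambda>X. R X + b) has_derivative R) (at X)"
      using has_derivative_add[OF bounded_linear_imp_has_derivative[OF R(1)] has_derivative_const[of b]] by simp
    then show ?thesis by (rule frechet_derivative_at[symmetric])
  qed
  ultimately show ?thesis by (simp add: lorentz_isometry_def inv R(3))
qed

text \<open>The projection is onto, so the image of \<open>x\<close> meets every fibre of
  \<open>fst\<close>. If \<open>P\<close> has at most one point in each, the image is all of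
  \<open>P\<close> and the inverse factors through \<open>fst\<close>.\<close>

lemma (in spacelike) homeomorphism_onto_graph:
  assumes G: "homeomorphism UNIV UNIV proj G"
    and P: "\<And>p. x p \<in> P" "\<And>X Y. X \<in> P \<Longrightarrow> Y \<in> P \<Longrightarrow> fst X = fst Y \<Longrightarrow> X = Y"
  shows "homeomorphism UNIV P x (\<lambda>X. G (fst X))"
proof (rule homeomorphismI)
  have pG: "proj (G y) = y" and Gp: "G (proj p) = p" for y p using G by (auto simp: homeomorphism_def)
  have cG: "continuous_on UNIV G" using G by (simp add: homeomorphism_def)
  show "continuous_on UNIV x" by (rule continuous_x)
  show "continuous_on P (\<lambda>X. G (fst X))"
    by (rule continuous_on_compose2[OF cG]) (auto intro!: continuous_intros)
  show "x ` UNIV \<subseteq> P" using P(1) by blast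
  show "G (fst (x p)) = p" for p using Gp[of p] by (simp add: proj_def)
  show "x (G (fst X)) = X" if "X \<in> P" for X
    using P(2)[OF P(1) that] pG[of "fst X"] by (simp add: proj_def)
qed simp

context pinched_spacelike
begin

lemma hyperplane_isometric:
  assumes G: "homeomorphism UNIV UNIV proj G" and k: "\<kappa> p0 = 0"
  shows "isometric_to x standard_hyperplane"
proof -
  define N0 where "N0 = N p0"
  define w0 where "w0 = lorentz (x p0) N0"
  have w: "lorentz (x p) N0 = w0" for p using flat_case(2)[OF k] by (simp add: w0_def N0_def)
  obtain R :: "'n lorentz_space \<Rightarrow> 'n lorentz_space" and \<epsilon> where R: "bounded_linear R" "\<And>X. R (R X) = X"
    "\<And>X Y. lorentz (R X) (R Y) = lorentz X Y" "R N0 = (0, \<epsilon>)" "\<epsilon> = 1 \<or> \<epsilon> = -1"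
    using adapted_reflection[of p0] unfolding N0_def by metis
  have l: "linear R" using R(1) by (rule bounded_linear.linear)
  have LN: "lorentz X N0 = - \<epsilon> * snd (R X)" for X
    using R(3)[of X N0] by (simp add: R(4) lorentz_def mult.commute)
  \<comment> \<open>By \<open>LN\<close> the reflection carries \<langle>X, N0\<rangle> = w0 to a
    level of the last coordinate, and \<open>d\<close> is that level. \<open>?F\<close> first lifts
    the standard hyperplane to it and then applies the involution \<open>R\<close>.\<close>
  define d where "d = - \<epsilon> * w0"
  let ?F = "\<lambda>X. R X + R (0, d)"
  let ?P = "{X. lorentz X N0 = w0}"
  have e: "\<epsilon> * \<epsilon> = 1" using R(5) by auto
  have d: "- \<epsilon> * d = w0" using e by (simp add: d_def mult.assoc[symmetric])
  have im: "?F ` standard_hyperplane = ?P"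
  proof
    show "?F ` standard_hyperplane \<subseteq> ?P"
      using d by (auto simp: standard_hyperplane_def LN linear_add[OF l] R(2))
    show "?P \<subseteq> ?F ` standard_hyperplane"
    proof
      fix X assume "X \<in> ?P"
      then have "- \<epsilon> * snd (R X) = w0" by (simp add: LN)
      then have "snd (R X) = d" using d R(5) by auto
      then have "R X - (0, d) \<in> standard_hyperplane" by (simp add: standard_hyperplane_def)
      moreover have "X = ?F (R X - (0, d))" by (simp add: linear_diff[OF l] R(2))
      ultimately show "X \<in> ?F ` standard_hyperplane" by blast
    qed
  qed
  have "snd N0 \<noteq> 0"
  proof
    assume "snd N0 = 0"
    then have "fst N0 \<bullet> fst N0 = -1" using N_unit[of p0] by (simp add: N0_def lorentz_def)
    then show False using inner_ge_zero[of "fst N0"] by linarith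
  qed
  then have "X = Y" if "X \<in> ?P" "Y \<in> ?P" "fst X = fst Y" for X Y
    using that by (auto simp: lorentz_def prod_eq_iff)
  then have "homeomorphism UNIV (?F ` standard_hyperplane) x (\<lambda>X. G (fst X))"
    unfolding im by (intro homeomorphism_onto_graph[OF G]) (use w in auto)
  then show ?thesis
    unfolding isometric_to_def using lorentz_isometry_affine[OF R(1-3)] by blast
qed

lemma hyperbolic_isometric:
  assumes G: "homeomorphism UNIV UNIV proj G" and k: "\<kappa> p0 \<noteq> 0"
  shows "\<exists>r>0. r \<ge> (real CARD('n) / 2) powr (1 / 4) \<and> isometric_to x (hyperbolic_space r)"
proof -
  obtain \<rho> where \<rho>: "\<rho> \<noteq> 0" "\<And>p. x p = \<rho> *\<^sub>R N p" "real CARD('n) \<le> 2 * \<rho> ^ 4"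
    using spherical_case[OF k] by metis
  define r where "r = \<bar>\<rho>\<bar>"
  have r: "r > 0" using \<rho>(1) by (simp add: r_def)
  have xx: "lorentz (x p) (x p) = - r\<^sup>2" for p
    by (simp add: \<rho>(2) lorentz_scaleR_left lorentz_scaleR_right N_unit r_def power2_eq_square)
  have sq: "(snd X)\<^sup>2 = fst X \<bullet> fst X + r\<^sup>2" if "lorentz X X = - r\<^sup>2" for X :: "'n lorentz_space"
    using that by (simp add: lorentz_def power2_eq_square)
  have nz: "snd (x p) \<noteq> 0" for p
  proof
    assume "snd (x p) = 0"
    then have "fst (x p) \<bullet> fst (x p) + r\<^sup>2 = 0" using sq[OF xx[of p]] by simp
    then show False using r inner_ge_zero[of "fst (x p)"] zero_less_power[OF r, of 2] by linarith
  qed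
  \<comment> \<open>The last coordinate never vanishes and the hypersurface is connected, so
    \<open>s\<close> selects one sheet. If it is the lower one, the isometry X \<mapsto> - X takes
    \<open>hyperbolic_space r\<close> there.\<close>
  define s where "s = sgn (snd (x p0))"
  have s: "s * s = 1" "s = 1 \<or> s = -1" using nz[of p0] by (auto simp: s_def sgn_if)
  have pos: "s * snd (x p) > 0" for p
  proof (rule ccontr)
    assume neg: "\<not> s * snd (x p) > 0"
    have c: "continuous_on UNIV (\<lambda>p. s * snd (x p))" by (intro continuous_intros continuous_x)
    have "connected (range (\<lambda>p. s * snd (x p)))" by (rule connected_continuous_image[OF c conn])
    moreover have "s * snd (x p0) > 0" using nz[of p0] by (simp add: s_def sgn_if)
    ultimately have "0 \<in> range (\<lambda>p. s * snd (x p))"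
      using neg unfolding connected_iff_interval by (meson less_imp_le not_le rangeI)
    then show False using nz s by auto
  qed
  let ?P = "{X :: 'n lorentz_space. lorentz X X = - r\<^sup>2 \<and> s * snd X > 0}"
  have "isometric_to x (hyperbolic_space r)"
  proof -
    let ?F = "\<lambda>X. s *\<^sub>R X + 0"
    have iso: "lorentz_isometry ?F"
      by (rule lorentz_isometry_affine)
        (simp_all add: bounded_linear_scaleR_right s(1) lorentz_scaleR_left lorentz_scaleR_right mult.assoc[symmetric])
    have im: "?F ` hyperbolic_space r = ?P"
    proof
      show "?F ` hyperbolic_space r \<subseteq> ?P"
        by (intro image_subsetI)
          (simp add: hyperbolic_space_def lorentz_scaleR_left lorentz_scaleR_right mult.assoc[symmetric] s(1))
      show "?P \<subseteq> ?F ` hyperbolic_space r"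
      proof
        fix X assume X: "X \<in> ?P"
        then have "s *\<^sub>R X \<in> hyperbolic_space r"
          by (simp add: hyperbolic_space_def lorentz_scaleR_left lorentz_scaleR_right mult.assoc[symmetric] s(1))
        moreover have "X = ?F (s *\<^sub>R X)" by (simp add: s(1))
        ultimately show "X \<in> ?F ` hyperbolic_space r" by blast
      qed
    qed
    have "X = Y" if "X \<in> ?P" "Y \<in> ?P" "fst X = fst Y" for X Y
    proof -
      have "(s * snd X)\<^sup>2 = (s * snd Y)\<^sup>2" using sq[of X] sq[of Y] that by (simp add: power_mult_distrib)
      then have "s * snd X = s * snd Y" using that by (simp add: power2_eq_iff_nonneg)
      then show ?thesis using that(3) s(2) by (auto simp: prod_eq_iff)
    qed
    then have "homeomorphism UNIV (?F ` hyperbolic_space r) x (\<lambda>X. G (fst X))"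
      unfolding im by (intro homeomorphism_onto_graph[OF G]) (use xx pos in auto)
    then show ?thesis unfolding isometric_to_def using iso by blast
  qed
  moreover have "(real CARD('n) / 2) powr (1 / 4) \<le> r"
  proof -
    have "real CARD('n) / 2 \<le> r ^ 4" using \<rho>(3) by (simp add: r_def)
    then have "(real CARD('n) / 2) powr (1 / 4) \<le> (r ^ 4) powr (1 / 4)" by (intro powr_mono2) auto
    also have "r ^ 4 = r powr 4" using powr_realpow[OF r, of 4] by simp
    also have "(r powr 4) powr (1 / 4) = r" unfolding powr_powr using r by simp
    finally show ?thesis .
  qed
  ultimately show ?thesis using r by blast
qed

end

theorem corollary1p5:
  fixes \<A> :: "('n::finite, 'm::{t2_space, second_countable_topology}) param set"
    and x N :: "'m \<Rightarrow> 'n lorentz_space"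
    and l :: real
    and n :: nat
    and H S :: "'m \<Rightarrow> real"
    and A :: "'m \<Rightarrow> real ^ 'n \<Rightarrow> real ^ 'n"
  defines "n \<equiv> CARD('n)"
    and "H \<equiv> mean_curvature \<A> x N"
    and "S \<equiv> sq_norm_sff \<A> x N"
    and "A \<equiv> shape_operator \<A> x N"
  assumes "n \<ge> 2"
    and "spacelike_hypersurface \<A> x"
    and "complete_hypersurface \<A> x"
    and "unit_normal_field \<A> x N"
    and "lambda_hypersurface \<A> x N l"
    and "\<exists>c. \<forall>p. S p - (H p)\<^sup>2 / n = c"
    and "\<forall>p. pos_semidef \<A> x p
           (\<lambda>v. 4 *\<^sub>R A p (A p v) - (4 * H p / n) *\<^sub>R A p v + (S p - (H p)\<^sup>2 / n) *\<^sub>R v)"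
    and "\<forall>p. (sqrt (S p - (H p)\<^sup>2 / n) - \<bar>l\<bar> * ((real n - 2) / (2 * sqrt (real n * (real n - 1)))))\<^sup>2
           + (H p - l)\<^sup>2 / n - n * l\<^sup>2 / (4 * (real n - 1)) \<ge> 0"
  shows "(\<exists>r>0. r \<ge> (real n / 2) powr (1 / 4) \<and> isometric_to x (hyperbolic_space r))
         \<or> isometric_to x standard_hyperplane"
proof -
  obtain B where B: "\<And>p. S p - (H p)\<^sup>2 / n = B" using assms(10) by blast
  interpret pinched_spacelike \<A> x N l B
  proof
    show "spacelike_hypersurface \<A> x" "unit_normal_field \<A> x N" "lambda_hypersurface \<A> x N l" by fact+
    show "CARD('n) \<ge> 2" using assms(5) by (simp add: n_def)
    show "sq_norm_sff \<A> x N p - (mean_curvature \<A> x N p)\<^sup>2 / real CARD('n) = B" for p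
      using B[of p] unfolding n_def H_def S_def .
    show "pos_semidef \<A> x p (\<lambda>v. 4 *\<^sub>R shape_operator \<A> x N p (shape_operator \<A> x N p v)
        - (4 * mean_curvature \<A> x N p / real CARD('n)) *\<^sub>R shape_operator \<A> x N p v + B *\<^sub>R v)" for p
      using assms(11)[rule_format, of p] unfolding B unfolding n_def H_def A_def .
    show "(sqrt B - \<bar>l\<bar> * ((real CARD('n) - 2) / (2 * sqrt (real CARD('n) * (real CARD('n) - 1)))))\<^sup>2
        + (mean_curvature \<A> x N p - l)\<^sup>2 / real CARD('n) - real CARD('n) * l\<^sup>2 / (4 * (real CARD('n) - 1)) \<ge> 0" for p
      using assms(12)[rule_format, of p] unfolding B unfolding n_def H_def .
  qed
  obtain G where G: "homeomorphism UNIV UNIV proj G"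
    using complete_projection_homeomorphism[OF assms(7)] by blast
  show ?thesis
  \<comment> \<open>\<open>\<kappa>\<close> is constant, so an arbitrary point decides between the
    two cases.\<close>
  proof (cases "\<kappa> undefined = 0")
    case True
    then show ?thesis using hyperplane_isometric[OF G] by blast
  next
    case False
    then show ?thesis using hyperbolic_isometric[OF G] unfolding n_def by blast
  qed
qed

end
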